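(* Let $k\geq 3$ and let $G=G_k$ be the graph with vertex set $\{x_1,\dots,x_k,y_1,\dots,y_k\}$ and edge set $$E(G)=\{\{x_2,y_i\}:1\leq i\leq k,\ i\neq 2\}\cup\{\{x_j,y_2\}:1\leq j\leq k,\ j\neq 2\}\cup\{\{x_m,y_m\}:1\leq m\leq k,\ m\neq 2\}$$ (the Levi graph of a Hirzebruch quasi-pencil of $k$ lines in $\mathbb{P}^2_{\mathbb{C}}$). Let $S$ be the polynomial ring over a field $\mathbb{K}$ in variables $a_v,b_v$ ($v\in V(G)$) and $J_G$ the binomial edge ideal of $G$. Then $S/J_G$ is not Cohen–Macaulay. Moreover, if $k=3$ then $\dim(S/J_G)-\operatorname{depth}(S/J_G)=1$, and if $k\geq 4$ then $\dim(S/J_G)-\operatorname{depth}(S/J_G)\geq k-3$.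
   Context: For a graph $G$ with vertices labelled $1,\dots,n$, the binomial edge ideal $J_G\subseteq \mathbb{K}[a_1,\dots,a_n,b_1,\dots,b_n]$ is generated by $a_ib_j-a_jb_i$ for all edges $\{i,j\}$ with $i<j$. The quantity $\dim(S/J_G)-\operatorname{depth}(S/J_G)$ is called the Cohen–Macaulay defect. *)

theory Defs
  imports Main "HOL-Library.Poly_Mapping" "HOL-Library.Extended_Nat"
begin

text \<open>Polynomial ring K[a_v, b_v : v a vertex]: variables are indexed by
  'v \<times> bool, where (v, True) is a_v and (v, False) is b_v.  A polynomial is a
  finitely supported map from monomials (exponent vectors) to coefficients.\<close>

type_synonym ('v, 'k) bpoly = "(('v \<times> bool) \<Rightarrow>\<^sub>0 nat) \<Rightarrow>\<^sub>0 'k"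

definition pvar :: "'a \<Rightarrow> (('a \<Rightarrow>\<^sub>0 nat) \<Rightarrow>\<^sub>0 'k::comm_ring_1)" where
  "pvar v = Poly_Mapping.single (Poly_Mapping.single v 1) 1"

definition avar :: "'v \<Rightarrow> ('v, 'k::comm_ring_1) bpoly" where
  "avar v = pvar (v, True)"

definition bvar :: "'v \<Rightarrow> ('v, 'k::comm_ring_1) bpoly" where
  "bvar v = pvar (v, False)"

definition is_ideal :: "'a::comm_ring_1 set \<Rightarrow> bool" where
  "is_ideal I \<longleftrightarrow> 0 \<in> I \<and> (\<forall>a\<in>I. \<forall>b\<in>I. a + b \<in> I) \<and> (\<forall>r. \<forall>a\<in>I. r * a \<in> I)"

definition ideal_gen :: "'a::comm_ring_1 set \<Rightarrow> 'a set" where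
  "ideal_gen G = \<Inter>{I. is_ideal I \<and> G \<subseteq> I}"

definition prime_ideal :: "'a::comm_ring_1 set \<Rightarrow> bool" where
  "prime_ideal P \<longleftrightarrow> is_ideal P \<and> 1 \<notin> P \<and> (\<forall>a b. a * b \<in> P \<longrightarrow> a \<in> P \<or> b \<in> P)"

definition krull_dim_quot :: "'a::comm_ring_1 set \<Rightarrow> enat" where
  "krull_dim_quot I = Sup {enat n | n. \<exists>P :: nat \<Rightarrow> 'a set.
      (\<forall>i\<le>n. prime_ideal (P i) \<and> I \<subseteq> P i) \<and> (\<forall>i<n. P i \<subset> P (Suc i))}"

definition regular_seq_quot :: "'a::comm_ring_1 set \<Rightarrow> 'a set \<Rightarrow> 'a list \<Rightarrow> bool" where
  "regular_seq_quot I m fs \<longleftrightarrow> set fs \<subseteq> m \<and>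
     (\<forall>i<length fs. \<forall>g. fs ! i * g \<in> ideal_gen (I \<union> set (take i fs))
                         \<longrightarrow> g \<in> ideal_gen (I \<union> set (take i fs))) \<and>
     1 \<notin> ideal_gen (I \<union> set fs)"

definition depth_quot :: "'a::comm_ring_1 set \<Rightarrow> 'a set \<Rightarrow> enat" where
  "depth_quot m I = Sup {enat (length fs) | fs. regular_seq_quot I m fs}"

definition max_ideal_S :: "('v, 'k::comm_ring_1) bpoly set" where
  "max_ideal_S = ideal_gen (range avar \<union> range bvar)"

text \<open>Binomial edge ideal of the graph with edge relation E (symmetric):
  generated by a_u b_v - a_v b_u for edges {u,v}.  Including both orientations
  only changes signs of generators, so the ideal is the same as with u < v.\<close>

definition binomial_edge_ideal :: "('v \<Rightarrow> 'v \<Rightarrow> bool) \<Rightarrow> ('v, 'k::comm_ring_1) bpoly set" where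
  "binomial_edge_ideal E = ideal_gen {avar u * bvar v - avar v * bvar u | u v. E u v}"

definition S_dim :: "('v, 'k::comm_ring_1) bpoly set \<Rightarrow> enat" where
  "S_dim I = krull_dim_quot I"

definition S_depth :: "('v, 'k::comm_ring_1) bpoly set \<Rightarrow> enat" where
  "S_depth I = depth_quot max_ideal_S I"

definition cohen_macaulay_quot :: "('v, 'k::comm_ring_1) bpoly set \<Rightarrow> bool" where
  "cohen_macaulay_quot I \<longleftrightarrow> S_depth I = S_dim I"

definition Gk_edge :: "nat \<Rightarrow> (nat \<Rightarrow> 'v) \<Rightarrow> (nat \<Rightarrow> 'v) \<Rightarrow> 'v \<Rightarrow> 'v \<Rightarrow> bool" where
  "Gk_edge k x y u v \<longleftrightarrow>
     (\<exists>i\<in>{1..k}. i \<noteq> 2 \<and> ({u, v} = {x 2, y i} \<or> {u, v} = {x i, y 2} \<or> {u, v} = {x i, y i}))"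

end

theory Submission
  imports Defs "HOL-Library.FuncSet" "HOL-Library.Multiset"
begin

text \<open>
  \<^bold>\<open>Depth.\<close> If \<open>P\<close> annihilates an element \<open>u\<close> of \<open>S/J\<close>, then \<open>depth S/J \<le> dim S/P\<close>: after replacing a
  regular sequence by high powers \<open>u\<close> lies outside the ideal it generates, and then a polynomial relation
  with coefficients in \<open>K\<close> between its members modulo \<open>P\<close> would make \<open>u\<close> vanish. Longer sequences are algebraically
  dependent modulo \<open>P\<close>, because modulo the minors there are only \<open>O(D\<^sup>d)\<close> monomials of degree \<open>\<le> D\<close>.
  The cut \<open>{y\<^sub>1, y\<^sub>2}\<close>, which isolates \<open>x\<^sub>1\<close>, gives \<open>depth \<le> 2k\<close>.

  \<^bold>\<open>Dimension.\<close> The cut \<open>{x\<^sub>2, y\<^sub>2}\<close> gives \<open>dim \<ge> 3k - 3\<close> and the empty cut gives \<open>dim \<ge> 2k + 1\<close>.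

  \<^bold>\<open>The case k = 3.\<close> Here \<open>G\<close> is a 6-cycle. Every prime over \<open>J\<close> contains the minors of a vertex
  partition with few classes, so the same counting gives \<open>dim \<le> 7\<close>. For \<open>depth \<ge> 6\<close> the forms
  \<open>\<theta>\<^sub>j = a\<^sub>j - b\<^bsub>j+1\<^esub>\<close> form a regular sequence, because \<open>S/J\<close> is free over \<open>K[\<theta>]\<close>: modulo the \<open>\<theta>\<close>'s the ring is
  \<open>K[z\<^sub>j]/(z\<^sub>j\<^sup>2 - z\<^bsub>j-1\<^esub> z\<^bsub>j+1\<^esub>)\<close>, whose monomials are sorted out by chip firing, and the resulting spanning set
  is matched injectively with monomials that combinatorial invariants show to be independent modulo \<open>J\<close>.\<close>

section \<open>Ideals and regular sequences\<close>

text \<open>Depth and dimension are suprema over arbitrary sequences and chains, with no homogeneity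
  to exploit, so both upper bounds pass through one statement: power products of the chosen elements
  stay linearly independent over K after multiplication by a test element \<open>u\<close>. Regular
  sequences are first raised to powers because \<open>u\<close> itself may lie in the ideal they
  generate; an evaluation that kills J but not \<open>u\<close> tells which power suffices. The
  count attached to a cut is (vertices left) + (classes): {y_1, y_2} and {x_2, y_2} both remove two
  vertices, but the former leaves two classes and the latter k - 1, whence the gap k - 3. Freeness
  over K[\<theta>] needs no Groebner basis: for every degree bound D the spanning family is injected
  into a family of monomials independent modulo J, and a finite spanning family no larger than an
  independent one is itself independent. Firing preserves the number of chips and their position sum
  modulo 6, which is why six classes remain in each degree from 6 on.\<close>

lemma is_ideal_zero: "is_ideal I \<Longrightarrow> 0 \<in> I"
  and is_ideal_add: "is_ideal I \<Longrightarrow> a \<in> I \<Longrightarrow> b \<in> I \<Longrightarrow> a + b \<in> I"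
  and is_ideal_mult: "is_ideal I \<Longrightarrow> a \<in> I \<Longrightarrow> r * a \<in> I"
  by (auto simp: is_ideal_def)

lemma is_ideal_mult_right: "is_ideal I \<Longrightarrow> a \<in> I \<Longrightarrow> a * r \<in> I"
  using is_ideal_mult[of I a r] by (simp add: mult.commute)

lemma is_ideal_minus: "is_ideal I \<Longrightarrow> a \<in> I \<Longrightarrow> - a \<in> I"
  using is_ideal_mult[of I a "-1"] by simp

lemma is_ideal_diff: "is_ideal I \<Longrightarrow> a \<in> I \<Longrightarrow> b \<in> I \<Longrightarrow> a - b \<in> I"
  using is_ideal_add[of I a "- b"] is_ideal_minus[of I b] by simp

lemma is_ideal_sum: "is_ideal I \<Longrightarrow> (\<And>i. i \<in> A \<Longrightarrow> f i \<in> I) \<Longrightarrow> sum f A \<in> I"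
  by (induction A rule: infinite_finite_induct) (auto intro: is_ideal_zero is_ideal_add)

lemma is_ideal_cong: "is_ideal I \<Longrightarrow> a - b \<in> I \<Longrightarrow> a \<in> I \<longleftrightarrow> b \<in> I"
  using is_ideal_diff[of I a "a - b"] is_ideal_add[of I "a - b" b] by auto

lemma is_ideal_gen: "is_ideal (ideal_gen G)"
  unfolding ideal_gen_def is_ideal_def by blast

lemma ideal_gen_superset: "G \<subseteq> ideal_gen G"
  unfolding ideal_gen_def by blast

lemma ideal_gen_least: "is_ideal I \<Longrightarrow> G \<subseteq> I \<Longrightarrow> ideal_gen G \<subseteq> I"
  unfolding ideal_gen_def by blast

lemma ideal_gen_ideal: "is_ideal I \<Longrightarrow> ideal_gen I = I"
  by (meson dual_order.refl ideal_gen_least ideal_gen_superset subset_antisym)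

definition adjoin :: "'a::comm_ring_1 set \<Rightarrow> 'a \<Rightarrow> 'a set" where
  "adjoin I x = {a + r * x | a r. a \<in> I}"

lemma adjoinI: "a \<in> I \<Longrightarrow> a + r * x \<in> adjoin I x"
  by (auto simp: adjoin_def)

lemma is_ideal_adjoin:
  assumes "is_ideal I" shows "is_ideal (adjoin I x)"
  unfolding is_ideal_def
proof (intro conjI ballI allI)
  show "0 \<in> adjoin I x"
    using adjoinI[OF is_ideal_zero[OF assms], of 0 x] by simp
next
  fix g h assume "g \<in> adjoin I x" "h \<in> adjoin I x"
  then obtain a r b s where "g = a + r * x" "a \<in> I" "h = b + s * x" "b \<in> I"
    by (auto simp: adjoin_def)
  then have "g + h = (a + b) + (r + s) * x" "a + b \<in> I"
    by (auto simp: algebra_simps intro: is_ideal_add assms)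
  then show "g + h \<in> adjoin I x" using adjoinI by metis
next
  fix q g assume "g \<in> adjoin I x"
  then obtain a r where "g = a + r * x" "a \<in> I" by (auto simp: adjoin_def)
  then have "q * g = q * a + (q * r) * x" "q * a \<in> I"
    using is_ideal_mult[OF assms] by (auto simp: distrib_left mult.assoc)
  then show "q * g \<in> adjoin I x" using adjoinI by metis
qed

lemma adjoin_superset: "I \<subseteq> adjoin I x"
  using adjoinI[of _ I 0 x] by auto

lemma adjoin_self: "is_ideal I \<Longrightarrow> x \<in> adjoin I x"
  using adjoinI[of 0 I 1 x] is_ideal_zero by auto

lemma adjoin_eq_gen:
  assumes "is_ideal I" shows "adjoin I x = ideal_gen (insert x I)"
proof
  have "insert x I \<subseteq> ideal_gen (insert x I)" by (rule ideal_gen_superset)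
  then show "adjoin I x \<subseteq> ideal_gen (insert x I)"
    by (auto simp: adjoin_def intro!: is_ideal_add is_ideal_mult is_ideal_gen)
  show "ideal_gen (insert x I) \<subseteq> adjoin I x"
    by (rule ideal_gen_least)
      (use assms is_ideal_adjoin adjoin_self adjoin_superset[of I x] in auto)
qed

section \<open>Regular sequences and their powers\<close>

definition nzd :: "'a::comm_ring_1 set \<Rightarrow> 'a \<Rightarrow> bool" where
  "nzd I x \<longleftrightarrow> (\<forall>g. x * g \<in> I \<longrightarrow> g \<in> I)"

text \<open>The quotients may vanish (weak regularity), so that \<open>reg_list_adjoin_power\<close>
  can start its induction at exponent 0, where the ideal is the whole ring.\<close>

fun reg_list :: "'a::comm_ring_1 set \<Rightarrow> 'a list \<Rightarrow> bool" where
  "reg_list I [] = True"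
| "reg_list I (f # fs) = (nzd I f \<and> reg_list (adjoin I f) fs)"

lemma reg_list_iff:
  "is_ideal I \<Longrightarrow> reg_list I fs \<longleftrightarrow> (\<forall>i<length fs. nzd (ideal_gen (I \<union> set (take i fs))) (fs ! i))"
proof (induction fs arbitrary: I)
  case (Cons f fs)
  have eq: "ideal_gen (adjoin I f \<union> A) = ideal_gen (I \<union> insert f A)" for A
  proof
    have "insert f I \<subseteq> ideal_gen (I \<union> insert f A)"
      using ideal_gen_superset[of "I \<union> insert f A"] by auto
    then have "adjoin I f \<subseteq> ideal_gen (I \<union> insert f A)"
      unfolding adjoin_eq_gen[OF Cons.prems] by (intro ideal_gen_least is_ideal_gen)
    then show "ideal_gen (adjoin I f \<union> A) \<subseteq> ideal_gen (I \<union> insert f A)"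
      using ideal_gen_superset[of "I \<union> insert f A"]
      by (intro ideal_gen_least is_ideal_gen) auto
    show "ideal_gen (I \<union> insert f A) \<subseteq> ideal_gen (adjoin I f \<union> A)"
      using ideal_gen_superset[of "adjoin I f \<union> A"] adjoin_self[OF Cons.prems] adjoin_superset[of I f]
      by (intro ideal_gen_least is_ideal_gen) auto
  qed
  have "reg_list I (f # fs) \<longleftrightarrow>
      nzd I f \<and> (\<forall>i<length fs. nzd (ideal_gen (adjoin I f \<union> set (take i fs))) (fs ! i))"
    using Cons.IH[OF is_ideal_adjoin[OF Cons.prems]] by simp
  also have "\<dots> \<longleftrightarrow> (\<forall>i<length (f # fs). nzd (ideal_gen (I \<union> set (take i (f # fs)))) ((f # fs) ! i))"
    unfolding eq length_Cons All_less_Suc2 by (simp add: ideal_gen_ideal[OF Cons.prems])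
  finally show ?case .
qed simp

text \<open>The triple below encodes an exact sequence
  \<open>0 \<rightarrow> R/A1 \<rightarrow> R/A2 \<rightarrow> R/A0 \<rightarrow> 0\<close> whose first map is multiplication by \<open>x\<close>; it stays exact
  modulo elements that are regular on the outer terms.\<close>

definition exact_triple :: "'a::comm_ring_1 \<Rightarrow> 'a set \<Rightarrow> 'a set \<Rightarrow> 'a set \<Rightarrow> bool" where
  "exact_triple x A0 A1 A2 \<longleftrightarrow> is_ideal A0 \<and> is_ideal A1 \<and> is_ideal A2 \<and> A0 = adjoin A2 x \<and>
     (\<forall>h. x * h \<in> A2 \<longleftrightarrow> h \<in> A1)"

text \<open>A fragment of the snake lemma: a class of R/A2 killed by \<open>y\<close> has zero image
  in R/A0, hence comes from R/A1, where it vanishes as well.\<close>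

lemma exact_triple_nzd:
  assumes t: "exact_triple x A0 A1 A2" and n0: "nzd A0 y" and n1: "nzd A1 y"
  shows "nzd A2 y"
  unfolding nzd_def
proof (intro allI impI)
  fix g assume g: "y * g \<in> A2"
  have A0: "A0 = adjoin A2 x" and i2: "is_ideal A2" and i1: "is_ideal A1"
    and x: "\<And>h. x * h \<in> A2 \<longleftrightarrow> h \<in> A1"
    using t by (auto simp: exact_triple_def)
  have "y * g \<in> A0" using g adjoin_superset A0 by blast
  then have "g \<in> A0" using n0 by (auto simp: nzd_def)
  then obtain a h where gh: "g = a + h * x" "a \<in> A2" unfolding A0 adjoin_def by auto
  have "x * (y * h) = y * g - y * a" using gh by (simp add: algebra_simps)
  then have "x * (y * h) \<in> A2" using g gh i2 is_ideal_diff is_ideal_mult by metis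
  then have "h \<in> A1" using x n1 by (auto simp: nzd_def)
  then have "x * h \<in> A2" using x by auto
  then show "g \<in> A2" using gh i2 is_ideal_add by (metis mult.commute)
qed

text \<open>Reduction modulo \<open>y\<close> could only break injectivity of the left map; the
  obstruction comes, via the connecting map, from elements of R/A0 killed by \<open>y\<close>, and
  there are none.\<close>

lemma exact_triple_adjoin:
  assumes t: "exact_triple x A0 A1 A2" and n0: "nzd A0 y"
  shows "exact_triple x (adjoin A0 y) (adjoin A1 y) (adjoin A2 y)"
proof -
  have A0: "A0 = adjoin A2 x" and i2: "is_ideal A2" and i1: "is_ideal A1" and i0: "is_ideal A0"
    and x: "\<And>h. x * h \<in> A2 \<longleftrightarrow> h \<in> A1"
    using t by (auto simp: exact_triple_def)
  have "adjoin (adjoin A2 x) y = adjoin (adjoin A2 y) x"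
  proof (intro set_eqI iffI)
    fix g assume "g \<in> adjoin (adjoin A2 x) y"
    then obtain a r s where "g = a + r * x + s * y" "a \<in> A2" by (auto simp: adjoin_def)
    then have "g = (a + s * y) + r * x" "a + s * y \<in> adjoin A2 y"
      by (auto simp: algebra_simps intro: adjoinI)
    then show "g \<in> adjoin (adjoin A2 y) x" by (auto simp: adjoin_def)
  next
    fix g assume "g \<in> adjoin (adjoin A2 y) x"
    then obtain a r s where "g = a + r * y + s * x" "a \<in> A2" by (auto simp: adjoin_def)
    then have "g = (a + s * x) + r * y" "a + s * x \<in> adjoin A2 x"
      by (auto simp: algebra_simps intro: adjoinI)
    then show "g \<in> adjoin (adjoin A2 x) y" by (auto simp: adjoin_def)
  qed
  moreover have "x * h \<in> adjoin A2 y \<longleftrightarrow> h \<in> adjoin A1 y" for h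
  proof
    assume "x * h \<in> adjoin A2 y"
    then obtain a c where ac: "x * h = a + c * y" "a \<in> A2" unfolding adjoin_def by auto
    have "y * c = - a + h * x" using ac by (simp add: algebra_simps)
    moreover have "- a + h * x \<in> A0" unfolding A0 using ac i2 by (intro adjoinI is_ideal_minus)
    ultimately have "c \<in> A0" using n0 by (auto simp: nzd_def)
    then obtain b d where bd: "c = b + d * x" "b \<in> A2" unfolding A0 adjoin_def by auto
    have "x * (h - d * y) = a + y * b" using ac bd by (simp add: algebra_simps)
    then have "x * (h - d * y) \<in> A2" using ac bd i2 by (simp add: is_ideal_add is_ideal_mult)
    then have "h - d * y \<in> A1" using x by blast
    from adjoinI[OF this, of d y] show "h \<in> adjoin A1 y" by simp
  next
    assume "h \<in> adjoin A1 y"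
    then obtain a c where ac: "h = a + c * y" "a \<in> A1" unfolding adjoin_def by auto
    have "x * a + (x * c) * y \<in> adjoin A2 y" using ac x by (intro adjoinI) auto
    then show "x * h \<in> adjoin A2 y" using ac by (simp add: algebra_simps)
  qed
  ultimately show ?thesis
    unfolding exact_triple_def using i0 i1 i2 A0 by (simp add: is_ideal_adjoin)
qed

lemma exact_triple_reg_list:
  "exact_triple x A0 A1 A2 \<Longrightarrow> reg_list A0 ys \<Longrightarrow> reg_list A1 ys \<Longrightarrow> reg_list A2 ys"
  by (induction ys arbitrary: A0 A1 A2) (auto intro: exact_triple_nzd dest: exact_triple_adjoin)

lemma nzdD: "nzd I x \<Longrightarrow> x * g \<in> I \<Longrightarrow> g \<in> I"
  by (auto simp: nzd_def)

lemma nzd_power: "nzd I x \<Longrightarrow> nzd I (x ^ n)"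
proof (induction n)
  case (Suc n)
  then have "g \<in> I" if "x ^ Suc n * g \<in> I" for g
    using that nzdD[of I x "x ^ n * g"] nzdD[of I "x ^ n" g] by (simp add: mult.assoc)
  then show ?case by (auto simp: nzd_def)
qed (simp add: nzd_def)

text \<open>Induction on \<open>n\<close> along 0 -> R/(A + x^n) -> R/(A + x^(n+1)) -> R/(A + x) ->
  0, where the first map is multiplication by \<open>x\<close>; it is injective because
  \<open>x\<close> is regular modulo \<open>A\<close>.\<close>

lemma reg_list_adjoin_power:
  assumes "is_ideal A" "nzd A x" "reg_list (adjoin A x) ys"
  shows "reg_list (adjoin A (x ^ n)) ys"
proof (induction n)
  case 0
  have "adjoin A 1 = UNIV"
  proof (intro set_eqI iffI UNIV_I)
    fix g :: 'a
    show "g \<in> adjoin A 1" using adjoinI[OF is_ideal_zero[OF assms(1)], of g 1] by simp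
  qed
  moreover have "adjoin UNIV y = UNIV" "nzd UNIV y" for y :: 'a
    using adjoin_superset[of UNIV y] by (auto simp: nzd_def)
  then have "reg_list UNIV ys" by (induction ys) simp_all
  ultimately show ?case by simp
next
  case (Suc n)
  have "exact_triple x (adjoin A x) (adjoin A (x ^ n)) (adjoin A (x ^ Suc n))"
    unfolding exact_triple_def
  proof (intro conjI allI is_ideal_adjoin assms)
    show "adjoin A x = adjoin (adjoin A (x ^ Suc n)) x"
    proof
      show "adjoin A x \<subseteq> adjoin (adjoin A (x ^ Suc n)) x"
      proof
        fix g assume "g \<in> adjoin A x"
        then obtain a r where "g = a + r * x" "a \<in> A" by (auto simp: adjoin_def)
        then show "g \<in> adjoin (adjoin A (x ^ Suc n)) x"
          using adjoinI[OF subsetD[OF adjoin_superset]] by simp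
      qed
      show "adjoin (adjoin A (x ^ Suc n)) x \<subseteq> adjoin A x"
      proof
        fix g assume "g \<in> adjoin (adjoin A (x ^ Suc n)) x"
        then obtain a r s where "g = a + r * x ^ Suc n + s * x" "a \<in> A" by (auto simp: adjoin_def)
        then have "g = a + (r * x ^ n + s) * x" "a \<in> A" by (auto simp: algebra_simps)
        then show "g \<in> adjoin A x" using adjoinI by blast
      qed
    qed
    fix h
    show "x * h \<in> adjoin A (x ^ Suc n) \<longleftrightarrow> h \<in> adjoin A (x ^ n)"
    proof
      assume "x * h \<in> adjoin A (x ^ Suc n)"
      then obtain a r where "x * h = a + r * x ^ Suc n" "a \<in> A" by (auto simp: adjoin_def)
      then have "x * (h - r * x ^ n) \<in> A" by (auto simp: algebra_simps)
      then have "h - r * x ^ n \<in> A" using assms(2) by (auto simp: nzd_def)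
      from adjoinI[OF this, of r "x ^ n"] show "h \<in> adjoin A (x ^ n)" by simp
    next
      assume "h \<in> adjoin A (x ^ n)"
      then obtain a r where "h = a + r * x ^ n" "a \<in> A" by (auto simp: adjoin_def)
      have "x * a + r * x ^ Suc n \<in> adjoin A (x ^ Suc n)"
        by (rule adjoinI[OF is_ideal_mult[OF assms(1) \<open>a \<in> A\<close>]])
      then show "x * h \<in> adjoin A (x ^ Suc n)"
        unfolding \<open>h = _\<close> by (simp add: algebra_simps)
    qed
  qed
  then show ?case using exact_triple_reg_list assms(3) Suc by blast
qed

lemma reg_list_powers: "is_ideal A \<Longrightarrow> reg_list A xs \<Longrightarrow> reg_list A (map (\<lambda>x. x ^ n) xs)"
proof (induction xs arbitrary: A)
  case (Cons x xs)
  then have "reg_list (adjoin A (x ^ n)) xs" by (auto intro: reg_list_adjoin_power)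
  with Cons show ?case by (auto intro: nzd_power is_ideal_adjoin)
qed simp

text \<open>A common abstraction of regular sequences and of elements chosen along a chain of primes.\<close>

fun tower :: "'a::comm_ring_1 set \<Rightarrow> 'a list \<Rightarrow> 'a set \<Rightarrow> bool" where
  "tower I [] L = (I \<subseteq> L)"
| "tower I (x # xs) L = (nzd I x \<and> (\<exists>I'. is_ideal I' \<and> I \<subseteq> I' \<and> x \<in> I' \<and> tower I' xs L))"

lemma tower_reg_list:
  "is_ideal I \<Longrightarrow> reg_list I xs \<Longrightarrow> is_ideal L \<Longrightarrow> I \<subseteq> L \<Longrightarrow> set xs \<subseteq> L \<Longrightarrow> tower I xs L"
proof (induction xs arbitrary: I)
  case (Cons x xs)
  have "adjoin I x \<subseteq> L"
    unfolding adjoin_eq_gen[OF Cons.prems(1)] using Cons.prems by (intro ideal_gen_least) auto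
  with Cons.prems have "tower (adjoin I x) xs L"
    by (intro Cons.IH is_ideal_adjoin) auto
  with Cons.prems show ?case
    using is_ideal_adjoin[of I x] adjoin_self[of I x] adjoin_superset[of I x] by auto
qed simp

fun pow_prod :: "'a::comm_monoid_mult list \<Rightarrow> nat list \<Rightarrow> 'a" where
  "pow_prod [] ns = 1"
| "pow_prod (x # xs) ns = x ^ hd ns * pow_prod xs (tl ns)"

section \<open>Linear algebra over the field\<close>

text \<open>Gaussian elimination: the unknowns are indexed by \<open>I\<close>, the equations by
  \<open>B\<close>, and each step spends one equation on a pivot unknown \<open>i0\<close>.\<close>

lemma homogeneous_system_nontrivial:
  fixes M :: "'i \<Rightarrow> 'b \<Rightarrow> 'k::field"
  assumes "finite B" "finite I" "card B < card I"
  shows "\<exists>c. (\<exists>i\<in>I. c i \<noteq> 0) \<and> (\<forall>b\<in>B. (\<Sum>i\<in>I. c i * M i b) = 0)"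
  using assms
proof (induction B arbitrary: I M)
  case empty
  then have "I \<noteq> {}" by auto
  then show ?case by (auto intro!: exI[of _ "\<lambda>_. 1"])
next
  case (insert b B)
  show ?case
  proof (cases "\<forall>i\<in>I. M i b = 0")
    case True
    have "card B < card I" using insert by simp
    from insert.IH[OF insert.prems(1) this, of M] True show ?thesis by auto
  next
    case False
    then obtain i0 where i0: "i0 \<in> I" "M i0 b \<noteq> 0" by auto
    let ?I = "I - {i0}"
    have "card B < card ?I" using insert i0 by (simp add: card_Diff_singleton)
    from insert.IH[OF _ this, of "\<lambda>i b'. M i b' - M i b / M i0 b * M i0 b'"] insert.prems
    obtain c where c: "\<exists>i\<in>?I. c i \<noteq> 0"
      "\<And>b'. b' \<in> B \<Longrightarrow> (\<Sum>i\<in>?I. c i * (M i b' - M i b / M i0 b * M i0 b')) = 0" by auto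
    \<comment> \<open>The value of the pivot unknown that solves equation \<open>b\<close> once the
      other unknowns are fixed.\<close>
    define e where "e = - (\<Sum>i\<in>?I. c i * (M i b / M i0 b))"
    have split: "(\<Sum>i\<in>I. (c(i0 := e)) i * M i b') = e * M i0 b' + (\<Sum>i\<in>?I. c i * M i b')" for b'
    proof -
      have "(\<Sum>i\<in>I. (c(i0 := e)) i * M i b') = (c(i0 := e)) i0 * M i0 b' + (\<Sum>i\<in>?I. (c(i0 := e)) i * M i b')"
        using insert.prems i0 by (intro sum.remove) auto
      also have "(\<Sum>i\<in>?I. (c(i0 := e)) i * M i b') = (\<Sum>i\<in>?I. c i * M i b')"
        by (intro sum.cong) auto
      finally show ?thesis by simp
    qed
    have "(\<Sum>i\<in>I. (c(i0 := e)) i * M i b') = (\<Sum>i\<in>?I. c i * (M i b' - M i b / M i0 b * M i0 b'))" for b'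
    proof -
      have "e * M i0 b' = - (\<Sum>i\<in>?I. c i * (M i b / M i0 b * M i0 b'))"
        by (simp add: e_def sum_distrib_right mult.assoc)
      then show ?thesis unfolding split by (simp add: right_diff_distrib sum_subtractf)
    qed
    then have "(\<Sum>i\<in>I. (c(i0 := e)) i * M i b') = 0" if "b' \<in> insert b B" for b'
      using that c(2) i0 by auto
    moreover have "\<exists>i\<in>I. (c(i0 := e)) i \<noteq> 0" using c(1) by auto
    ultimately show ?thesis by blast
  qed
qed

section \<open>Polynomials and algebraic independence\<close>

abbreviation "lookup \<equiv> Poly_Mapping.lookup"
abbreviation "keys \<equiv> Poly_Mapping.keys"

abbreviation (input) cst :: "'k \<Rightarrow> ('x \<Rightarrow>\<^sub>0 nat) \<Rightarrow>\<^sub>0 'k::comm_ring_1" where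
  "cst c \<equiv> Poly_Mapping.single 0 c"

abbreviation (input) mon :: "('x \<Rightarrow>\<^sub>0 nat) \<Rightarrow> ('x \<Rightarrow>\<^sub>0 nat) \<Rightarrow>\<^sub>0 'k::comm_ring_1" where
  "mon m \<equiv> Poly_Mapping.single m 1"

lemma cst_add: "cst (a + b) = cst a + cst b"
  and cst_mult: "cst (a * b) = cst a * cst b"
  and cst_diff: "cst (a - b) = cst a - cst b"
  by (simp_all add: single_add single_diff mult_single)

lemma cst_sum: "cst (sum f A) = (\<Sum>i\<in>A. cst (f i))"
  by (induction A rule: infinite_finite_induct) (simp_all add: single_add)

lemma cst_mono: "cst c * mon m = Poly_Mapping.single m c"
  by (simp add: mult_single)

lemma mono_add: "mon (m + n) = mon m * mon n"
  by (simp add: mult_single)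

lemma poly_mapping_expand: "p = (\<Sum>m\<in>keys p. cst (lookup p m) * mon m)"
proof (rule poly_mapping_eqI)
  fix n
  have "lookup (\<Sum>m\<in>keys p. cst (lookup p m) * mon m) n = (\<Sum>m\<in>keys p. if m = n then lookup p m else 0)"
    unfolding cst_mono lookup_sum by (intro sum.cong) (auto simp: lookup_single when_def)
  then show "lookup p n = lookup (\<Sum>m\<in>keys p. cst (lookup p m) * mon m) n"
    by (simp add: sum.delta' in_keys_iff)
qed

lemma is_ideal_unit_cst:
  fixes c :: "'k::field"
  assumes "is_ideal I" "c \<noteq> 0" "cst c * u \<in> I" shows "u \<in> I"
proof -
  have "cst (inverse c) * (cst c * u) = cst (inverse c * c) * u"
    by (simp add: cst_mult mult.assoc)
  then have "cst (inverse c) * (cst c * u) = u" using assms(2) by simp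
  then show ?thesis using is_ideal_mult[OF assms(1,3)] by metis
qed

text \<open>Cancel the lowest occurring power of the first element and reduce modulo the next ideal.\<close>

lemma tower_independent:
  fixes xs :: "(('x \<Rightarrow>\<^sub>0 nat) \<Rightarrow>\<^sub>0 'k::field) list"
  assumes "is_ideal I" "tower I xs L" "u \<notin> L"
    and "finite \<Gamma>" "\<And>\<gamma>. \<gamma> \<in> \<Gamma> \<Longrightarrow> length \<gamma> = length xs"
    and "(\<Sum>\<gamma>\<in>\<Gamma>. cst (c \<gamma>) * (pow_prod xs \<gamma> * u)) \<in> I"
  shows "\<gamma> \<in> \<Gamma> \<Longrightarrow> c \<gamma> = 0"
  using assms
proof (induction xs arbitrary: I \<Gamma> c \<gamma>)
  case Nil
  then have "\<gamma> = []" and "\<Gamma> = {[]}" by auto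
  with Nil have "cst (c []) * u \<in> I" by simp
  then have "c [] \<noteq> 0 \<Longrightarrow> u \<in> I" using Nil is_ideal_unit_cst by blast
  with Nil \<open>\<gamma> = []\<close> show ?case by auto
next
  case (Cons x xs)
  obtain I' where I': "is_ideal I'" "I \<subseteq> I'" "x \<in> I'" "tower I' xs L" and nz: "nzd I x"
    using Cons.prems(3) unfolding tower.simps by blast
  show ?case
  proof (rule ccontr)
    assume "c \<gamma> \<noteq> 0"
    \<comment> \<open>The smallest exponent of the first element with a nonzero coefficient:
      \<open>x ^ n\<close> factors out of the whole relation and can be cancelled modulo
      \<open>I\<close>.\<close>
    define n where "n = (LEAST n. \<exists>\<gamma>\<in>\<Gamma>. hd \<gamma> = n \<and> c \<gamma> \<noteq> 0)"
    have "\<exists>\<gamma>\<in>\<Gamma>. hd \<gamma> = n \<and> c \<gamma> \<noteq> 0"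
      unfolding n_def by (rule LeastI[of _ "hd \<gamma>"]) (use \<open>c \<gamma> \<noteq> 0\<close> Cons.prems(1) in auto)
    then obtain \<delta> where \<delta>: "\<delta> \<in> \<Gamma>" "hd \<delta> = n" "c \<delta> \<noteq> 0" by auto
    have low: "c \<gamma> = 0" if "\<gamma> \<in> \<Gamma>" "hd \<gamma> < n" for \<gamma>
      using that not_less_Least[of "hd \<gamma>" "\<lambda>n. \<exists>\<gamma>\<in>\<Gamma>. hd \<gamma> = n \<and> c \<gamma> \<noteq> 0"] unfolding n_def by auto
    define t where "t \<gamma> = cst (c \<gamma>) * (x ^ (hd \<gamma> - n) * (pow_prod xs (tl \<gamma>) * u))" for \<gamma>
    have "cst (c \<gamma>) * (pow_prod (x # xs) \<gamma> * u) = x ^ n * t \<gamma>" if "\<gamma> \<in> \<Gamma>" for \<gamma>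
    proof (cases "hd \<gamma> < n")
      case False
      then have "x ^ hd \<gamma> = x ^ n * x ^ (hd \<gamma> - n)" by (simp flip: power_add)
      then show ?thesis by (simp add: t_def algebra_simps)
    qed (use low[OF that] in \<open>simp add: t_def\<close>)
    then have "(\<Sum>\<gamma>\<in>\<Gamma>. cst (c \<gamma>) * (pow_prod (x # xs) \<gamma> * u)) = x ^ n * (\<Sum>\<gamma>\<in>\<Gamma>. t \<gamma>)"
      unfolding sum_distrib_left by (rule sum.cong[OF refl])
    then have tI: "(\<Sum>\<gamma>\<in>\<Gamma>. t \<gamma>) \<in> I"
      using nzd_power[OF nz, of n] Cons.prems(7) by (auto dest: nzdD)
    define \<Gamma>0 where "\<Gamma>0 = {\<gamma>\<in>\<Gamma>. hd \<gamma> = n}"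
    have "(\<Sum>\<gamma>\<in>\<Gamma>. t \<gamma>) = (\<Sum>\<gamma>\<in>\<Gamma>0. t \<gamma>) + (\<Sum>\<gamma>\<in>\<Gamma> - \<Gamma>0. t \<gamma>)"
      using Cons.prems(5) by (subst add.commute, intro sum.subset_diff) (auto simp: \<Gamma>0_def)
    \<comment> \<open>Terms with a higher exponent keep a factor \<open>x\<close> and vanish modulo
      \<open>I'\<close>; only \<open>\<Gamma>0\<close> is passed on to the induction.\<close>
    moreover have "(\<Sum>\<gamma>\<in>\<Gamma> - \<Gamma>0. t \<gamma>) \<in> I'"
    proof (rule is_ideal_sum[OF I'(1)])
      fix \<gamma> assume g: "\<gamma> \<in> \<Gamma> - \<Gamma>0"
      show "t \<gamma> \<in> I'"
      proof (cases "hd \<gamma> < n")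
        case True
        then show ?thesis using low g is_ideal_zero[OF I'(1)] by (simp add: t_def)
      next
        case False
        with g have "hd \<gamma> > n" by (auto simp: \<Gamma>0_def)
        then obtain j where "hd \<gamma> - n = Suc j" by (metis Suc_diff_Suc)
        then have "t \<gamma> = (cst (c \<gamma>) * (x ^ j * (pow_prod xs (tl \<gamma>) * u))) * x"
          by (simp add: t_def algebra_simps)
        then show ?thesis using is_ideal_mult[OF I'(1,3)] by metis
      qed
    qed
    ultimately have s0: "(\<Sum>\<gamma>\<in>\<Gamma>0. t \<gamma>) \<in> I'"
      using tI I'(1,2) is_ideal_diff[OF I'(1), of "\<Sum>\<gamma>\<in>\<Gamma>. t \<gamma>" "\<Sum>\<gamma>\<in>\<Gamma> - \<Gamma>0. t \<gamma>"] by auto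
    have len: "length \<gamma> = Suc (length xs)" if "\<gamma> \<in> \<Gamma>0" for \<gamma>
      using that Cons.prems(6) by (auto simp: \<Gamma>0_def)
    have split: "n # tl \<gamma> = \<gamma>" if "\<gamma> \<in> \<Gamma>0" for \<gamma>
      using len[OF that] that by (cases \<gamma>) (auto simp: \<Gamma>0_def)
    then have "inj_on tl \<Gamma>0" by (metis inj_onI)
    then have "(\<Sum>\<delta>\<in>tl ` \<Gamma>0. cst (c (n # \<delta>)) * (pow_prod xs \<delta> * u))
        = (\<Sum>\<gamma>\<in>\<Gamma>0. cst (c (n # tl \<gamma>)) * (pow_prod xs (tl \<gamma>) * u))"
      by (simp add: sum.reindex)
    also have "\<dots> = (\<Sum>\<gamma>\<in>\<Gamma>0. t \<gamma>)"
      by (intro sum.cong refl) (simp add: split, simp add: t_def \<Gamma>0_def)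
    finally have "(\<Sum>\<delta>\<in>tl ` \<Gamma>0. cst (c (n # \<delta>)) * (pow_prod xs \<delta> * u)) \<in> I'"
      using s0 by simp
    moreover have "\<delta> \<in> \<Gamma>0" using \<delta> by (auto simp: \<Gamma>0_def)
    ultimately have "c (n # tl \<delta>) = 0"
      using Cons.prems(5) len I' Cons.prems(4)
      by (intro Cons.IH[of "tl \<delta>" "tl ` \<Gamma>0" I' "\<lambda>\<delta>. c (n # \<delta>)"]) (auto simp: \<Gamma>0_def)
    then show False using split[OF \<open>\<delta> \<in> \<Gamma>0\<close>] \<delta> by simp
  qed
qed

text \<open>A kernel vector of the coefficient matrix gives the relation. This drives both counting
  arguments: algebraic dependence modulo minors, and independence of the normal forms of the
  6-cycle.\<close>

lemma dependent_modulo_ideal: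
  fixes v :: "'i \<Rightarrow> ('x \<Rightarrow>\<^sub>0 nat) \<Rightarrow>\<^sub>0 'k::field"
  assumes P: "is_ideal P" and fin: "finite B" "finite I" "card B < card I"
    and sp: "\<And>i. i \<in> I \<Longrightarrow> \<exists>c. v i - (\<Sum>b\<in>B. cst (c b) * w b) \<in> P"
  shows "\<exists>d. (\<exists>i\<in>I. d i \<noteq> 0) \<and> (\<Sum>i\<in>I. cst (d i) * v i) \<in> P"
proof -
  from sp obtain M where M: "\<And>i. i \<in> I \<Longrightarrow> v i - (\<Sum>b\<in>B. cst (M i b) * w b) \<in> P" by metis
  obtain d where d: "\<exists>i\<in>I. d i \<noteq> 0" "\<And>b. b \<in> B \<Longrightarrow> (\<Sum>i\<in>I. d i * M i b) = 0"
    using homogeneous_system_nontrivial[OF fin, of M] by auto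
  have "(\<Sum>i\<in>I. cst (d i) * (\<Sum>b\<in>B. cst (M i b) * w b)) = (\<Sum>b\<in>B. cst (\<Sum>i\<in>I. d i * M i b) * w b)"
    unfolding sum_distrib_left cst_sum sum_distrib_right
    by (subst sum.swap) (simp add: cst_mult mult.assoc)
  also have "\<dots> = 0" using d by (intro sum.neutral) auto
  finally have "(\<Sum>i\<in>I. cst (d i) * v i) = (\<Sum>i\<in>I. cst (d i) * (v i - (\<Sum>b\<in>B. cst (M i b) * w b)))"
    by (simp add: right_diff_distrib sum_subtractf)
  also have "\<dots> \<in> P" using M P by (intro is_ideal_sum is_ideal_mult)
  finally show ?thesis using d by blast
qed

section \<open>Evaluation homomorphisms and total degree\<close>

definition mono_eval :: "('x \<Rightarrow> 'a::comm_semiring_1) \<Rightarrow> ('x \<Rightarrow>\<^sub>0 nat) \<Rightarrow> 'a" where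
  "mono_eval g m = (\<Prod>x\<in>keys m. g x ^ lookup m x)"

definition poly_eval :: "('x \<Rightarrow> ('y \<Rightarrow>\<^sub>0 nat) \<Rightarrow>\<^sub>0 'k) \<Rightarrow> (('x \<Rightarrow>\<^sub>0 nat) \<Rightarrow>\<^sub>0 'k) \<Rightarrow> ('y \<Rightarrow>\<^sub>0 nat) \<Rightarrow>\<^sub>0 'k::comm_ring_1"
  where "poly_eval g p = (\<Sum>m\<in>keys p. cst (lookup p m) * mono_eval g m)"

lemma mono_eval_superset:
  "finite A \<Longrightarrow> keys m \<subseteq> A \<Longrightarrow> mono_eval g m = (\<Prod>x\<in>A. g x ^ lookup m x)"
  unfolding mono_eval_def by (rule prod.mono_neutral_left) (auto simp: in_keys_iff)

lemma mono_eval_add: "mono_eval g (m + n) = mono_eval g m * mono_eval g n"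
proof -
  let ?A = "keys m \<union> keys n"
  have "keys (m + n) \<subseteq> ?A" by (rule Poly_Mapping.keys_add)
  then show ?thesis
    by (simp add: mono_eval_superset[of ?A] lookup_add power_add prod.distrib)
qed

lemma poly_eval_add: "poly_eval g (p + q) = poly_eval g p + poly_eval g q"
  unfolding poly_eval_def
  by (rule setsum_keys_plus_distrib) (simp_all add: single_add distrib_right)

lemma poly_eval_zero [simp]: "poly_eval g 0 = 0"
  by (simp add: poly_eval_def)

lemma poly_eval_sum: "poly_eval g (sum f A) = (\<Sum>i\<in>A. poly_eval g (f i))"
  by (induction A rule: infinite_finite_induct) (simp_all add: poly_eval_add)

lemma poly_eval_single: "poly_eval g (Poly_Mapping.single m c) = cst c * mono_eval g m"
  by (cases "c = 0") (simp_all add: poly_eval_def)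

lemma poly_eval_mult: "poly_eval g (p * q) = poly_eval g p * poly_eval g q"
proof -
  have "p * q = (\<Sum>m\<in>keys p. \<Sum>n\<in>keys q. Poly_Mapping.single (m + n) (lookup p m * lookup q n))"
    by (subst poly_mapping_expand[of p], subst poly_mapping_expand[of q])
      (simp add: sum_product mult_single)
  then have "poly_eval g (p * q) = (\<Sum>m\<in>keys p. \<Sum>n\<in>keys q.
      (cst (lookup p m) * mono_eval g m) * (cst (lookup q n) * mono_eval g n))"
    by (simp add: poly_eval_sum poly_eval_single mono_eval_add cst_mult mult_ac)
  then show ?thesis by (simp add: poly_eval_def sum_product)
qed

lemma poly_eval_cst [simp]: "poly_eval g (cst c) = cst c"
  by (simp add: poly_eval_single mono_eval_def)

lemma poly_eval_one [simp]: "poly_eval g 1 = 1"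
  using poly_eval_cst[of g 1] by simp

lemma poly_eval_diff: "poly_eval g (p - q) = poly_eval g p - poly_eval g q"
  using poly_eval_add[of g "p - q" q] by (simp add: algebra_simps)

lemma poly_eval_power: "poly_eval g (p ^ n) = poly_eval g p ^ n"
  by (induction n) (simp_all add: poly_eval_mult)

lemma poly_eval_prod: "poly_eval g (prod f A) = (\<Prod>i\<in>A. poly_eval g (f i))"
  by (induction A rule: infinite_finite_induct) (simp_all add: poly_eval_mult)

lemma poly_eval_pvar [simp]: "poly_eval g (pvar x) = g x"
  by (simp add: pvar_def poly_eval_single mono_eval_def)

lemma poly_eval_avar [simp]: "poly_eval g (avar v) = g (v, True)"
  and poly_eval_bvar [simp]: "poly_eval g (bvar v) = g (v, False)"
  by (simp_all add: avar_def bvar_def)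

lemma poly_eval_compose: "poly_eval h (poly_eval g p) = poly_eval (\<lambda>x. poly_eval h (g x)) p"
proof -
  have "poly_eval h (mono_eval g m) = mono_eval (\<lambda>x. poly_eval h (g x)) m" for m
    by (simp add: mono_eval_def poly_eval_prod poly_eval_power)
  then show ?thesis
    by (simp add: poly_eval_def[of g] poly_eval_def[of "\<lambda>x. poly_eval h (g x)"] poly_eval_sum poly_eval_mult)
qed

lemma is_ideal_poly_eval_vimage: "is_ideal I \<Longrightarrow> is_ideal {p. poly_eval g p \<in> I}"
  by (simp add: is_ideal_def poly_eval_add poly_eval_mult)

definition mdeg :: "('x \<Rightarrow>\<^sub>0 nat) \<Rightarrow> nat" where
  "mdeg m = (\<Sum>x\<in>keys m. lookup m x)"

lemma mdeg_add: "mdeg (m + n) = mdeg m + mdeg n"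
  unfolding mdeg_def by (rule setsum_keys_plus_distrib) simp_all

lemma mdeg_zero [simp]: "mdeg 0 = 0"
  and mdeg_single [simp]: "mdeg (Poly_Mapping.single x n) = n"
  by (simp_all add: mdeg_def)

definition deg_le :: "nat \<Rightarrow> (('x \<Rightarrow>\<^sub>0 nat) \<Rightarrow>\<^sub>0 'k::zero) \<Rightarrow> bool" where
  "deg_le D p \<longleftrightarrow> (\<forall>m\<in>keys p. mdeg m \<le> D)"

lemma deg_le_mono: "deg_le D p \<Longrightarrow> D \<le> E \<Longrightarrow> deg_le E p"
  by (auto simp: deg_le_def)

lemma deg_le_one: "deg_le D (1 :: ('x \<Rightarrow>\<^sub>0 nat) \<Rightarrow>\<^sub>0 'k::comm_ring_1)"
  by (simp add: deg_le_def)

lemma deg_le_mult: "deg_le D p \<Longrightarrow> deg_le E q \<Longrightarrow> deg_le (D + E) (p * q)"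
  using keys_mult[of p q] by (fastforce simp: deg_le_def mdeg_add intro: add_mono)

lemma deg_le_power:
  fixes p :: "('x \<Rightarrow>\<^sub>0 nat) \<Rightarrow>\<^sub>0 'k::comm_ring_1"
  shows "deg_le D p \<Longrightarrow> deg_le (n * D) (p ^ n)"
  by (induction n) (auto simp: deg_le_one intro: deg_le_mult)

lemma deg_le_pow_prod:
  fixes xs :: "(('x \<Rightarrow>\<^sub>0 nat) \<Rightarrow>\<^sub>0 'k::comm_ring_1) list"
  assumes "\<And>x. x \<in> set xs \<Longrightarrow> deg_le e x" "length ns = length xs" "set ns \<subseteq> {..N}"
  shows "deg_le (length xs * (N * e)) (pow_prod xs ns)"
  using assms
proof (induction xs arbitrary: ns)
  case Nil
  then show ?case by (simp add: deg_le_one)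
next
  case (Cons x xs)
  then obtain n ms where ns: "ns = n # ms" by (cases ns) auto
  have "deg_le (N * e) (x ^ n)"
    by (rule deg_le_mono[OF deg_le_power[of e]]) (use Cons.prems ns in auto)
  moreover have "deg_le (length xs * (N * e)) (pow_prod xs ms)"
    using Cons ns by (intro Cons.IH) auto
  ultimately show ?case using ns by (auto intro: deg_le_mult)
qed

lemma deg_le_exists_list:
  fixes xs :: "(('x \<Rightarrow>\<^sub>0 nat) \<Rightarrow>\<^sub>0 'k::comm_ring_1) list"
  shows "\<exists>e\<ge>1. \<forall>x\<in>set xs. deg_le e x"
proof (induction xs)
  case (Cons x xs)
  then obtain e where e: "e \<ge> 1" "\<forall>x\<in>set xs. deg_le e x" by auto
  define f where "f = Max (insert 0 (mdeg ` keys x))"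
  have "deg_le f x" unfolding deg_le_def f_def by auto
  then have "\<forall>y\<in>set (x # xs). deg_le (e + f) y"
    using e by (auto intro: deg_le_mono)
  then show ?case using e by (intro exI[of _ "e + f"]) auto
qed auto

section \<open>Counting monomials modulo minors\<close>

text \<open>Modulo all 2-minors inside each class of \<open>cl\<close>, and modulo the variables over \<open>T\<close>,
  a monomial is determined by its degree at each vertex and its \<open>b\<close>-degree on each class.\<close>

locale minors_ideal =
  fixes P :: "('v, 'k::field) bpoly set" and T :: "'v set" and cl :: "'v \<Rightarrow> 'c"
  assumes finite_vertices: "finite (UNIV :: 'v set)"
    and ideal: "is_ideal P"
    and killed: "v \<in> T \<Longrightarrow> avar v \<in> P \<and> bvar v \<in> P"
    and minors: "v \<notin> T \<Longrightarrow> w \<notin> T \<Longrightarrow> cl v = cl w \<Longrightarrow> avar v * bvar w - avar w * bvar v \<in> P"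
begin

text \<open>If \<open>m\<close> has too many b's at \<open>v\<close>, equality of class sums yields
  a vertex \<open>w\<close> of the same class with too few. Exchanging b_v a_w for a_v b_w is a
  minor and lowers the total excess of b-exponents over \<open>m'\<close>.\<close>

lemma mono_congruent:
  assumes "\<And>v s. v \<in> T \<Longrightarrow> lookup m (v, s) = 0" "\<And>v s. v \<in> T \<Longrightarrow> lookup m' (v, s) = 0"
    and "\<And>v. lookup m (v, True) + lookup m (v, False) = lookup m' (v, True) + lookup m' (v, False)"
    and "\<And>c. (\<Sum>v\<in>{v. v \<notin> T \<and> cl v = c}. lookup m (v, False)) = (\<Sum>v\<in>{v. v \<notin> T \<and> cl v = c}. lookup m' (v, False))"
  shows "mon m - mon m' \<in> P"
  using assms
proof (induction "\<Sum>v\<in>UNIV. lookup m (v, False) - lookup m' (v, False)" arbitrary: m rule: less_induct)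
  case less
  note fin = finite_subset[OF subset_UNIV finite_vertices]
  show ?case
  proof (cases "\<exists>v. lookup m (v, False) > lookup m' (v, False)")
    case False
    have "lookup m (v, False) = lookup m' (v, False)" for v
    proof (rule ccontr)
      assume ne: "lookup m (v, False) \<noteq> lookup m' (v, False)"
      with False have lt: "lookup m (v, False) < lookup m' (v, False)" by (metis nat_neq_iff)
      then have "v \<notin> T" using less.prems(2) by fastforce
      then have "(\<Sum>w\<in>{w. w \<notin> T \<and> cl w = cl v}. lookup m (w, False)) < (\<Sum>w\<in>{w. w \<notin> T \<and> cl w = cl v}. lookup m' (w, False))"
        using lt False by (intro sum_strict_mono_ex1 fin) (auto simp: not_less)
      then show False using less.prems(4)[of "cl v"] by simp
    qed
    then have "lookup m (v, s) = lookup m' (v, s)" for v s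
      using less.prems(3)[of v] by (cases s) simp_all
    then have "m = m'" by (intro poly_mapping_eqI) auto
    then show ?thesis using is_ideal_zero[OF ideal] by simp
  next
    case True
    then obtain v where v: "lookup m (v, False) > lookup m' (v, False)" by auto
    then have vT: "v \<notin> T" using less.prems(1) by fastforce
    have "\<exists>w. w \<notin> T \<and> cl w = cl v \<and> lookup m (w, False) < lookup m' (w, False)"
    proof (rule ccontr)
      assume "\<not> ?thesis"
      then have "(\<Sum>w\<in>{w. w \<notin> T \<and> cl w = cl v}. lookup m' (w, False)) < (\<Sum>w\<in>{w. w \<notin> T \<and> cl w = cl v}. lookup m (w, False))"
        using v vT by (intro sum_strict_mono_ex1 fin) (auto simp: not_less)
      then show False using less.prems(4)[of "cl v"] by simp
    qed
    then obtain w where w: "w \<notin> T" "cl w = cl v" "lookup m (w, False) < lookup m' (w, False)" by auto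
    then have vw: "v \<noteq> w" using v by auto
    \<comment> \<open>At \<open>w\<close> the vertex degrees agree while \<open>m\<close> has fewer
      b's, so an \<open>a\<close> is available for the exchange.\<close>
    have wa: "lookup m (w, True) > 0" using less.prems(3)[of w] w(3) by linarith
    define s where "s = m - Poly_Mapping.single (v, False) 1 - Poly_Mapping.single (w, True) 1"
    have m: "m = s + Poly_Mapping.single (v, False) 1 + Poly_Mapping.single (w, True) 1"
    proof (rule poly_mapping_eqI)
      fix z
      show "lookup m z = lookup (s + Poly_Mapping.single (v, False) 1 + Poly_Mapping.single (w, True) 1) z"
        using v wa by (auto simp: s_def lookup_add lookup_minus lookup_single when_def)
    qed
    define m1 where "m1 = s + Poly_Mapping.single (v, True) 1 + Poly_Mapping.single (w, False) 1"
    have m1: "lookup m1 z + (if z = (v, False) \<or> z = (w, True) then 1 else 0)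
        = lookup m z + (if z = (v, True) \<or> z = (w, False) then 1 else 0)" for z
      using vw by (auto simp: m m1_def lookup_add lookup_single when_def)
    have b1: "lookup m1 (u, False) = (if u = v then lookup m (u, False) - 1 else if u = w then lookup m (u, False) + 1 else lookup m (u, False))" for u
      using m1[of "(u, False)"] vw v by auto
    have a1: "lookup m1 (u, True) = (if u = w then lookup m (u, True) - 1 else if u = v then lookup m (u, True) + 1 else lookup m (u, True))" for u
      using m1[of "(u, True)"] vw wa by auto
    have "mon m - mon m1 = mon s * (avar w * bvar v - avar v * bvar w :: ('v, 'k) bpoly)"
      by (simp add: m m1_def avar_def bvar_def pvar_def mult_single right_diff_distrib add_ac)
    then have "mon m - mon m1 \<in> P" using minors[of w v] w vT ideal is_ideal_mult by metis
    moreover have "mon m1 - mon m' \<in> P"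
    proof (rule less.hyps)
      show "(\<Sum>v\<in>UNIV. lookup m1 (v, False) - lookup m' (v, False)) < (\<Sum>v\<in>UNIV. lookup m (v, False) - lookup m' (v, False))"
        using w(3) v vw by (intro sum_strict_mono_ex1 finite_vertices) (auto simp: b1 intro!: exI[of _ v])
      show "lookup m1 (u, s) = 0" if "u \<in> T" for u s
        using less.prems(1)[OF that] that vT w(1) a1[of u] b1[of u] by (cases s) auto
      show "lookup m1 (u, True) + lookup m1 (u, False) = lookup m' (u, True) + lookup m' (u, False)" for u
        unfolding less.prems(3)[symmetric] using a1[of u] b1[of u] vw v wa by auto
      show "(\<Sum>u\<in>{u. u \<notin> T \<and> cl u = c}. lookup m1 (u, False)) = (\<Sum>u\<in>{u. u \<notin> T \<and> cl u = c}. lookup m' (u, False))" for c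
      proof (cases "c = cl v")
        case True
        let ?C = "{u. u \<notin> T \<and> cl u = c}"
        have C: "v \<in> ?C" "w \<in> ?C - {v}" using True vT w vw by auto
        have e: "(\<Sum>u\<in>?C. f u) = f v + (f w + (\<Sum>u\<in>?C - {v} - {w}. f u))" for f :: "'v \<Rightarrow> nat"
          using C fin by (simp add: sum.remove)
        have "(\<Sum>u\<in>?C. lookup m1 (u, False)) = (\<Sum>u\<in>?C. lookup m (u, False))"
        proof -
          have "(\<Sum>u\<in>?C - {v} - {w}. lookup m1 (u, False)) = (\<Sum>u\<in>?C - {v} - {w}. lookup m (u, False))"
            by (intro sum.cong) (auto simp: b1)
          then show ?thesis unfolding e using v vw b1[of v] b1[of w] by simp
        qed
        then show ?thesis using less.prems(4) by simp
      next
        case False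
        then have "(\<Sum>u\<in>{u. u \<notin> T \<and> cl u = c}. lookup m1 (u, False)) = (\<Sum>u\<in>{u. u \<notin> T \<and> cl u = c}. lookup m (u, False))"
          using w by (intro sum.cong) (auto simp: b1)
        then show ?thesis using less.prems(4) by simp
      qed
    qed (use less.prems(2) in auto)
    ultimately show ?thesis
      using is_ideal_add[OF ideal, of "mon m - mon m1" "mon m1 - mon m'"] by simp
  qed
qed

definition good :: "('v \<times> bool \<Rightarrow>\<^sub>0 nat) \<Rightarrow> bool" where
  "good m \<longleftrightarrow> (\<forall>v\<in>T. \<forall>s. lookup m (v, s) = 0)"

text \<open>The functions are restricted so that the types of bounded degree lie in a finite
  \<open>PiE\<close> product whose cardinality is a power of D + 1.\<close>

definition type_of :: "('v \<times> bool \<Rightarrow>\<^sub>0 nat) \<Rightarrow> ('v \<Rightarrow> nat) \<times> ('c \<Rightarrow> nat)" where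
  "type_of m = (restrict (\<lambda>v. lookup m (v, True) + lookup m (v, False)) (- T),
     restrict (\<lambda>c. \<Sum>v\<in>{v. v \<notin> T \<and> cl v = c}. lookup m (v, False)) (cl ` (- T)))"

definition types :: "nat \<Rightarrow> (('v \<Rightarrow> nat) \<times> ('c \<Rightarrow> nat)) set" where
  "types D = PiE (- T) (\<lambda>_. {..D}) \<times> PiE (cl ` (- T)) (\<lambda>_. {..D})"

lemma finite_types: "finite (types D)"
  and card_types: "card (types D) = (D + 1) ^ (card (- T) + card (cl ` (- T)))"
proof -
  have "finite (- T)" by (rule finite_subset[OF subset_UNIV finite_vertices])
  then show "finite (types D)" "card (types D) = (D + 1) ^ (card (- T) + card (cl ` (- T)))"
    by (simp_all add: types_def finite_PiE card_cartesian_product card_PiE power_add)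
qed

lemma mono_bad: "\<not> good m \<Longrightarrow> mon m \<in> P"
proof -
  assume "\<not> good m"
  then obtain v s where v: "v \<in> T" "lookup m (v, s) \<noteq> 0" by (auto simp: good_def)
  then have "m = (m - Poly_Mapping.single (v, s) 1) + Poly_Mapping.single (v, s) 1"
    by (intro poly_mapping_eqI) (auto simp: lookup_add lookup_minus lookup_single when_def)
  then have "mon m = mon (m - Poly_Mapping.single (v, s) 1) * (pvar (v, s) :: ('v, 'k) bpoly)"
    unfolding pvar_def by (metis mono_add)
  moreover have "pvar (v, s) \<in> P" using killed[OF v(1)] by (cases s) (auto simp: avar_def bvar_def)
  ultimately show ?thesis using is_ideal_mult[OF ideal] by metis
qed

lemma mono_same_type:
  assumes "good m" "good m'" "type_of m = type_of m'" shows "mon m - mon m' \<in> P"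
proof (rule mono_congruent)
  show z: "lookup m (v, s) = 0" "lookup m' (v, s) = 0" if "v \<in> T" for v s
    using assms that by (auto simp: good_def)
  show "lookup m (v, True) + lookup m (v, False) = lookup m' (v, True) + lookup m' (v, False)" for v
  proof (cases "v \<in> T")
    case False
    have "fst (type_of m) v = fst (type_of m') v" by (simp only: assms(3))
    with False show ?thesis by (simp add: type_of_def)
  qed (simp add: z)
  fix c
  show "(\<Sum>v\<in>{v. v \<notin> T \<and> cl v = c}. lookup m (v, False)) = (\<Sum>v\<in>{v. v \<notin> T \<and> cl v = c}. lookup m' (v, False))"
  proof (cases "c \<in> cl ` (- T)")
    case True
    moreover have "snd (type_of m) c = snd (type_of m') c" by (simp only: assms(3))
    ultimately show ?thesis by (simp add: type_of_def)
  next
    case False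
    then have "{v. v \<notin> T \<and> cl v = c} = {}" by auto
    then show ?thesis by (simp only: sum.empty)
  qed
qed

lemma type_of_in_types:
  assumes "mdeg m \<le> D" shows "type_of m \<in> types D"
proof -
  have fin: "finite (UNIV :: ('v \<times> bool) set)" using finite_vertices by (simp add: finite_prod)
  have le: "(\<Sum>z\<in>A. lookup m z) \<le> D" for A
  proof -
    have "(\<Sum>z\<in>A. lookup m z) \<le> (\<Sum>z\<in>UNIV. lookup m z)"
      by (intro sum_mono2 fin) auto
    also have "\<dots> = mdeg m"
      unfolding mdeg_def by (rule sum.mono_neutral_right) (use fin in \<open>auto simp: in_keys_iff\<close>)
    finally show ?thesis using assms by simp
  qed
  have "lookup m (v, True) + lookup m (v, False) \<le> D" for v
    using le[of "{(v, True), (v, False)}"] by simp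
  moreover have "(\<Sum>v\<in>A. lookup m (v, False)) \<le> D" for A
    using le[of "(\<lambda>v. (v, False)) ` A"] by (simp add: sum.reindex inj_on_def)
  ultimately show ?thesis by (auto simp: type_of_def types_def)
qed

text \<open>The choice is arbitrary when no good monomial has type \<open>t\<close>; in
  \<open>span_types\<close> the coefficient of such a \<open>t\<close> is an empty sum.\<close>

definition representative :: "('v \<Rightarrow> nat) \<times> ('c \<Rightarrow> nat) \<Rightarrow> ('v, 'k) bpoly" where
  "representative t = mon (SOME m. good m \<and> type_of m = t)"

lemma span_types:
  assumes "deg_le D p"
  shows "\<exists>c. p - (\<Sum>t\<in>types D. cst (c t) * representative t) \<in> P"
proof -
  define K where "K = {m\<in>keys p. good m}"
  define c where "c t = (\<Sum>m\<in>{m\<in>K. type_of m = t}. lookup p m)" for t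
  have K: "finite K" "K \<subseteq> keys p" by (auto simp: K_def)
  have rep: "mon m - representative (type_of m) \<in> P" if "m \<in> K" for m
  proof -
    have "good (SOME m'. good m' \<and> type_of m' = type_of m) \<and> type_of (SOME m'. good m' \<and> type_of m' = type_of m) = type_of m"
      by (rule someI[of _ m]) (use that in \<open>auto simp: K_def\<close>)
    then show ?thesis
      unfolding representative_def using that by (intro mono_same_type) (auto simp: K_def)
  qed
  have "(\<Sum>t\<in>types D. cst (c t) * representative t)
      = (\<Sum>t\<in>types D. \<Sum>m\<in>{m\<in>K. type_of m = t}. cst (lookup p m) * representative (type_of m))"
    unfolding c_def cst_sum sum_distrib_right by (intro sum.cong) auto
  also have "\<dots> = (\<Sum>m\<in>K. cst (lookup p m) * representative (type_of m))"
    using assms K type_of_in_types by (intro sum.group finite_types) (auto simp: deg_le_def K_def)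
  finally have c: "(\<Sum>t\<in>types D. cst (c t) * representative t) = (\<Sum>m\<in>K. cst (lookup p m) * representative (type_of m))" .
  have "p = (\<Sum>m\<in>keys p - K. cst (lookup p m) * mon m) + (\<Sum>m\<in>K. cst (lookup p m) * mon m)"
    by (subst poly_mapping_expand[of p], rule sum.subset_diff[OF K(2)]) simp
  then have "p - (\<Sum>t\<in>types D. cst (c t) * representative t)
      = (\<Sum>m\<in>keys p - K. cst (lookup p m) * mon m) + (\<Sum>m\<in>K. cst (lookup p m) * (mon m - representative (type_of m)))"
    unfolding c by (simp add: right_diff_distrib sum_subtractf)
  also have "\<dots> \<in> P"
    using rep mono_bad by (intro is_ideal_add is_ideal_sum is_ideal_mult ideal) (auto simp: K_def)
  finally show ?thesis by blast
qed

text \<open>With exponents up to N there are (N + 1)^r power products of the r elements, of degree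
  O(N), but only O(N^d) types to span them; r > d decides.\<close>

lemma algebraically_dependent:
  assumes "length xs > card (- T) + card (cl ` (- T))"
  shows "\<exists>\<Gamma> c. finite \<Gamma> \<and> (\<forall>\<gamma>\<in>\<Gamma>. length \<gamma> = length xs) \<and> (\<exists>\<gamma>\<in>\<Gamma>. c \<gamma> \<noteq> 0) \<and>
    (\<Sum>\<gamma>\<in>\<Gamma>. cst (c \<gamma>) * pow_prod xs \<gamma>) \<in> P"
proof -
  let ?d = "card (- T) + card (cl ` (- T))" and ?r = "length xs"
  obtain e where e: "e \<ge> 1" "\<forall>x\<in>set xs. deg_le e x" using deg_le_exists_list by blast
  \<comment> \<open>Large enough to absorb the constant: the types number at most (e r)^d (N + 1)^d
    = N (N + 1)^d, which is below (N + 1)^(d + 1).\<close>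
  define N where "N = (e * ?r) ^ ?d"
  define D where "D = ?r * (N * e)"
  define \<Gamma> where "\<Gamma> = {\<gamma>. set \<gamma> \<subseteq> {..N} \<and> length \<gamma> = ?r}"
  have er: "e * ?r \<ge> 1" using e(1) assms by (cases e; cases ?r) auto
  have "D + 1 \<le> (e * ?r) * (N + 1)"
    using er by (simp add: D_def algebra_simps)
  then have "card (types D) \<le> ((e * ?r) * (N + 1)) ^ ?d"
    unfolding card_types by (rule power_mono) simp
  also have "\<dots> = N * (N + 1) ^ ?d" by (simp only: N_def power_mult_distrib)
  also have "\<dots> < (N + 1) ^ Suc ?d" by simp
  also have "\<dots> \<le> (N + 1) ^ ?r" using assms by (intro power_increasing) auto
  also have "\<dots> = card \<Gamma>" by (simp add: \<Gamma>_def card_lists_length_eq)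
  finally have less: "card (types D) < card \<Gamma>" .
  have finG: "finite \<Gamma>" unfolding \<Gamma>_def by (rule finite_lists_length_eq) simp
  have "\<exists>c. pow_prod xs \<gamma> - (\<Sum>t\<in>types D. cst (c t) * representative t) \<in> P" if "\<gamma> \<in> \<Gamma>" for \<gamma>
    by (rule span_types) (use that e in \<open>auto simp: D_def \<Gamma>_def intro!: deg_le_pow_prod\<close>)
  from dependent_modulo_ideal[OF ideal finite_types finG less this]
  show ?thesis using finG by (auto simp: \<Gamma>_def)
qed

end

text \<open>A relation in \<open>P\<close>, multiplied by \<open>u\<close>, lands in
  \<open>I\<close> and contradicts independence along the tower. For dimension \<open>u\<close> is
  1; for depth \<open>u\<close> is annihilated by \<open>P\<close> modulo J.\<close>

lemma dependent_imp_tower_le: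
  fixes xs :: "('v, 'k::field) bpoly list"
  assumes "minors_ideal P T (cl :: 'v \<Rightarrow> 'c)" and "is_ideal I" "\<And>p. p \<in> P \<Longrightarrow> p * u \<in> I"
    and "tower I xs L" "u \<notin> L"
  shows "length xs \<le> card (- T) + card (cl ` (- T))"
proof (rule ccontr)
  assume "\<not> ?thesis"
  then obtain \<Gamma> c where G: "finite \<Gamma>" "\<And>\<gamma>. \<gamma> \<in> \<Gamma> \<Longrightarrow> length \<gamma> = length xs" "\<exists>\<gamma>\<in>\<Gamma>. c \<gamma> \<noteq> 0"
    "(\<Sum>\<gamma>\<in>\<Gamma>. cst (c \<gamma>) * pow_prod xs \<gamma>) \<in> P"
    using minors_ideal.algebraically_dependent[OF assms(1), of xs] by (auto simp: not_le)
  have "(\<Sum>\<gamma>\<in>\<Gamma>. cst (c \<gamma>) * (pow_prod xs \<gamma> * u)) = (\<Sum>\<gamma>\<in>\<Gamma>. cst (c \<gamma>) * pow_prod xs \<gamma>) * u"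
    by (simp add: sum_distrib_right mult.assoc)
  then have "(\<Sum>\<gamma>\<in>\<Gamma>. cst (c \<gamma>) * (pow_prod xs \<gamma> * u)) \<in> I" using G(4) assms(3) by simp
  then show False
    using tower_independent[OF assms(2,4,5) G(1,2)] G(3) by blast
qed

section \<open>Bounds for depth and dimension\<close>

text \<open>The \<open>N\<close>-th power of the ideal generated by the variables, described by its
  monomials.\<close>

definition order_ge :: "nat \<Rightarrow> (('y \<Rightarrow>\<^sub>0 nat) \<Rightarrow>\<^sub>0 'k::comm_ring_1) set" where
  "order_ge N = {q. \<forall>m\<in>keys q. N \<le> mdeg m}"

lemma order_ge_mult: "p \<in> order_ge M \<Longrightarrow> q \<in> order_ge N \<Longrightarrow> p * q \<in> order_ge (M + N)"
  using keys_mult[of p q] by (fastforce simp: order_ge_def mdeg_add intro: add_mono)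

lemma is_ideal_order_ge: "is_ideal (order_ge N :: (('y \<Rightarrow>\<^sub>0 nat) \<Rightarrow>\<^sub>0 'k::comm_ring_1) set)" (is "is_ideal ?O")
proof -
  have "p + q \<in> ?O" if "p \<in> ?O" "q \<in> ?O" for p q
    using that Poly_Mapping.keys_add[of p q] by (auto simp: order_ge_def)
  moreover have "r * p \<in> ?O" if "p \<in> ?O" for r p
    using order_ge_mult[of r 0 p N] that by (simp add: order_ge_def)
  moreover have "0 \<in> ?O" by (simp add: order_ge_def)
  ultimately show ?thesis by (simp add: is_ideal_def)
qed

lemma order_ge_power: "p \<in> order_ge 1 \<Longrightarrow> p ^ N \<in> order_ge N"
proof (induction N)
  case (Suc N)
  then show ?case using order_ge_mult[of p 1 "p ^ N" N] by simp
qed (simp add: order_ge_def)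

lemma order_ge_exceeded: "q \<noteq> 0 \<Longrightarrow> \<exists>N. q \<notin> order_ge N"
proof -
  assume "q \<noteq> 0"
  then obtain m where "m \<in> keys q" by (metis keys_eq_empty ex_in_conv)
  then have "q \<notin> order_ge (Suc (mdeg m))" by (auto simp: order_ge_def intro!: bexI[of _ m])
  then show ?thesis by blast
qed

text \<open>The annihilator argument for \<open>depth \<le> dim S/P\<close>: the evaluation \<open>g\<close> separates \<open>u\<close> from
  high powers of the maximal ideal modulo \<open>J\<close>, so a regular sequence may be replaced by high
  powers of its members and then cannot be algebraically dependent on \<open>u\<close>.\<close>

lemma depth_le_annihilator:
  fixes J :: "('v, 'k::field) bpoly set" and g :: "'v \<times> bool \<Rightarrow> ('y \<Rightarrow>\<^sub>0 nat) \<Rightarrow>\<^sub>0 'k"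
  assumes "minors_ideal P T (cl :: 'v \<Rightarrow> 'c)" and J: "is_ideal J" and Pu: "\<And>p. p \<in> P \<Longrightarrow> p * u \<in> J"
    and gJ: "\<And>p. p \<in> J \<Longrightarrow> poly_eval g p = 0" and g1: "\<And>z. g z \<in> order_ge 1"
    and gu: "poly_eval g u \<noteq> 0"
  shows "S_depth J \<le> enat (card (- T) + card (cl ` (- T)))"
  unfolding S_depth_def depth_quot_def
proof (intro Sup_least, clarsimp)
  fix fs assume "regular_seq_quot J max_ideal_S fs"
  then have fs: "set fs \<subseteq> max_ideal_S" "reg_list J fs"
    unfolding reg_list_iff[OF J] by (auto simp: regular_seq_quot_def nzd_def)
  obtain N where N: "poly_eval g u \<notin> order_ge N" using order_ge_exceeded[OF gu] by blast
  \<comment> \<open>The preimage of a power of the maximal ideal: it contains J and all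
    \<open>N\<close>-th powers of elements of the maximal ideal, but not \<open>u\<close>.\<close>
  define L where "L = {p. poly_eval g p \<in> order_ge N}"
  have L: "is_ideal L" unfolding L_def by (intro is_ideal_poly_eval_vimage is_ideal_order_ge)
  have "max_ideal_S \<subseteq> {p. poly_eval g p \<in> order_ge 1}"
    unfolding max_ideal_S_def
    by (intro ideal_gen_least is_ideal_poly_eval_vimage is_ideal_order_ge) (auto simp: g1[simplified])
  then have "set (map (\<lambda>f. f ^ N) fs) \<subseteq> L"
    using fs(1) order_ge_power by (fastforce simp: L_def poly_eval_power)
  moreover have "J \<subseteq> L"
    using gJ is_ideal_zero[OF is_ideal_order_ge] by (auto simp: L_def)
  ultimately have "tower J (map (\<lambda>f. f ^ N) fs) L"
    by (intro tower_reg_list reg_list_powers J L fs)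
  from dependent_imp_tower_le[OF assms(1) J Pu this]
  show "length fs \<le> card (- T) + card (cl ` (- T))" using N by (simp add: L_def)
qed

text \<open>Any element of a prime outside the preceding one is regular modulo the preceding
  one.\<close>

lemma prime_chain_tower:
  assumes "\<And>i. i \<le> n \<Longrightarrow> prime_ideal (Q i)" "\<And>i. i < n \<Longrightarrow> Q i \<subset> Q (Suc i)"
  shows "\<exists>xs. length xs = n \<and> tower (Q 0) xs (Q n)"
  using assms
proof (induction n arbitrary: Q)
  case (Suc n)
  have "\<exists>xs. length xs = n \<and> tower (Q (Suc 0)) xs (Q (Suc n))"
    using Suc.prems by (intro Suc.IH[of "\<lambda>i. Q (Suc i)"]) auto
  then obtain xs where xs: "length xs = n" "tower (Q (Suc 0)) xs (Q (Suc n))" by blast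
  obtain x where x: "x \<in> Q (Suc 0)" "x \<notin> Q 0" and sub: "Q 0 \<subseteq> Q (Suc 0)"
    using Suc.prems(2)[of 0] by auto
  have "nzd (Q 0) x" using Suc.prems(1)[of 0] x(2) unfolding prime_ideal_def nzd_def by blast
  moreover have "is_ideal (Q (Suc 0))" using Suc.prems(1)[of "Suc 0"] by (simp add: prime_ideal_def)
  ultimately have "tower (Q 0) (x # xs) (Q (Suc n))" using x(1) sub xs(2) by auto
  then show ?case using xs(1) by (intro exI[of _ "x # xs"]) simp
qed auto

text \<open>Only the bottom prime of a chain enters the count, and \<open>T\<close> and
  \<open>cl\<close> may be chosen depending on it.\<close>

lemma dim_le_minors:
  fixes J :: "('v, 'k::field) bpoly set"
  assumes "\<And>P. prime_ideal P \<Longrightarrow> J \<subseteq> P \<Longrightarrow>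
    \<exists>T (cl :: 'v \<Rightarrow> 'c). minors_ideal P T cl \<and> card (- T) + card (cl ` (- T)) \<le> d"
  shows "S_dim J \<le> enat d"
  unfolding S_dim_def krull_dim_quot_def
proof (intro Sup_least, clarsimp)
  fix n and Q :: "nat \<Rightarrow> ('v, 'k) bpoly set"
  assume Q: "\<forall>i\<le>n. prime_ideal (Q i) \<and> J \<subseteq> Q i" "\<forall>i<n. Q i \<subset> Q (Suc i)"
  then obtain xs where xs: "length xs = n" "tower (Q 0) xs (Q n)"
    using prime_chain_tower[of n Q] by auto
  obtain T and cl :: "'v \<Rightarrow> 'c" where T: "minors_ideal (Q 0) T cl" "card (- T) + card (cl ` (- T)) \<le> d"
    using assms[of "Q 0"] Q by auto
  have "length xs \<le> card (- T) + card (cl ` (- T))"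
    by (rule dependent_imp_tower_le[OF T(1) _ _ xs(2), where u = 1])
      (use Q in \<open>auto simp: prime_ideal_def\<close>)
  then show "n \<le> d" using xs T(2) by simp
qed

lemma ideal_gen_poly_eval_zero:
  "(\<And>p. p \<in> G \<Longrightarrow> poly_eval g p = 0) \<Longrightarrow> p \<in> ideal_gen G \<Longrightarrow> poly_eval g p = 0"
proof -
  assume *: "\<And>p. p \<in> G \<Longrightarrow> poly_eval g p = 0" "p \<in> ideal_gen G"
  have "is_ideal {p. poly_eval g p \<in> {0}}"
    by (rule is_ideal_poly_eval_vimage) (simp add: is_ideal_def)
  then have "ideal_gen G \<subseteq> {p. poly_eval g p \<in> {0}}" using *(1) by (intro ideal_gen_least) auto
  then show ?thesis using *(2) by auto
qed

lemma prime_ideal_poly_eval_kernel: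
  fixes g :: "'x \<Rightarrow> (nat \<Rightarrow>\<^sub>0 nat) \<Rightarrow>\<^sub>0 'k::field"
  shows "prime_ideal {p. poly_eval g p = 0}"
proof -
  have "is_ideal {p. poly_eval g p \<in> {0}}"
    by (rule is_ideal_poly_eval_vimage) (simp add: is_ideal_def)
  then show ?thesis by (simp add: prime_ideal_def poly_eval_mult)
qed

lemma pvar_nonzero: "(pvar x :: ('x \<Rightarrow>\<^sub>0 nat) \<Rightarrow>\<^sub>0 'k::comm_ring_1) \<noteq> 0"
  by (metis lookup_single_eq lookup_zero pvar_def zero_neq_one)

text \<open>Chain of kernels of \<open>a\<^sub>v \<mapsto> s\<^sub>v, b\<^sub>v \<mapsto> s\<^sub>v t\<^bsub>cl v\<^esub>\<close> (and \<open>0\<close> over \<open>T\<close>), where first the \<open>t\<close>'s and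
  then the \<open>s\<close>'s are set to zero one at a time.\<close>

lemma dim_binomial_edge_ideal_ge:
  fixes E :: "'v \<Rightarrow> 'v \<Rightarrow> bool" and cl :: "'v \<Rightarrow> 'c"
  assumes fin: "finite (UNIV :: 'v set)"
    and E: "\<And>u v. E u v \<Longrightarrow> u \<in> T \<or> v \<in> T \<or> cl u = cl v"
  shows "enat (card (- T) + card (cl ` (- T))) \<le> S_dim (binomial_edge_ideal E :: ('v, 'k::field) bpoly set)"
proof -
  have finT: "finite (- T)" by (rule finite_subset[OF subset_UNIV fin])
  define n q where "n = card (- T)" and "q = card (cl ` (- T))"
  obtain \<nu>t where t: "bij_betw \<nu>t (cl ` (- T)) {0..<q}"
    using ex_bij_betw_finite_nat[of "cl ` (- T)"] finT unfolding q_def by auto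
  obtain \<nu> where s: "bij_betw \<nu> (- T) {0..<n}"
    using ex_bij_betw_finite_nat[OF finT] unfolding n_def by auto
  define X :: "nat \<Rightarrow> nat \<Rightarrow> (nat \<Rightarrow>\<^sub>0 nat) \<Rightarrow>\<^sub>0 'k" where "X i j = (if j < i then 0 else pvar j)" for i j
  \<comment> \<open>The t's have indices below \<open>q\<close> and the s's indices from
    \<open>q\<close> on, so killing variables in the order of their index removes the t's while
    every s is still present.\<close>
  define g where "g i z = (if fst z \<in> T then 0 else
     X i (q + \<nu> (fst z)) * (if snd z then 1 else X i (\<nu>t (cl (fst z)))))" for i z
  define Q where "Q i = {p. poly_eval (g i) p = 0}" for i
  have step: "g (Suc i) = (\<lambda>z. poly_eval (\<lambda>j. if j = i then 0 else pvar j) (g i z))" for i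
    by (rule ext) (simp add: g_def X_def poly_eval_mult less_Suc_eq)
  have mon: "Q i \<subseteq> Q (Suc i)" for i
    unfolding Q_def step by (auto simp flip: poly_eval_compose)
  \<comment> \<open>A t about to vanish is detected by b_v, an s by a_v.\<close>
  have strict: "Q i \<noteq> Q (Suc i)" if "i < n + q" for i
  proof (cases "i < q")
    case True
    then obtain v where v: "v \<in> - T" "\<nu>t (cl v) = i"
      using t by (metis atLeast0LessThan bij_betw_imp_surj_on imageE lessThan_iff)
    then have "bvar v \<in> Q (Suc i)" "bvar v \<notin> Q i"
      using True by (simp_all add: Q_def g_def X_def pvar_nonzero)
    then show ?thesis by blast
  next
    case False
    then have "i - q \<in> {0..<n}" using that by auto
    then obtain v where v: "v \<in> - T" "\<nu> v = i - q"
      using s by (metis bij_betw_imp_surj_on imageE)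
    then have "avar v \<in> Q (Suc i)" "avar v \<notin> Q i"
      using False by (simp_all add: Q_def g_def X_def pvar_nonzero)
    then show ?thesis by blast
  qed
  have "binomial_edge_ideal E \<subseteq> Q i" for i
  proof
    fix p :: "('v, 'k) bpoly" assume "p \<in> binomial_edge_ideal E"
    then show "p \<in> Q i"
      unfolding binomial_edge_ideal_def Q_def mem_Collect_eq
    proof (rule ideal_gen_poly_eval_zero[rotated])
      fix f :: "('v, 'k) bpoly" assume "f \<in> {avar u * bvar v - avar v * bvar u | u v. E u v}"
      then obtain u v where f: "f = avar u * bvar v - avar v * bvar u" "E u v" by blast
      from E[OF f(2)] show "poly_eval (g i) f = 0"
        by (auto simp: f(1) poly_eval_diff poly_eval_mult g_def)
    qed
  qed
  then have "\<exists>P. (\<forall>i\<le>n + q. prime_ideal (P i) \<and> (binomial_edge_ideal E :: ('v, 'k) bpoly set) \<subseteq> P i) \<and> (\<forall>i<n + q. P i \<subset> P (Suc i))"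
    using mon strict prime_ideal_poly_eval_kernel unfolding Q_def by (intro exI[of _ Q]) (auto simp: Q_def)
  then show ?thesis
    unfolding S_dim_def krull_dim_quot_def n_def[symmetric] q_def[symmetric] by (intro Sup_upper) auto
qed

section \<open>The Levi graph\<close>

abbreviation (input) minor :: "'v \<Rightarrow> 'v \<Rightarrow> ('v, 'k::comm_ring_1) bpoly" where
  "minor v w \<equiv> avar v * bvar w - avar w * bvar v"

lemma is_ideal_binomial_edge_ideal: "is_ideal (binomial_edge_ideal E)"
  by (simp add: binomial_edge_ideal_def is_ideal_gen)

lemma minor_in_binomial_edge_ideal: "E u v \<Longrightarrow> minor u v \<in> binomial_edge_ideal E"
  unfolding binomial_edge_ideal_def by (rule subsetD[OF ideal_gen_superset]) blast

text \<open>Three-term Pluecker relations: once a_w or b_w can be cancelled, vanishing of minors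
  becomes transitive through \<open>w\<close>.\<close>

lemma avar_minor: "avar w * minor v z = avar v * minor w z + avar z * minor v w"
  and bvar_minor: "bvar w * minor v z = bvar v * minor w z + bvar z * minor v w"
  by (simp_all add: algebra_simps)

locale Gk_graph =
  fixes k :: nat and x y :: "nat \<Rightarrow> 'v"
  assumes k3: "k \<ge> 3"
    and inj_x: "inj_on x {1..k}" and inj_y: "inj_on y {1..k}"
    and disjoint: "x ` {1..k} \<inter> y ` {1..k} = {}"
    and univ: "(UNIV :: 'v set) = x ` {1..k} \<union> y ` {1..k}"
begin

lemma finite_vertices: "finite (UNIV :: 'v set)"
  unfolding univ by simp

lemma card_vertices: "card (UNIV :: 'v set) = 2 * k"
  unfolding univ using disjoint inj_x inj_y by (simp add: card_Un_disjoint card_image)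

lemma x_eq_iff: "i \<in> {1..k} \<Longrightarrow> j \<in> {1..k} \<Longrightarrow> x i = x j \<longleftrightarrow> i = j"
  and y_eq_iff: "i \<in> {1..k} \<Longrightarrow> j \<in> {1..k} \<Longrightarrow> y i = y j \<longleftrightarrow> i = j"
  using inj_x inj_y by (auto dest: inj_onD)

lemma x_neq_y: "i \<in> {1..k} \<Longrightarrow> j \<in> {1..k} \<Longrightarrow> x i \<noteq> y j"
  using disjoint by blast

lemma vertex_cases:
  obtains i where "i \<in> {1..k}" "v = x i" | i where "i \<in> {1..k}" "v = y i"
  using univ by (metis UNIV_I Un_iff imageE)

lemma edges:
  assumes "i \<in> {1..k}" "i \<noteq> 2"
  shows "Gk_edge k x y (x 2) (y i)" "Gk_edge k x y (y i) (x 2)" "Gk_edge k x y (x i) (y 2)"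
    "Gk_edge k x y (y 2) (x i)" "Gk_edge k x y (x i) (y i)" "Gk_edge k x y (y i) (x i)"
  unfolding Gk_edge_def using assms by (auto intro!: bexI[of _ i])

lemma Gk_edge_sym: "Gk_edge k x y u v \<Longrightarrow> Gk_edge k x y v u"
  by (simp add: Gk_edge_def insert_commute)

text \<open>The large component left after deleting \<open>y 1\<close> and \<open>y 2\<close>,
  written as hub \<open>x 2\<close> and pairs because it is explored along the paths x_2 - y_i -
  x_i.\<close>

definition rest :: "'v set" where
  "rest = insert (x 2) {v. \<exists>i\<in>{3..k}. v = x i \<or> v = y i}"

lemma finite_rest: "finite rest"
  by (rule finite_subset[OF subset_UNIV finite_vertices])

lemma in_rest: "v \<in> rest \<longleftrightarrow> v \<noteq> x 1 \<and> v \<noteq> y 1 \<and> v \<noteq> y 2"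
proof -
  have r: "1 \<in> {1..k}" "2 \<in> {1..k}" using k3 by auto
  have i: "i = 1 \<or> i = 2 \<or> i \<in> {3..k}" if "i \<in> {1..k}" for i using that by auto
  have s: "{3..k} \<subseteq> {1..k}" by auto
  show ?thesis
  proof
    assume "v \<in> rest"
    then show "v \<noteq> x 1 \<and> v \<noteq> y 1 \<and> v \<noteq> y 2"
      unfolding rest_def using r s x_eq_iff[of 2 1] x_neq_y[of 2 1] x_neq_y[of 2 2]
      by (auto simp: x_eq_iff y_eq_iff x_neq_y x_neq_y[symmetric])
  next
    assume *: "v \<noteq> x 1 \<and> v \<noteq> y 1 \<and> v \<noteq> y 2"
    show "v \<in> rest"
    proof (cases v rule: vertex_cases)
      case (1 j)
      then show ?thesis using i[of j] * by (auto simp: rest_def)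
    next
      case (2 j)
      then show ?thesis using i[of j] * by (auto simp: rest_def)
    qed
  qed
qed

lemma edge_x1: "Gk_edge k x y u v \<Longrightarrow> u = x 1 \<Longrightarrow> v = y 1 \<or> v = y 2"
  unfolding Gk_edge_def using k3 by (auto simp: doubleton_eq_iff x_eq_iff x_neq_y)

text \<open>The minimal prime attached to the cut \<open>{y\<^sub>1, y\<^sub>2}\<close>, which isolates \<open>x\<^sub>1\<close>, has dimension \<open>2k\<close>.
  It annihilates \<open>u = (a\<^bsub>x1\<^esub> b\<^bsub>x2\<^esub> - a\<^bsub>x2\<^esub> b\<^bsub>x1\<^esub>) A^N\<close> modulo \<open>J\<close>, where \<open>A\<close> is the product of the
  \<open>a\<^sub>v\<close> over the remaining vertices.\<close>

lemma depth_le: "S_depth (binomial_edge_ideal (Gk_edge k x y) :: ('v, 'k::field) bpoly set) \<le> enat (2 * k)"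
proof -
  define J :: "('v, 'k) bpoly set" where "J = binomial_edge_ideal (Gk_edge k x y)"
  have J: "is_ideal J" by (simp add: J_def is_ideal_binomial_edge_ideal)
  have edge: "minor v w \<in> J" if "Gk_edge k x y v w" for v w
    unfolding J_def using that by (rule minor_in_binomial_edge_ideal)
  define A :: "('v, 'k) bpoly" where "A = (\<Prod>v\<in>rest. avar v)"
  \<comment> \<open>\<open>R v w\<close> says that the minor lies in the ideal after inverting
    \<open>A\<close>.\<close>
  define R where "R v w \<longleftrightarrow> (\<exists>n. minor v w * A ^ n \<in> J)" for v w
  have R_edge: "R v w" if "Gk_edge k x y v w" for v w
    unfolding R_def using edge[OF that] by (intro exI[of _ 0]) simp
  have R_mono: "minor v w * A ^ n \<in> J" if "minor v w * A ^ m \<in> J" "m \<le> n" for v w m n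
  proof -
    have "A ^ n = A ^ m * A ^ (n - m)" using that(2) by (simp flip: power_add)
    then show ?thesis using is_ideal_mult_right[OF J that(1), of "A ^ (n - m)"] by (simp add: mult.assoc)
  qed
  \<comment> \<open>For \<open>w\<close> in \<open>rest\<close> the variable a_w divides
    \<open>A\<close>, so the factor a_w of the Pluecker relation is absorbed by one more power of
    \<open>A\<close>.\<close>
  have R_trans: "R v z" if w: "w \<in> rest" and vw: "R v w" and wz: "R w z" for v w z
  proof -
    from vw wz obtain m n where mn: "minor v w * A ^ m \<in> J" "minor w z * A ^ n \<in> J"
      unfolding R_def by blast
    define l where "l = max m n"
    have l: "minor v w * A ^ l \<in> J" "minor w z * A ^ l \<in> J"
      using mn R_mono unfolding l_def by auto
    define B where "B = (\<Prod>v\<in>rest - {w}. avar v :: ('v, 'k) bpoly)"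
    have AB: "A = avar w * B" unfolding A_def B_def using w finite_rest by (simp add: prod.remove)
    have ABC: "minor v z * (A * C) = B * ((avar w * minor v z) * C)" for C
      unfolding AB by (simp only: mult_ac)
    have "minor v z * A ^ Suc l = B * ((avar w * minor v z) * A ^ l)"
      unfolding power_Suc by (rule ABC)
    also have "\<dots> = B * (avar v * (minor w z * A ^ l) + avar z * (minor v w * A ^ l))"
      unfolding avar_minor[of w v z] by (simp only: distrib_right mult.assoc)
    also have "\<dots> \<in> J" by (intro is_ideal_add is_ideal_mult J l)
    finally show ?thesis unfolding R_def by blast
  qed
  have x2: "x 2 \<in> rest" by (simp add: rest_def)
  have i3: "i \<in> {1..k}" "i \<noteq> 2" if "i \<in> {3..k}" for i using that by auto
  have R_x2: "R (x 2) v \<and> R v (x 2)" if "v \<in> rest" for v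
    using that unfolding rest_def
  proof (elim insertE CollectE bexE disjE)
    assume "v = x 2"
    then show ?thesis unfolding R_def using is_ideal_zero[OF J] by simp
  next
    fix i assume i: "i \<in> {3..k}" "v = y i"
    show ?thesis unfolding i(2) using edges(1,2)[OF i3[OF i(1)]] by (simp add: R_edge)
  next
    fix i assume i: "i \<in> {3..k}" "v = x i"
    then have "y i \<in> rest" by (auto simp: rest_def)
    then show ?thesis
      unfolding i(2) using R_trans[of "y i"] edges[OF i3[OF i(1)]] by (simp add: R_edge)
  qed
  have three: "3 \<in> {3..k}" using k3 by auto
  then have "x 3 \<in> rest" by (auto simp: rest_def)
  \<comment> \<open>\<open>y 2\<close> and \<open>x 2\<close> are not adjacent; the link goes
    through \<open>x 3\<close>, which exists because k \<ge> 3.\<close>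
  then have R_y2: "R (y 2) (x 2)"
    using R_x2 R_trans[of "x 3" "y 2" "x 2"] R_edge edges(4)[OF i3[OF three]] by simp
  have R_rest: "R v w" if "v \<in> rest" "w \<in> rest" for v w
    using R_x2 R_trans[OF x2] that by simp
  define S where "S = insert (y 2, x 2) (rest \<times> rest)"
  have "\<forall>p\<in>S. \<exists>n. minor (fst p) (snd p) * A ^ n \<in> J"
    using R_rest R_y2 by (auto simp: S_def R_def)
  then obtain n where n: "\<And>p. p \<in> S \<Longrightarrow> minor (fst p) (snd p) * A ^ n p \<in> J"
    by metis
  \<comment> \<open>One exponent that works for all pairs in the finite set
    \<open>S\<close>.\<close>
  define N where "N = (\<Sum>p\<in>S. n p)"
  have N: "minor v w * A ^ N \<in> J" if "(v, w) \<in> S" for v w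
  proof (rule R_mono)
    show "minor v w * A ^ n (v, w) \<in> J" using n[OF that] by simp
    show "n (v, w) \<le> N" unfolding N_def
      by (rule member_le_sum[OF that]) (auto simp: S_def finite_rest)
  qed
  define u where "u = minor (x 1) (x 2) * A ^ N"
  define P where "P = {p. p * u \<in> J}"
  define T where "T = {y 1, y 2}"
  define cl where "cl v = (v = x 1)" for v
  have one: "1 \<in> {1..k}" "(1::nat) \<noteq> 2" "2 \<in> {1..k}" using k3 by auto
  \<comment> \<open>Used for \<open>w\<close> in the cut: it is linked to both \<open>x 1\<close>
    and \<open>x 2\<close>, so the Pluecker relation puts a_w u and b_w u into the ideal.\<close>
  have split: "c * u \<in> J" if "c * minor (x 1) (x 2) = p * minor w (x 2) + q * minor (x 1) w"
    "minor w (x 2) * A ^ N \<in> J" "minor (x 1) w * A ^ N \<in> J" for c p q w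
  proof -
    have "c * u = (c * minor (x 1) (x 2)) * A ^ N" by (simp add: u_def mult.assoc)
    also have "\<dots> = p * (minor w (x 2) * A ^ N) + q * (minor (x 1) w * A ^ N)"
      unfolding that(1) by (simp only: distrib_right mult.assoc)
    also have "\<dots> \<in> J" by (intro is_ideal_add is_ideal_mult J that)
    finally show ?thesis .
  qed
  have "minors_ideal P T cl"
  proof
    show "finite (UNIV :: 'v set)" by (rule finite_vertices)
    show "is_ideal P"
      using J by (auto simp: P_def is_ideal_def distrib_right mult.assoc)
    show "avar v \<in> P \<and> bvar v \<in> P" if "v \<in> T" for v
    proof -
      have "minor v (x 2) * A ^ N \<in> J"
        using that N[of "y 2" "x 2"] edge[OF edges(2)[OF one(1,2)]] is_ideal_mult_right[OF J]
        unfolding T_def S_def by blast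
      moreover have "minor (x 1) v * A ^ N \<in> J"
        using that edge[OF edges(3)[OF one(1,2)]] edge[OF edges(5)[OF one(1,2)]] is_ideal_mult_right[OF J]
        unfolding T_def by blast
      ultimately show ?thesis
        unfolding P_def mem_Collect_eq using split[OF avar_minor] split[OF bvar_minor] by blast
    qed
    show "minor v w \<in> P" if "v \<notin> T" "w \<notin> T" "cl v = cl w" for v w
    proof (cases "v = x 1")
      case True
      then have "w = x 1" using that by (simp add: cl_def)
      then show ?thesis using True is_ideal_zero[OF J] by (simp add: P_def)
    next
      case False
      then have "(v, w) \<in> S" using that by (auto simp: cl_def T_def S_def in_rest)
      then have "minor (x 1) (x 2) * (minor v w * A ^ N) \<in> J" by (intro is_ideal_mult J N)
      then show ?thesis by (simp add: P_def u_def mult_ac)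
    qed
  qed
  define X :: "(nat \<Rightarrow>\<^sub>0 nat) \<Rightarrow>\<^sub>0 'k" where "X = pvar 0"
  \<comment> \<open>The vector (a_v, b_v) is parallel to (1, 0) on \<open>rest\<close>, to (0, 1) at
    \<open>x 1\<close>, and 0 on the cut: a zero of the ideal at which neither the minor of
    \<open>x 1\<close>, \<open>x 2\<close> nor any factor of \<open>A\<close> vanishes.\<close>
  define g where "g z = (if fst z = x 1 then (if snd z then 0 else X)
      else if fst z \<in> rest then (if snd z then X else 0) else 0)" for z
  have gJ: "poly_eval g p = 0" if "p \<in> J" for p
    using that unfolding J_def binomial_edge_ideal_def
  proof (rule ideal_gen_poly_eval_zero[rotated])
    fix f :: "('v, 'k) bpoly" assume "f \<in> {minor u v | u v. Gk_edge k x y u v}"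
    then obtain v w where f: "f = minor v w" "Gk_edge k x y v w" by blast
    have "v = x 1 \<Longrightarrow> g (w, s) = 0" "w = x 1 \<Longrightarrow> g (v, s) = 0" for s
      using edge_x1[OF f(2)] edge_x1[OF Gk_edge_sym[OF f(2)]] x_neq_y[of 1] one
      by (auto simp: g_def in_rest)
    moreover have "v \<noteq> x 1 \<Longrightarrow> g (v, False) = 0" "w \<noteq> x 1 \<Longrightarrow> g (w, False) = 0" by (simp_all add: g_def)
    ultimately show "poly_eval g f = 0"
      unfolding f(1) by (cases "v = x 1"; cases "w = x 1") (simp_all add: poly_eval_diff poly_eval_mult)
  qed
  have x12: "x 1 \<noteq> x 2" using x_eq_iff[OF one(1,3)] by simp
  have "poly_eval g A \<noteq> 0"
    using finite_rest by (auto simp: A_def poly_eval_prod g_def in_rest X_def pvar_nonzero)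
  then have gu: "poly_eval g u \<noteq> 0"
    using x2 x12 by (simp add: u_def poly_eval_diff poly_eval_mult poly_eval_power g_def X_def pvar_nonzero)
  have g1: "g z \<in> order_ge 1" for z
    by (simp add: g_def X_def pvar_def order_ge_def)
  have "card (- T) = 2 * k - 2"
    unfolding Compl_eq_Diff_UNIV T_def using finite_vertices card_vertices y_eq_iff[OF one(1,3)]
    by (simp add: card_Diff_subset)
  moreover have "card (cl ` (- T)) \<le> 2"
    using card_mono[of "UNIV :: bool set" "cl ` (- T)"] by simp
  ultimately have "card (- T) + card (cl ` (- T)) \<le> 2 * k" using k3 by simp
  moreover have "S_depth J \<le> enat (card (- T) + card (cl ` (- T)))"
    by (rule depth_le_annihilator[OF \<open>minors_ideal P T cl\<close> J _ gJ g1 gu]) (auto simp: P_def)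
  ultimately show ?thesis unfolding J_def[symmetric] by (metis enat_ord_simps(1) order_trans)
qed

lemma dim_ge_connected:
  "enat (2 * k + 1) \<le> S_dim (binomial_edge_ideal (Gk_edge k x y) :: ('v, 'k::field) bpoly set)"
proof -
  have "card (range (\<lambda>_ :: 'v. 0 :: nat)) = 1"
    by (simp add: image_constant_conv)
  then show ?thesis
    using dim_binomial_edge_ideal_ge[OF finite_vertices, of "Gk_edge k x y" "{}" "\<lambda>_. 0 :: nat"] card_vertices
    by simp
qed

text \<open>Deleting \<open>x 2\<close> and \<open>y 2\<close> leaves the k - 1 disjoint edges {x_m,
  y_m}: 2(k - 1) vertices in k - 1 classes.\<close>

lemma dim_ge_cut:
  "enat (3 * k - 3) \<le> S_dim (binomial_edge_ideal (Gk_edge k x y) :: ('v, 'k::field) bpoly set)"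
proof -
  define T where "T = {x 2, y 2}"
  define cl where "cl v = (THE i. i \<in> {1..k} \<and> (v = x i \<or> v = y i))" for v
  have cl: "cl (x i) = i" "cl (y i) = i" if "i \<in> {1..k}" for i
    unfolding cl_def using that
    by (auto intro!: the_equality simp: x_eq_iff y_eq_iff x_neq_y x_neq_y[symmetric])
  have two: "2 \<in> {1..k}" using k3 by auto
  have "u \<in> T \<or> v \<in> T \<or> cl u = cl v" if "Gk_edge k x y u v" for u v
    using that unfolding Gk_edge_def T_def by (auto simp: doubleton_eq_iff cl)
  from dim_binomial_edge_ideal_ge[OF finite_vertices this]
  have *: "enat (card (- T) + card (cl ` (- T))) \<le> S_dim (binomial_edge_ideal (Gk_edge k x y) :: ('v, 'k) bpoly set)"
    by simp
  have "card (- T) = 2 * k - 2"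
    unfolding Compl_eq_Diff_UNIV T_def using finite_vertices card_vertices x_neq_y[OF two two]
    by (simp add: card_Diff_subset)
  moreover have "{1..k} - {2} \<subseteq> cl ` (- T)"
  proof
    fix i assume "i \<in> {1..k} - {2}"
    then have "x i \<in> - T" "cl (x i) = i" using two by (auto simp: T_def cl x_eq_iff x_neq_y)
    then show "i \<in> cl ` (- T)" by (metis imageI)
  qed
  then have "k - 1 \<le> card (cl ` (- T))"
    using card_mono[of "cl ` (- T)" "{1..k} - {2}"] finite_subset[OF subset_UNIV[of "- T"] finite_vertices] two
    by simp
  ultimately have "3 * k - 3 \<le> card (- T) + card (cl ` (- T))" using k3 by simp
  then show ?thesis using * by (metis enat_ord_simps(1) order_trans)
qed

end

section \<open>Chip firing on the 6-cycle\<close>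

text \<open>Positions are natural numbers read modulo 6.\<close>

inductive chip :: "nat multiset \<Rightarrow> nat multiset \<Rightarrow> bool" where
  fire: "chip (add_mset (Suc j) (add_mset (Suc j) U)) (add_mset j (add_mset (Suc (Suc j)) U))"
| wrap: "chip (add_mset (j + 6) U) (add_mset j U)"
| refl: "chip M M"
| sym: "chip M N \<Longrightarrow> chip N M"
| trans [trans]: "chip M N \<Longrightarrow> chip N L \<Longrightarrow> chip M L"

lemma chip_add: "chip M N \<Longrightarrow> chip (M + U) (N + U)"
  by (induction rule: chip.induct) (auto intro: chip.intros)

lemma chip_add_mset: "chip M N \<Longrightarrow> chip (add_mset i M) (add_mset i N)"
  using chip_add[of M N "{#i#}"] by simp

lemma chip_size: "chip M N \<Longrightarrow> size M = size N"
  by (induction rule: chip.induct) auto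

lemma chip_wrap_mod: "chip (add_mset j U) (add_mset (j mod 6) U)"
proof (induction j rule: less_induct)
  case (less j)
  show ?case
  proof (cases "j < 6")
    case False
    then obtain i where j: "j = i + 6" by (metis add.commute le_add_diff_inverse not_less)
    have "chip (add_mset j U) (add_mset i U)" unfolding j by (rule chip.wrap)
    also have "chip (add_mset i U) (add_mset (i mod 6) U)" by (rule less) (simp add: j)
    finally show ?thesis by (simp add: j)
  qed (simp add: chip.refl)
qed

lemma chip_mod: "chip M (image_mset (\<lambda>j. j mod 6) M)"
proof (induction M)
  case (add j M)
  have "chip (add_mset j M) (add_mset (j mod 6) M)" by (rule chip_wrap_mod)
  also have "chip \<dots> (add_mset (j mod 6) (image_mset (\<lambda>j. j mod 6) M))"
    using add by (rule chip_add_mset)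
  finally show ?case by simp
qed (simp add: chip.refl)

lemma chip_cong_mod:
  "image_mset (\<lambda>j. j mod 6) M = image_mset (\<lambda>j. j mod 6) N \<Longrightarrow> chip M N"
  using chip_mod[of M] chip_mod[of N] by (metis chip.sym chip.trans)

text \<open>Fire the sites r, r - 1, ..., l + 1 in turn: the doubled site travels down the run, and
  everything above it moves up by one.\<close>

lemma chip_run_end:
  "l < r \<Longrightarrow> chip (add_mset r (mset_set {l + 1..r})) (add_mset l (mset_set {l + 2..r + 1}))"
proof (induction r)
  case (Suc r)
  show ?case
  proof (cases "l = r")
    case True
    then show ?thesis using chip.fire[of r "{#}"] by (simp add: add_mset_commute)
  next
    case False
    with Suc.prems have lr: "l < r" by simp
    have "add_mset (Suc r) (mset_set {l + 1..Suc r})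
        = add_mset (Suc r) (add_mset (Suc r) (mset_set {l + 1..r}))"
      using lr by (simp add: atLeastAtMostSuc_conv)
    also have "chip \<dots> (add_mset r (add_mset (Suc (Suc r)) (mset_set {l + 1..r})))"
      by (rule chip.fire)
    also have "\<dots> = add_mset (Suc (Suc r)) (add_mset r (mset_set {l + 1..r}))" by simp
    also have "chip \<dots> (add_mset (Suc (Suc r)) (add_mset l (mset_set {l + 2..r + 1})))"
      by (intro chip_add_mset Suc.IH lr)
    also have "\<dots> = add_mset l (mset_set {l + 2..Suc r + 1})"
      using lr by (simp add: atLeastAtMostSuc_conv)
    finally show ?thesis .
  qed
qed simp

lemma mset_set_atLeastAtMost_split:
  fixes l h r :: nat
  assumes "l \<le> h" "h \<le> r"
  shows "mset_set {l + 1..r} = mset_set {l + 1..h} + mset_set {h + 1..r}"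
proof -
  have "{l + 1..r} = {l + 1..h} \<union> {h + 1..r}" using assms by auto
  then show ?thesis by (simp add: mset_set_Union)
qed

lemma mset_set_atLeastAtMost_remove:
  fixes l h r :: nat
  assumes "l < h" "h \<le> r"
  shows "mset_set ({l + 1..r} - {h}) = mset_set {l + 1..h - 1} + mset_set {h + 1..r}"
proof -
  have "{l + 1..r} - {h} = {l + 1..h - 1} \<union> {h + 1..r}" using assms by auto
  moreover have "{l + 1..h - 1} \<inter> {h + 1..r} = {}" by auto
  ultimately show ?thesis by (simp add: mset_set_Union)
qed

text \<open>An extra chip inside a run fills the free sites at both ends and opens one hole.
  Conservation of the position sum forces the hole to be the mirror image l + 1 + r - i of
  \<open>i\<close>.\<close>

lemma chip_run:
  assumes "l < i" "i \<le> r"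
  shows "chip (add_mset i (mset_set {l + 1..r}))
    (add_mset l (add_mset (r + 1) (mset_set ({l + 1..r} - {l + 1 + r - i}))))"
  using assms(2)
proof (induction r rule: dec_induct)
  case base
  have "{l + 1..i} - {l + 1 + i - i} = {l + 2..i}" by auto
  moreover have "mset_set {l + 2..i + 1} = add_mset (i + 1) (mset_set {l + 2..i})"
    using assms(1) by (simp add: atLeastAtMostSuc_conv)
  ultimately show ?case using chip_run_end[OF assms(1)] by simp
next
  case (step r)
  define h where "h = l + 1 + r - i"
  have h: "l < h" "h \<le> r" "l + 1 + Suc r - i = h + 1" using step assms by (auto simp: h_def)
  have "add_mset i (mset_set {l + 1..Suc r}) = add_mset (Suc r) (add_mset i (mset_set {l + 1..r}))"
    using step assms by (simp add: atLeastAtMostSuc_conv)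
  also have "chip \<dots> (add_mset (Suc r) (add_mset l (add_mset (r + 1) (mset_set ({l + 1..r} - {h})))))"
    unfolding h_def by (intro chip_add_mset step.IH)
  also have "\<dots> = add_mset (r + 1) (mset_set {h + 1..r + 1}) + add_mset l (mset_set {l + 1..h - 1})"
    unfolding mset_set_atLeastAtMost_remove[OF h(1,2)] using h by (simp add: atLeastAtMostSuc_conv)
  also have "chip \<dots> (add_mset h (mset_set {h + 2..r + 1 + 1}) + add_mset l (mset_set {l + 1..h - 1}))"
    using h by (intro chip_add chip_run_end) simp
  also have "\<dots> = add_mset l (add_mset (Suc r + 1) (mset_set ({l + 1..Suc r} - {l + 1 + Suc r - i})))"
  proof -
    have "mset_set {l + 1..h} = add_mset h (mset_set {l + 1..h - 1})"
      using h by (cases h) (auto simp: atLeastAtMostSuc_conv)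
    moreover have "mset_set {h + 2..r + 2} = add_mset (r + 2) (mset_set {h + 2..r + 1})"
      using h by (simp add: atLeastAtMostSuc_conv)
    ultimately show ?thesis
      unfolding h(3) using mset_set_atLeastAtMost_remove[of l "h + 1" "Suc r"] h by simp
  qed
  finally show ?case .
qed

lemma inj_on_mod6: "inj_on (\<lambda>j::nat. j mod 6) {l + 1..r}" if "r \<le> l + 6"
proof (rule inj_onI)
  fix a b assume ab: "a \<in> {l + 1..r}" "b \<in> {l + 1..r}" "a mod 6 = b mod 6"
  have "a - b < 6" "b - a < 6" using ab that by auto
  moreover have "6 dvd a - b" "6 dvd b - a"
    using ab(3) by (metis mod_eq_dvd_iff_nat nat_le_linear diff_is_0_eq dvd_0_right)+
  ultimately have "a - b = 0" "b - a = 0" using nat_dvd_not_less by blast+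
  then show "a = b" by simp
qed

lemma image_mset_mod_mset_set:
  fixes A :: "nat set"
  assumes "inj_on (\<lambda>j. j mod 6) A"
  shows "image_mset (\<lambda>j. j mod 6) (mset_set ((\<lambda>j. j mod 6) ` A)) = image_mset (\<lambda>j. j mod 6) (mset_set A)"
proof -
  have "mset_set ((\<lambda>j. j mod 6) ` A) = image_mset (\<lambda>j. j mod 6) (mset_set A)"
    by (rule image_mset_mset_set[OF assms, symmetric])
  then show ?thesis by (simp add: multiset.map_comp comp_def)
qed

text \<open>Apply \<open>chip_run\<close> to the maximal cyclic run of occupied sites around
  \<open>i\<close>; with at most four occupied sites its two free ends are different.\<close>

lemma chip_squarefree_step:
  assumes X: "X \<subseteq> {..<6}" "card X \<le> 4" and i: "i \<in> X"
  shows "\<exists>Y\<subseteq>{..<6}. chip (add_mset i (mset_set X)) (mset_set Y)"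
proof -
  have finX: "finite X" using X(1) by (rule finite_subset) simp
  have ex: "\<exists>n. (i + n) mod 6 \<notin> X"
  proof (rule ccontr)
    assume "\<not> ?thesis"
    then have all: "(i + n) mod 6 \<in> X" for n by auto
    have "j \<in> X" if "j < 6" for j
      using all[of "6 - i + j"] that i X(1) by (auto simp: lessThan_def)
    then have "{..<6} \<subseteq> X" by auto
    then show False using card_mono[OF finX, of "{..<6}"] X(2) by simp
  qed
  \<comment> \<open>Cyclic distances from \<open>i\<close> to the first free site ahead
    (\<open>q\<close>) and behind (\<open>p\<close>); the summand 6 keeps the subtraction within the
    naturals.\<close>
  define q where "q = (LEAST n. (i + n) mod 6 \<notin> X)"
  define p where "p = (LEAST n. (i + 6 - n) mod 6 \<notin> X)"
  have i6: "i < 6" using i X(1) by auto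
  have q: "(i + q) mod 6 \<notin> X" unfolding q_def using ex by (rule LeastI_ex)
  have qlt: "(i + n) mod 6 \<in> X" if "n < q" for n using that not_less_Least unfolding q_def by blast
  have q6: "q \<le> 6"
  proof (rule ccontr)
    assume "\<not> q \<le> 6"
    then have *: "(i + n) mod 6 \<in> X" if "n \<le> 6" for n using that qlt by auto
    obtain n where n: "(i + n) mod 6 \<notin> X" using ex by auto
    have "(i + n mod 6) mod 6 = (i + n) mod 6" by (simp add: mod_add_right_eq)
    then show False using *[of "n mod 6"] n by simp
  qed
  have "(i + 6 - (6 - q)) mod 6 \<notin> X" using q q6 by simp
  then have p: "(i + 6 - p) mod 6 \<notin> X" and pq: "p \<le> 6 - q"
    unfolding p_def by (rule LeastI, rule Least_le)
  have plt: "(i + 6 - n) mod 6 \<in> X" if "n < p" for n using that not_less_Least unfolding p_def by blast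
  have p0: "p > 0" using p i i6 by (cases p) auto
  have q0: "q > 0" using q i i6 by (cases q) auto
  \<comment> \<open>The run unrolled to an interval of integers, in which \<open>i\<close> appears
    as \<open>i + 6\<close>; \<open>l\<close> and \<open>r + 1\<close> are the free ends.\<close>
  define l r where "l = i + 6 - p" and "r = i + 5 + q"
  define A where "A = {l + 1..r}"
  have A: "a mod 6 \<in> X" if "a \<in> A" for a
  proof (cases "a < i + 6")
    case True
    then show ?thesis using plt[of "i + 6 - a"] that by (auto simp: A_def l_def)
  next
    case False
    then have "a = (i + (a - (i + 6))) + 6" by simp
    then have "a mod 6 = (i + (a - (i + 6))) mod 6" by (metis mod_add_self2)
    then show ?thesis using qlt[of "a - (i + 6)"] that False q0 by (auto simp: A_def r_def)
  qed
  have lr: "r \<le> l + 6" "l < i + 6" "i + 6 \<le> r" using pq q6 p0 q0 by (auto simp: l_def r_def)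
  have injA: "inj_on (\<lambda>j. j mod 6) A" unfolding A_def by (rule inj_on_mod6[OF lr(1)])
  have "card A \<le> card X"
    using card_mono[OF finX, of "(\<lambda>j. j mod 6) ` A"] A card_image[OF injA] by auto
  moreover have "card A = p + q - 1" using pq q6 p0 q0 by (simp add: A_def l_def r_def)
  \<comment> \<open>The ends are p + q apart, so this bound keeps them distinct modulo 6.\<close>
  ultimately have pq5: "p + q \<le> 5" using X(2) by linarith
  define h where "h = l + 1 + r - (i + 6)"
  define f where "f = (\<lambda>j::nat. j mod 6)"
  define Y where "Y = insert (l mod 6) (insert ((r + 1) mod 6) (f ` (A - {h}) \<union> (X - f ` A)))"
  have f6: "f j < 6" for j by (simp add: f_def)
  have "add_mset i (mset_set X) = add_mset i (mset_set (f ` A) + mset_set (X - f ` A))"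
  proof -
    have "X = f ` A \<union> (X - f ` A)" using A by (auto simp: f_def)
    moreover have "mset_set (f ` A \<union> (X - f ` A)) = mset_set (f ` A) + mset_set (X - f ` A)"
      using finX by (intro mset_set_Union) (auto simp: A_def)
    ultimately show ?thesis by simp
  qed
  also have "chip \<dots> (add_mset (i + 6) (mset_set A + mset_set (X - f ` A)))"
  proof (rule chip_cong_mod)
    have "image_mset f (mset_set (f ` A)) = image_mset f (mset_set A)"
      unfolding f_def by (rule image_mset_mod_mset_set[OF injA])
    then show "image_mset (\<lambda>j. j mod 6) (add_mset i (mset_set (f ` A) + mset_set (X - f ` A))) =
      image_mset (\<lambda>j. j mod 6) (add_mset (i + 6) (mset_set A + mset_set (X - f ` A)))"
      by (simp add: f_def)
  qed
  also have "\<dots> = add_mset (i + 6) (mset_set {l + 1..r}) + mset_set (X - f ` A)"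
    by (simp add: A_def)
  also have "chip \<dots> (add_mset l (add_mset (r + 1) (mset_set (A - {h}))) + mset_set (X - f ` A))"
    unfolding A_def h_def by (intro chip_add chip_run lr)
  also have "chip \<dots> (mset_set Y)"
  proof (rule chip_cong_mod)
    have "mset_set Y = add_mset (l mod 6) (add_mset ((r + 1) mod 6) (mset_set (f ` (A - {h})) + mset_set (X - f ` A)))"
    proof -
      have sub: "f ` (A - {h}) \<union> (X - f ` A) \<subseteq> X" using A by (auto simp: f_def)
      have l: "l mod 6 \<notin> X" using p by (simp add: l_def)
      have "r + 1 = (i + q) + 6" by (simp add: r_def)
      then have "(r + 1) mod 6 = (i + q) mod 6" by (simp only: mod_add_self2)
      then have r: "(r + 1) mod 6 \<notin> X" using q by simp
      have "l mod 6 \<noteq> (r + 1) mod 6"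
      proof
        assume "l mod 6 = (r + 1) mod 6"
        moreover have "r + 1 = l + (p + q)" using pq q6 by (simp add: l_def r_def)
        ultimately have "6 dvd p + q" by (metis add_diff_cancel_left' le_add1 mod_eq_dvd_iff_nat)
        then show False using pq5 p0 by (auto dest: dvd_imp_le)
      qed
      moreover have "mset_set (f ` (A - {h}) \<union> (X - f ` A)) = mset_set (f ` (A - {h})) + mset_set (X - f ` A)"
        using finX by (intro mset_set_Union) (auto simp: A_def)
      moreover define Z where "Z = f ` (A - {h}) \<union> (X - f ` A)"
      then have "l mod 6 \<notin> Z" "(r + 1) mod 6 \<notin> Z" "finite Z"
        using sub l r finite_subset[OF sub finX] by auto
      ultimately show ?thesis
        unfolding Y_def Z_def[symmetric] by (simp del: Suc_eq_plus1_left)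
    qed
    moreover have "mset_set (f ` (A - {h})) = image_mset f (mset_set (A - {h}))"
      using injA by (intro image_mset_mset_set[symmetric]) (auto simp: f_def inj_on_def)
    ultimately show "image_mset (\<lambda>j. j mod 6) (add_mset l (add_mset (r + 1) (mset_set (A - {h}))) + mset_set (X - f ` A))
       = image_mset (\<lambda>j. j mod 6) (mset_set Y)"
      by (simp add: f_def multiset.map_comp comp_def)
  qed
  finally show ?thesis
    using X(1) f6 by (intro exI[of _ Y]) (auto simp: Y_def)
qed

lemma chip_squarefree:
  "size M \<le> 5 \<Longrightarrow> \<exists>X\<subseteq>{..<6}. chip M (mset_set X)"
proof (induction M)
  case empty
  then show ?case by (intro exI[of _ "{}"]) (simp add: chip.refl)
next
  case (add i M)
  then obtain X where X: "X \<subseteq> {..<6}" "chip M (mset_set X)" by auto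
  have fin: "finite X" using X(1) by (rule finite_subset) simp
  have card: "card X \<le> 4" using chip_size[OF X(2)] add.prems by simp
  have *: "chip (add_mset i M) (add_mset (i mod 6) (mset_set X))"
    by (rule chip.trans[OF chip_add_mset[OF X(2)] chip_wrap_mod])
  show ?case
  proof (cases "i mod 6 \<in> X")
    case True
    from chip_squarefree_step[OF X(1) card this]
    obtain Y where "Y \<subseteq> {..<6}" "chip (add_mset (i mod 6) (mset_set X)) (mset_set Y)" by blast
    then show ?thesis using chip.trans[OF *] by blast
  next
    case False
    then have "chip (add_mset i M) (mset_set (insert (i mod 6) X))" using * fin by simp
    then show ?thesis using X(1) by (intro exI[of _ "insert (i mod 6) X"]) auto
  qed
qed

text \<open>Every site except \<open>s\<close> once, and one more chip \<open>t\<close> places after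
  \<open>s\<close>. The position sum is t + 3 modulo 6 for every \<open>s\<close>, so
  \<open>t\<close> names the chip class; t = 6 occupies all six sites once.\<close>

definition crowd :: "nat \<Rightarrow> nat \<Rightarrow> nat multiset" where
  "crowd t s = add_mset (s + t) (mset_set {s + 1..s + 5})"

text \<open>For t \<le> 5, firing down the run that ends at the doubled site moves that site up by
  one and puts a chip on the free site \<open>s\<close>, leaving s + 1 free. For t = 6 only wrapping
  is needed.\<close>

lemma chip_crowd_Suc: "1 \<le> t \<Longrightarrow> t \<le> 6 \<Longrightarrow> chip (crowd t s) (crowd t (Suc s))"
proof (cases "t = 6")
  case True
  have "{s + 1..s + 5} = {s + 1, s + 2, s + 3, s + 4, s + 5}"
    "{Suc s + 1..Suc s + 5} = {s + 2, s + 3, s + 4, s + 5, s + 6}" by auto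
  then have "crowd t s = {#s + 6, s + 1, s + 2, s + 3, s + 4, s + 5#}"
    "crowd t (Suc s) = {#(s + 1) + 6, s + 2, s + 3, s + 4, s + 5, s + 6#}"
    using True by (simp_all add: crowd_def)
  then show ?thesis
    using chip.sym[OF chip.wrap[of "s + 1" "{#s + 6, s + 2, s + 3, s + 4, s + 5#}"]] by (simp add: add_mset_commute)
next
  case False
  assume "1 \<le> t" "t \<le> 6"
  with False have t: "1 \<le> t" "t \<le> 5" by auto
  have "crowd t s = add_mset (s + t) (mset_set {s + 1..s + t}) + mset_set {s + t + 1..s + 5}"
    unfolding crowd_def using t by (subst mset_set_atLeastAtMost_split[of _ "s + t"]) auto
  also have "chip \<dots> (add_mset s (mset_set {s + 2..s + t + 1}) + mset_set {s + t + 1..s + 5})"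
    using t by (intro chip_add chip_run_end) simp
  also have "\<dots> = add_mset s (add_mset (Suc s + t) (mset_set {s + 2..s + 5}))"
  proof -
    have "mset_set {s + 2..s + t + 1} = add_mset (s + t + 1) (mset_set {s + 2..s + t})"
      using t by (simp add: atLeastAtMostSuc_conv)
    moreover have "mset_set {s + 2..s + 5} = mset_set {s + 2..s + t} + mset_set {s + t + 1..s + 5}"
      using t mset_set_atLeastAtMost_split[of "s + 1" "s + t" "s + 5"] by simp
    ultimately show ?thesis by simp
  qed
  also have "chip \<dots> (add_mset (s + 6) (add_mset (Suc s + t) (mset_set {s + 2..s + 5})))"
    by (rule chip.sym[OF chip.wrap])
  also have "\<dots> = crowd t (Suc s)"
  proof -
    have "mset_set {Suc s + 1..Suc s + 5} = add_mset (s + 6) (mset_set {s + 2..s + 5})"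
      using atLeastAtMostSuc_conv[of "s + 2" "s + 5"] by simp
    then show ?thesis by (simp add: crowd_def)
  qed
  finally show ?thesis .
qed

lemma chip_crowd: "1 \<le> t \<Longrightarrow> t \<le> 6 \<Longrightarrow> chip (crowd t 0) (crowd t s)"
proof (induction s)
  case (Suc s)
  then have "chip (crowd t 0) (crowd t s)" by simp
  also have "chip \<dots> (crowd t (Suc s))" using Suc.prems by (rule chip_crowd_Suc)
  finally show ?case .
qed (simp add: chip.refl)

lemma chip_six:
  assumes "size M = 6" shows "\<exists>t\<in>{1..6}. chip M (crowd t 0)"
proof -
  obtain i N where "M = add_mset i N" using assms by (cases M) auto
  with assms have M: "M = add_mset i N" "size N = 5" by auto
  then obtain X where X: "X \<subseteq> {..<6}" "chip N (mset_set X)" using chip_squarefree[of N] by auto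
  have fin: "finite X" using X(1) by (rule finite_subset) simp
  have "card X = 5" using chip_size[OF X(2)] M by simp
  then have "card ({..<6} - X) = 1" using X(1) by (simp add: card_Diff_subset[OF fin])
  then obtain s where s: "{..<6} - X = {s}" by (auto simp: card_1_singleton_iff)
  then have s6: "s < 6" and Xs: "X = {..<6} - {s}" using X(1) by auto
  have X_eq: "(\<lambda>j. j mod 6) ` {s + 1..s + 5} = X"
  proof (rule card_subset_eq[OF fin])
    show "(\<lambda>j. j mod 6) ` {s + 1..s + 5} \<subseteq> X"
    proof
      fix a assume "a \<in> (\<lambda>j. j mod 6) ` {s + 1..s + 5}"
      then obtain b where b: "b \<in> {s + 1..s + 5}" "a = b mod 6" by auto
      have "b mod 6 \<noteq> s"
      proof
        assume "b mod 6 = s"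
        then have "b mod 6 = s mod 6" using s6 by simp
        then have "6 dvd b - s" using b by (simp add: mod_eq_dvd_iff_nat)
        then show False using b by (auto dest: dvd_imp_le)
      qed
      then show "a \<in> X" using b by (simp add: Xs)
    qed
    show "card ((\<lambda>j. j mod 6) ` {s + 1..s + 5}) = card X"
      using card_image[OF inj_on_mod6[of "s + 5" s]] \<open>card X = 5\<close> by simp
  qed
  \<comment> \<open>The distance from the free site \<open>s\<close> to the sixth chip, taken in 1,
    ..., 6.\<close>
  define t where "t = (if i mod 6 \<le> s then i mod 6 + 6 - s else i mod 6 - s)"
  have "i mod 6 < 6" by simp
  then have "t \<in> {1..6}" "s + t = i mod 6 + 6 \<or> s + t = i mod 6"
    using s6 unfolding t_def by auto
  then have t: "t \<in> {1..6}" "(s + t) mod 6 = i mod 6" by auto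
  have "chip M (add_mset i (mset_set X))" unfolding M(1) by (intro chip_add_mset X)
  also have "chip \<dots> (crowd t s)"
  proof (rule chip_cong_mod)
    have "image_mset (\<lambda>j. j mod 6) (mset_set X) = image_mset (\<lambda>j. j mod 6) (mset_set {s + 1..s + 5})"
      unfolding X_eq[symmetric] by (rule image_mset_mod_mset_set[OF inj_on_mod6]) simp
    then show "image_mset (\<lambda>j. j mod 6) (add_mset i (mset_set X)) = image_mset (\<lambda>j. j mod 6) (crowd t s)"
      by (simp add: crowd_def t)
  qed
  also have "chip \<dots> (crowd t 0)" using t by (intro chip.sym[OF chip_crowd]) auto
  finally show ?thesis using t by blast
qed

text \<open>The crowd is rotated until its extra chip sits on site 0 and can join the pile there;
  the remaining five chips and the new one are then normalised again.\<close>

lemma chip_many: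
  "\<exists>t\<in>{1..6}. size M = n + 6 \<longrightarrow> chip M (crowd t 0 + replicate_mset n 0)"
proof (induction n arbitrary: M)
  case 0
  then show ?case using chip_six[of M] by (cases "size M = 6") (auto intro: bexI[of _ 1])
next
  case (Suc n)
  show ?case
  proof (cases "size M = Suc n + 6")
    case True
    then obtain i N where M: "M = add_mset i N" by (cases M) auto
    then obtain t where t: "t \<in> {1..6}" "chip N (crowd t 0 + replicate_mset n 0)"
      using Suc.IH[of N] True by auto
    \<comment> \<open>This rotation puts the extra chip at s + t = 6, which wraps to 0.\<close>
    define s where "s = 6 - t"
    have st: "s + t = 6" using t by (auto simp: s_def)
    obtain t' where t': "t' \<in> {1..6}" "chip (add_mset i (mset_set {s + 1..s + 5})) (crowd t' 0)"
      using chip_six[of "add_mset i (mset_set {s + 1..s + 5})"] by auto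
    have "chip M (add_mset i (crowd t 0 + replicate_mset n 0))"
      unfolding M by (intro chip_add_mset t)
    also have "\<dots> = crowd t 0 + add_mset i (replicate_mset n 0)" by simp
    also have "chip \<dots> (crowd t s + add_mset i (replicate_mset n 0))"
      using t by (intro chip_add chip_crowd) auto
    also have "\<dots> = add_mset (0 + 6) (add_mset i (mset_set {s + 1..s + 5}) + replicate_mset n 0)"
      by (simp add: crowd_def st)
    also have "chip \<dots> (add_mset 0 (add_mset i (mset_set {s + 1..s + 5}) + replicate_mset n 0))"
      by (rule chip.wrap)
    also have "chip \<dots> (add_mset 0 (crowd t' 0 + replicate_mset n 0))"
      by (intro chip_add_mset chip_add t')
    also have "\<dots> = crowd t' 0 + replicate_mset (Suc n) 0" by simp
    finally show ?thesis using t'(1) by blast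
  qed (auto intro: bexI[of _ 1])
qed

section \<open>The binomial edge ideal of the 6-cycle\<close>

definition vdeg :: "('v \<times> bool \<Rightarrow>\<^sub>0 nat) \<Rightarrow> 'v \<Rightarrow> nat" where
  "vdeg m v = lookup m (v, True) + lookup m (v, False)"

definition separated :: "('v \<Rightarrow> 'v \<Rightarrow> bool) \<Rightarrow> ('v \<times> bool \<Rightarrow>\<^sub>0 nat) \<Rightarrow> 'v set \<Rightarrow> bool" where
  "separated E m Z \<longleftrightarrow> (\<forall>u v. E u v \<longrightarrow> u \<in> Z \<longrightarrow> v \<notin> Z \<longrightarrow> vdeg m u = 0 \<or> vdeg m v = 0)"

text \<open>The \<open>b\<close>-degree of a monomial on a union of components of its support is invariant under the
  exchanges \<open>a\<^sub>u b\<^sub>v \<leftrightarrow> a\<^sub>v b\<^sub>u\<close> along edges; \<open>label\<close> records these invariants.\<close>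

definition label :: "('v \<Rightarrow> 'v \<Rightarrow> bool) \<Rightarrow> ('v \<times> bool \<Rightarrow>\<^sub>0 nat) \<Rightarrow> ('v \<Rightarrow> nat) \<times> ('v set \<Rightarrow> nat)" where
  "label E m = (vdeg m, \<lambda>Z. if separated E m Z then \<Sum>v\<in>Z. lookup m (v, False) else 0)"

text \<open>Both ends of the edge stay in the support, so a separated set contains both or neither,
  and moving a \<open>b\<close> between them does not change its b-degree.\<close>

lemma label_exchange:
  assumes fin: "finite (UNIV :: 'v set)" and symE: "\<And>u v. E u v \<Longrightarrow> E v u" and uv: "E u (v :: 'v)"
  shows "label E (s + Poly_Mapping.single (u, True) 1 + Poly_Mapping.single (v, False) 1)
    = label E (s + Poly_Mapping.single (v, True) 1 + Poly_Mapping.single (u, False) 1)" (is "label E ?m = label E ?n")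
proof -
  have vd: "vdeg ?m = vdeg ?n"
    by (rule ext) (auto simp: vdeg_def lookup_add lookup_single when_def)
  have pos: "vdeg ?m u > 0" "vdeg ?m v > 0"
    by (auto simp: vdeg_def lookup_add lookup_single when_def)
  have "(\<Sum>w\<in>Z. lookup ?m (w, False)) = (\<Sum>w\<in>Z. lookup ?n (w, False))" if "separated E ?m Z" for Z
  proof -
    have iff: "u \<in> Z \<longleftrightarrow> v \<in> Z"
      using that uv symE[OF uv] pos unfolding separated_def by (metis less_numeral_extra(3))
    have Z: "finite Z" by (rule finite_subset[OF subset_UNIV fin])
    show ?thesis
      using iff Z by (simp add: lookup_add lookup_single when_def sum.distrib sum.delta sum.delta' eq_commute[of _ u] eq_commute[of _ v])
  qed
  moreover have "separated E ?m = separated E ?n" by (simp add: separated_def vd fun_eq_iff del: One_nat_def)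
  ultimately have "(\<lambda>Z. if separated E ?m Z then \<Sum>w\<in>Z. lookup ?m (w, False) else 0)
      = (\<lambda>Z. if separated E ?n Z then \<Sum>w\<in>Z. lookup ?n (w, False) else 0)"
    by (intro ext) (metis (no_types, lifting))
  then show ?thesis unfolding label_def vd by simp
qed

definition label_coeff :: "('v \<Rightarrow> 'v \<Rightarrow> bool) \<Rightarrow> ('v \<Rightarrow> nat) \<times> ('v set \<Rightarrow> nat) \<Rightarrow> ('v, 'k::comm_ring_1) bpoly \<Rightarrow> 'k" where
  "label_coeff E l p = (\<Sum>m\<in>keys p. if label E m = l then lookup p m else 0)"

lemma label_coeff_add: "label_coeff E l (p + q) = label_coeff E l p + label_coeff E l q"
  unfolding label_coeff_def by (rule setsum_keys_plus_distrib) auto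

lemma label_coeff_zero [simp]: "label_coeff E l 0 = 0"
  by (simp add: label_coeff_def)

lemma label_coeff_sum: "label_coeff E l (sum f A) = (\<Sum>i\<in>A. label_coeff E l (f i))"
  by (induction A rule: infinite_finite_induct) (simp_all add: label_coeff_add)

lemma label_coeff_diff: "label_coeff E l (p - q) = label_coeff E l p - label_coeff E l q"
  using label_coeff_add[of E l "p - q" q] by (simp add: algebra_simps)

lemma label_coeff_single:
  "label_coeff E l (Poly_Mapping.single m a) = (if label E m = l then a else 0)"
  by (simp add: label_coeff_def)

text \<open>The two terms of a monomial multiple of a generator share a label and cancel. These
  functionals therefore certify independence of monomials with distinct labels.\<close>

lemma label_coeff_binomial_edge_ideal:
  fixes p :: "('v, 'k::comm_ring_1) bpoly"
  assumes fin: "finite (UNIV :: 'v set)" and symE: "\<And>u v. E u v \<Longrightarrow> E v u"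
    and p: "p \<in> binomial_edge_ideal E"
  shows "label_coeff E l p = 0"
proof -
  \<comment> \<open>The largest ideal inside the kernel; the kernel of a linear functional need not
    be closed under multiplication.\<close>
  define I where "I = {p :: ('v, 'k) bpoly. \<forall>r. label_coeff E l (r * p) = 0}"
  have "is_ideal I"
    unfolding is_ideal_def I_def by (simp add: distrib_left label_coeff_add flip: mult.assoc)
  moreover have "minor u v \<in> I" if "E u v" for u v
  proof -
    have "label_coeff E l (r * minor u v) = 0" for r :: "('v, 'k) bpoly"
    proof -
      have "r * minor u v = (\<Sum>m\<in>keys r.
          Poly_Mapping.single (m + Poly_Mapping.single (u, True) 1 + Poly_Mapping.single (v, False) 1) (lookup r m)
        - Poly_Mapping.single (m + Poly_Mapping.single (v, True) 1 + Poly_Mapping.single (u, False) 1) (lookup r m))"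
        by (subst poly_mapping_expand[of r])
          (simp add: sum_distrib_right right_diff_distrib avar_def bvar_def pvar_def mult_single add.assoc sum_subtractf)
      then show ?thesis
        by (simp add: label_coeff_sum label_coeff_diff label_coeff_single label_exchange[where E = E, OF fin symE that, simplified])
    qed
    then show ?thesis by (simp add: I_def)
  qed
  ultimately have "binomial_edge_ideal E \<subseteq> I"
    unfolding binomial_edge_ideal_def by (intro ideal_gen_least) auto
  then have "label_coeff E l (1 * p) = 0" using p unfolding I_def by blast
  then show ?thesis by simp
qed

lemma independent_labels:
  fixes d :: "'i \<Rightarrow> 'k::comm_ring_1"
  assumes "finite (UNIV :: 'v set)" "\<And>u v. E u v \<Longrightarrow> E v (u :: 'v)"
    and "finite I" "inj_on (\<lambda>i. label E (\<mu> i)) I"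
    and "(\<Sum>i\<in>I. cst (d i) * mon (\<mu> i)) \<in> binomial_edge_ideal E" and i: "i \<in> I"
  shows "d i = 0"
proof -
  have "0 = label_coeff E (label E (\<mu> i)) (\<Sum>i\<in>I. cst (d i) * mon (\<mu> i))"
    using label_coeff_binomial_edge_ideal[OF assms(1,2,5)] by simp
  also have "\<dots> = (\<Sum>j\<in>I. if j = i then d j else 0)"
    unfolding label_coeff_sum cst_mono label_coeff_single
    using assms(4) i by (intro sum.cong) (auto dest: inj_onD)
  also have "\<dots> = d i" using assms(3) i by simp
  finally show ?thesis by simp
qed

section \<open>Coordinates on the 6-cycle and the firing relation\<close>

locale six_cycle =
  fixes E :: "'v \<Rightarrow> 'v \<Rightarrow> bool" and c :: "nat \<Rightarrow> 'v" and J :: "('v, 'k::field) bpoly set"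
  assumes periodic: "c (j + 6) = c j"
    and c_inj: "i < 6 \<Longrightarrow> j < 6 \<Longrightarrow> c i = c j \<Longrightarrow> i = j"
    and c_surj: "\<exists>i<6. v = c i"
    and E_iff: "E u v \<longleftrightarrow> (\<exists>j. u = c j \<and> v = c (Suc j) \<or> u = c (Suc j) \<and> v = c j)"
    and J_def: "J = binomial_edge_ideal E"
begin

lemma finite_vertices: "finite (UNIV :: 'v set)"
proof -
  have "UNIV = c ` {..<6}" using c_surj by auto
  then show ?thesis by (metis finite_imageI finite_lessThan)
qed

lemma card_vertices: "card (UNIV :: 'v set) = 6"
proof -
  have "UNIV = c ` {..<6}" using c_surj by auto
  moreover have "inj_on c {..<6}" using c_inj by (auto intro: inj_onI)
  ultimately show ?thesis by (metis card_image card_lessThan)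
qed

lemma E_sym: "E u v \<Longrightarrow> E v u"
  unfolding E_iff by blast

lemma c_mod: "c (j mod 6) = c j"
proof (induction j rule: less_induct)
  case (less j)
  show ?case
  proof (cases "j < 6")
    case False
    then have j: "j = (j - 6) + 6" by simp
    then have "c j = c (j - 6)" "j mod 6 = (j - 6) mod 6"
      by (metis periodic, metis mod_add_self2)
    then show ?thesis using less[of "j - 6"] False by simp
  qed simp
qed

lemma c_eq_iff: "c i = c j \<longleftrightarrow> i mod 6 = j mod 6"
  using c_inj[of "i mod 6" "j mod 6"] by (metis c_mod mod_less_divisor zero_less_numeral)

lemma J_ideal: "is_ideal J"
  by (simp add: J_def is_ideal_binomial_edge_ideal)

definition z :: "nat \<Rightarrow> ('v, 'k) bpoly" where "z j = bvar (c j)"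

definition \<theta> :: "nat \<Rightarrow> ('v, 'k) bpoly" where "\<theta> j = avar (c j) - bvar (c (Suc j))"

definition zprod :: "nat multiset \<Rightarrow> ('v, 'k) bpoly" where "zprod M = prod_mset (image_mset z M)"

definition vprod :: "('v \<times> bool) multiset \<Rightarrow> ('v, 'k) bpoly" where "vprod N = prod_mset (image_mset pvar N)"

lemma zprod_simps [simp]: "zprod {#} = 1" "zprod (add_mset j M) = z j * zprod M" "zprod (M + M') = zprod M * zprod M'"
  and vprod_simps [simp]: "vprod {#} = 1" "vprod (add_mset w N) = pvar w * vprod N" "vprod (N + N') = vprod N * vprod N'"
  by (simp_all add: zprod_def vprod_def)

lemma zprod_vprod: "zprod M = vprod (image_mset (\<lambda>j. (c j, False)) M)"
  by (simp add: zprod_def vprod_def multiset.map_comp comp_def z_def[abs_def] bvar_def)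

lemma z_mod: "z (j + 6) = z j"
  by (simp add: z_def periodic)

lemma \<theta>_mod: "\<theta> (j mod 6) = \<theta> j"
proof -
  have "c (Suc (j mod 6)) = c (Suc j)" unfolding c_eq_iff by (simp add: mod_Suc_eq)
  then show ?thesis by (simp add: \<theta>_def c_mod)
qed

text \<open>Substitute a_j = z_(j+1) + \<theta>_j in the minor: the corrections to the firing rule
  are linear in z and carry a factor \<theta>, which permits induction on the degree.\<close>

lemma fire_relation:
  "z (Suc j) * z (Suc j) - z j * z (Suc (Suc j)) + \<theta> j * z (Suc j) - \<theta> (Suc j) * z j \<in> J"
proof -
  have "E (c j) (c (Suc j))" unfolding E_iff by blast
  then have "minor (c j) (c (Suc j)) \<in> J" unfolding J_def by (rule minor_in_binomial_edge_ideal)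
  moreover have "minor (c j) (c (Suc j)) = z (Suc j) * z (Suc j) - z j * z (Suc (Suc j)) + \<theta> j * z (Suc j) - \<theta> (Suc j) * z j"
    by (simp add: z_def \<theta>_def algebra_simps)
  ultimately show ?thesis by simp
qed

section \<open>Normal forms and their spanning property\<close>

type_synonym index = "(nat \<Rightarrow> nat) \<times> (nat set + nat \<times> nat)"

text \<open>\<open>Inl X\<close> is a squarefree product of \<open>z\<close>'s; \<open>Inr (i, r)\<close> is the \<open>r\<close>-th of the six
  chip classes in degree \<open>6 + i\<close>.\<close>

fun chips :: "nat set + nat \<times> nat \<Rightarrow> nat multiset" where
  "chips (Inl X) = mset_set X"
| "chips (Inr (i, r)) = crowd (Suc r) 0 + replicate_mset i 0"

text \<open>The full set of six sites is absent from the \<open>Inl\<close> part because, up to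
  wrapping, it is \<open>Inr (0, 5)\<close>. Bounding \<open>i\<close> by \<open>D\<close> keeps the
  set finite.\<close>

definition normals :: "nat \<Rightarrow> (nat set + nat \<times> nat) set" where
  "normals D = Inl ` {X. X \<subseteq> {..<6} \<and> card X \<le> 5} \<union> Inr ` ({..D} \<times> {..<6})"

definition indices :: "nat \<Rightarrow> index set" where
  "indices D = {(\<alpha>, e). \<alpha> \<in> PiE {..<6} (\<lambda>_. {..D}) \<and> e \<in> normals D \<and> (\<Sum>j<6. \<alpha> j) + size (chips e) \<le> D}"

fun monomial :: "index \<Rightarrow> ('v, 'k) bpoly" where
  "monomial (\<alpha>, e) = (\<Prod>j<6. \<theta> j ^ \<alpha> j) * zprod (chips e)"

definition bump :: "nat \<Rightarrow> index \<Rightarrow> index" where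
  "bump j \<iota> = ((fst \<iota>)(j := Suc (fst \<iota> j)), snd \<iota>)"

text \<open>The K-span, modulo J, of the normal forms of degree at most \<open>D\<close>.\<close>

definition W :: "nat \<Rightarrow> ('v, 'k) bpoly set" where
  "W D = {p. \<exists>f. p - (\<Sum>\<iota>\<in>indices D. cst (f \<iota>) * monomial \<iota>) \<in> J}"

lemma finite_indices: "finite (indices D)"
proof -
  have "finite (normals D)" by (simp add: normals_def)
  then have "finite (PiE {..<6::nat} (\<lambda>_. {..D}) \<times> normals D)" by (simp add: finite_PiE)
  then show ?thesis by (rule finite_subset[rotated]) (auto simp: indices_def)
qed

lemma indices_mono: "D \<le> D' \<Longrightarrow> indices D \<subseteq> indices D'"
proof (intro subsetI)
  fix \<iota> assume D: "D \<le> D'" and "\<iota> \<in> indices D"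
  then obtain \<alpha> e where \<iota>: "\<iota> = (\<alpha>, e)" and *: "\<alpha> \<in> PiE {..<6} (\<lambda>_. {..D})" "e \<in> normals D"
    "(\<Sum>j<6. \<alpha> j) + size (chips e) \<le> D" by (auto simp: indices_def)
  have "\<alpha> \<in> PiE {..<6} (\<lambda>_. {..D'})"
    by (rule subsetD[OF PiE_mono *(1)]) (use D in auto)
  moreover have "e \<in> normals D'" using *(2) D by (auto simp: normals_def)
  ultimately show "\<iota> \<in> indices D'" using *(3) D by (simp add: indices_def \<iota>)
qed

lemma bump_indices: "\<iota> \<in> indices D \<Longrightarrow> j < 6 \<Longrightarrow> bump j \<iota> \<in> indices (Suc D)"
proof -
  assume \<iota>: "\<iota> \<in> indices D" and j: "j < 6"
  obtain \<alpha> e where e: "\<iota> = (\<alpha>, e)" by (cases \<iota>)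
  have "(\<Sum>i<6. (\<alpha>(j := Suc (\<alpha> j))) i) = Suc (\<Sum>i<6. \<alpha> i)"
  proof -
    have "(\<Sum>i<6. (\<alpha>(j := Suc (\<alpha> j))) i) = (\<Sum>i<6. \<alpha> i + (if i = j then 1 else 0))"
      by (intro sum.cong) auto
    then show ?thesis using j by (simp add: sum.distrib)
  qed
  then show ?thesis using \<iota> j by (auto simp: e bump_def indices_def normals_def PiE_iff extensional_def le_SucI)
qed

lemma monomial_bump: "j < 6 \<Longrightarrow> monomial (bump j \<iota>) = \<theta> j * monomial \<iota>"
proof -
  assume j: "j < 6"
  obtain \<alpha> e where e: "\<iota> = (\<alpha>, e)" by (cases \<iota>)
  have "(\<Prod>i<6. \<theta> i ^ (\<alpha>(j := Suc (\<alpha> j))) i) = (\<Prod>i<6. \<theta> i ^ \<alpha> i * (if i = j then \<theta> j else 1))"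
    by (intro prod.cong) auto
  also have "\<dots> = (\<Prod>i<6. \<theta> i ^ \<alpha> i) * \<theta> j" using j by (simp add: prod.distrib)
  finally show ?thesis by (simp add: e bump_def mult_ac)
qed

lemma inj_bump: "inj (bump j)"
proof (rule injI)
  fix x y :: index assume *: "bump j x = bump j y"
  have "fst x i = fst y i" for i
  proof -
    have "fst (bump j x) i = fst (bump j y) i" by (simp only: *)
    then show ?thesis by (cases "i = j") (simp_all add: bump_def)
  qed
  moreover have "snd x = snd y" using * by (simp add: bump_def)
  ultimately show "x = y" by (simp add: prod_eq_iff fun_eq_iff)
qed

lemma W_I: "p - (\<Sum>\<iota>\<in>indices D. cst (f \<iota>) * monomial \<iota>) \<in> J \<Longrightarrow> p \<in> W D"
  unfolding W_def by blast

lemma W_J: "p \<in> J \<Longrightarrow> p \<in> W D"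
  unfolding W_def by (auto intro!: exI[of _ "\<lambda>_. 0"])

lemma W_add: "p \<in> W D \<Longrightarrow> q \<in> W D \<Longrightarrow> p + q \<in> W D"
proof -
  assume "p \<in> W D" "q \<in> W D"
  then obtain f g where "p - (\<Sum>\<iota>\<in>indices D. cst (f \<iota>) * monomial \<iota>) \<in> J" "q - (\<Sum>\<iota>\<in>indices D. cst (g \<iota>) * monomial \<iota>) \<in> J"
    by (auto simp: W_def)
  from is_ideal_add[OF J_ideal this]
  have "p + q - (\<Sum>\<iota>\<in>indices D. cst (f \<iota> + g \<iota>) * monomial \<iota>) \<in> J"
    by (simp add: cst_add distrib_right sum.distrib algebra_simps)
  then show ?thesis by (rule W_I)
qed

lemma W_cst: "p \<in> W D \<Longrightarrow> cst a * p \<in> W D"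
proof -
  assume "p \<in> W D"
  then obtain f where "p - (\<Sum>\<iota>\<in>indices D. cst (f \<iota>) * monomial \<iota>) \<in> J" by (auto simp: W_def)
  from is_ideal_mult[OF J_ideal this, of "cst a"]
  have "cst a * p - (\<Sum>\<iota>\<in>indices D. cst (a * f \<iota>) * monomial \<iota>) \<in> J"
    by (simp add: right_diff_distrib sum_distrib_left cst_mult mult.assoc)
  then show ?thesis by (rule W_I)
qed

lemma W_minus: "p \<in> W D \<Longrightarrow> - p \<in> W D"
  using W_cst[of p D "- 1"] by (simp add: single_uminus)

lemma W_diff: "p \<in> W D \<Longrightarrow> q \<in> W D \<Longrightarrow> p - q \<in> W D"
  using W_add[OF _ W_minus] by force

lemma W_sum: "(\<And>i. i \<in> A \<Longrightarrow> f i \<in> W D) \<Longrightarrow> sum f A \<in> W D"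
  by (induction A rule: infinite_finite_induct) (auto intro: W_add W_J is_ideal_zero[OF J_ideal])

lemma W_monomial: "\<iota> \<in> indices D \<Longrightarrow> monomial \<iota> \<in> W D"
proof -
  assume \<iota>: "\<iota> \<in> indices D"
  have "(\<Sum>\<kappa>\<in>indices D. cst (if \<kappa> = \<iota> then 1 else 0) * monomial \<kappa>) = (\<Sum>\<kappa>\<in>indices D. if \<kappa> = \<iota> then monomial \<kappa> else 0)"
    by (intro sum.cong) auto
  also have "\<dots> = monomial \<iota>" using \<iota> finite_indices by simp
  finally show ?thesis
    unfolding W_def using is_ideal_zero[OF J_ideal] by (auto intro!: exI[of _ "\<lambda>\<kappa>. if \<kappa> = \<iota> then 1 else 0"])
qed

lemma W_expand:
  assumes "p \<in> W D" obtains f where "p - (\<Sum>\<iota>\<in>indices D. cst (f \<iota>) * monomial \<iota>) \<in> J"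
  using assms by (auto simp: W_def)

lemma W_via: "p - q \<in> J \<Longrightarrow> q \<in> W D \<Longrightarrow> p \<in> W D"
  using W_add[of "p - q" D q] W_J[of "p - q" D] by simp

lemma W_mono: "p \<in> W D \<Longrightarrow> D \<le> D' \<Longrightarrow> p \<in> W D'"
proof -
  assume p: "p \<in> W D" and D: "D \<le> D'"
  obtain f where "p - (\<Sum>\<iota>\<in>indices D. cst (f \<iota>) * monomial \<iota>) \<in> J" using p by (rule W_expand)
  then show ?thesis
    by (rule W_via) (use indices_mono[OF D] in \<open>auto intro!: W_sum W_cst W_monomial\<close>)
qed

lemma W_\<theta>: "p \<in> W D \<Longrightarrow> \<theta> j * p \<in> W (Suc D)"
proof -
  assume p: "p \<in> W D"
  define i where "i = j mod 6"
  have i: "i < 6" "\<theta> j = \<theta> i" by (simp_all add: i_def \<theta>_mod)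
  obtain f where "p - (\<Sum>\<iota>\<in>indices D. cst (f \<iota>) * monomial \<iota>) \<in> J" using p by (rule W_expand)
  from is_ideal_mult[OF J_ideal this, of "\<theta> i"]
  have "\<theta> i * p - (\<Sum>\<iota>\<in>indices D. cst (f \<iota>) * monomial (bump i \<iota>)) \<in> J"
    by (simp add: right_diff_distrib sum_distrib_left monomial_bump[OF i(1)] mult_ac)
  then show ?thesis
    unfolding i(2) by (rule W_via) (auto intro!: W_sum W_cst W_monomial bump_indices i)
qed

text \<open>Each firing costs only terms \<theta> times a product with fewer variables, which
  \<open>IH\<close> and \<open>W_\<theta>\<close> cover.\<close>

lemma chip_congruent:
  assumes IH: "\<And>N. size N \<le> D \<Longrightarrow> vprod N \<in> W D"
  shows "chip M M' \<Longrightarrow> size M \<le> Suc D \<Longrightarrow> zprod M - zprod M' \<in> W (Suc D)"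
proof (induction rule: chip.induct)
  case (fire j U)
  then have "zprod (add_mset i U) \<in> W D" for i
    unfolding zprod_vprod by (intro IH) simp
  then have w: "\<theta> i * zprod (add_mset i' U) \<in> W (Suc D)" for i i' by (rule W_\<theta>)
  have "(z (Suc j) * z (Suc j) - z j * z (Suc (Suc j)) + \<theta> j * z (Suc j) - \<theta> (Suc j) * z j) * zprod U \<in> W (Suc D)"
    by (intro W_J is_ideal_mult_right J_ideal fire_relation)
  from W_diff[OF W_add[OF this w[of "Suc j" j]] w[of j "Suc j"]]
  show ?case by (simp add: algebra_simps)
next
  case (wrap j U)
  then show ?case by (simp add: z_mod W_J is_ideal_zero[OF J_ideal])
next
  case (refl M)
  then show ?case by (simp add: W_J is_ideal_zero[OF J_ideal])
next
  case (sym M N)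
  then have "zprod M - zprod N \<in> W (Suc D)" using chip_size by simp
  from W_minus[OF this] show ?case by simp
next
  case (trans M N L)
  then have "zprod M - zprod N \<in> W (Suc D)" "zprod N - zprod L \<in> W (Suc D)"
    using chip_size[of M N] by auto
  from W_add[OF this] show ?case by simp
qed

definition zero_exp :: "nat \<Rightarrow> nat" where "zero_exp = restrict (\<lambda>_. 0) {..<6}"

lemma zprod_chips_W: "e \<in> normals D \<Longrightarrow> size (chips e) \<le> D \<Longrightarrow> zprod (chips e) \<in> W D"
proof -
  assume e: "e \<in> normals D" "size (chips e) \<le> D"
  then have "(zero_exp, e) \<in> indices D" by (auto simp: indices_def zero_exp_def)
  moreover have "monomial (zero_exp, e) = zprod (chips e)" by (simp add: zero_exp_def)
  ultimately show ?thesis using W_monomial by metis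
qed

lemma chips_normal: "\<exists>e\<in>normals (size M). chip M (chips e)"
proof (cases "size M \<le> 5")
  case True
  then obtain X where X: "X \<subseteq> {..<6}" "chip M (mset_set X)" using chip_squarefree by blast
  then have "card X \<le> 5" using chip_size[OF X(2)] True by simp
  with X show ?thesis by (intro bexI[of _ "Inl X"]) (auto simp: normals_def)
next
  case False
  then have M: "size M = (size M - 6) + 6" by simp
  obtain t where t: "t \<in> {1..6}" "chip M (crowd t 0 + replicate_mset (size M - 6) 0)"
    using chip_many[of M "size M - 6"] M by auto
  then show ?thesis by (intro bexI[of _ "Inr (size M - 6, t - 1)"]) (auto simp: normals_def)
qed

text \<open>Each a_j is replaced by z_(j+1) + \<theta>_j. The part with \<theta> is handled by
  induction on the degree, and once only z's remain chip firing brings them into normal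
  form.\<close>

lemma vprod_W: "size N \<le> D \<Longrightarrow> vprod N \<in> W D"
proof (induction D arbitrary: N)
  case 0
  then have "vprod N = zprod (chips (Inl {}))" by simp
  also have "\<dots> \<in> W 0" by (rule zprod_chips_W) (auto simp: normals_def)
  finally show ?case .
next
  case (Suc D)
  have zW: "zprod M \<in> W (Suc D)" if M: "size M \<le> Suc D" for M
  proof -
    obtain e where e: "e \<in> normals (size M)" "chip M (chips e)" using chips_normal by blast
    then have "zprod (chips e) \<in> W (size M)"
      using chip_size[OF e(2)] by (intro zprod_chips_W) auto
    then have "zprod (chips e) \<in> W (Suc D)" using W_mono M by blast
    from W_add[OF chip_congruent[OF Suc.IH e(2) M] this] show ?thesis by simp
  qed
  \<comment> \<open>\<open>M\<close> collects the variables already turned into chips.\<close>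
  have "vprod N * zprod M \<in> W (Suc D)" if "size N + size M \<le> Suc D" for M
    using that
  proof (induction N arbitrary: M)
    case empty
    then show ?case using zW by simp
  next
    case (add w N)
    obtain v s where w: "w = (v, s)" by (cases w)
    obtain j where v: "v = c j" using c_surj by blast
    show ?case
    proof (cases s)
      case True
      have "pvar w = z (Suc j) + \<theta> j"
        using True by (simp add: w v z_def \<theta>_def avar_def)
      then have "vprod (add_mset w N) * zprod M = vprod N * zprod (add_mset (Suc j) M) + \<theta> j * (vprod N * zprod M)"
        by (simp add: algebra_simps)
      moreover have "vprod N * zprod M \<in> W D"
        using Suc.IH[of "N + image_mset (\<lambda>j. (c j, False)) M"] add.prems by (simp add: zprod_vprod)
      then have "\<theta> j * (vprod N * zprod M) \<in> W (Suc D)" by (rule W_\<theta>)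
      moreover have "vprod N * zprod (add_mset (Suc j) M) \<in> W (Suc D)"
        using add.prems by (intro add.IH) simp
      ultimately show ?thesis by (simp only: W_add)
    next
      case False
      then have "vprod (add_mset w N) * zprod M = vprod N * zprod (add_mset j M)"
        by (simp add: w v z_def bvar_def mult_ac)
      also have "\<dots> \<in> W (Suc D)" using add.prems by (intro add.IH) simp
      finally show ?thesis .
    qed
  qed
  from this[of "{#}"] show ?case using Suc.prems by simp
qed

lemma mono_W: "mdeg m \<le> D \<Longrightarrow> mon m \<in> W D"
proof -
  have "\<exists>N. size N = mdeg m \<and> vprod N = mon m" for m
  proof (induction "mdeg m" arbitrary: m)
    case 0
    then have "m = 0" by (metis mdeg_def sum_eq_0_iff finite_keys in_keys_iff poly_mapping_eqI lookup_zero)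
    then show ?case by (intro exI[of _ "{#}"]) simp
  next
    case (Suc n)
    then have "m \<noteq> 0" by auto
    then obtain w where w: "lookup m w \<noteq> 0" by (metis poly_mapping_eqI lookup_zero)
    define m' where "m' = m - Poly_Mapping.single w 1"
    have m: "m = Poly_Mapping.single w 1 + m'"
      using w by (intro poly_mapping_eqI) (auto simp: m'_def lookup_add lookup_minus lookup_single when_def)
    then have "mdeg m = Suc (mdeg m')" by (simp add: mdeg_add)
    then obtain N where N: "size N = mdeg m'" "vprod N = mon m'" using Suc by (metis nat.inject)
    have "vprod (add_mset w N) = mon m" using N unfolding m by (simp add: pvar_def mult_single)
    then show ?case using N \<open>mdeg m = Suc (mdeg m')\<close> by (metis size_add_mset)
  qed
  then show "mdeg m \<le> D \<Longrightarrow> mon m \<in> W D" using vprod_W by metis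
qed

lemma c_bij: "bij_betw c {..<6} UNIV"
  using c_inj c_surj by (fastforce simp: bij_betw_def inj_on_def image_iff)

lemma sum_vertices: "(\<Sum>v\<in>UNIV. f v) = (\<Sum>j<6. f (c j))"
  using sum.reindex_bij_betw[OF c_bij, of f] by simp

section \<open>Matching normal forms with monomials of distinct labels\<close>

definition expo :: "(nat \<Rightarrow> nat) \<Rightarrow> (nat \<Rightarrow> nat) \<Rightarrow> 'v \<times> bool \<Rightarrow>\<^sub>0 nat" where
  "expo A B = (\<Sum>j<6. Poly_Mapping.single (c j, True) (A j) + Poly_Mapping.single (c j, False) (B j))"

lemma lookup_expo:
  assumes "j < 6"
  shows "lookup (expo A B) (c j, True) = A j" "lookup (expo A B) (c j, False) = B j"
proof -
  have "c i = c j \<longleftrightarrow> i = j" if "i < 6" for i using c_inj that assms by blast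
  then have "lookup (expo A B) (c j, True) = (\<Sum>i<6. if i = j then A i else 0)"
    "lookup (expo A B) (c j, False) = (\<Sum>i<6. if i = j then B i else 0)"
    unfolding expo_def lookup_sum lookup_add lookup_single
    by (auto intro!: sum.cong simp: when_def)
  then show "lookup (expo A B) (c j, True) = A j" "lookup (expo A B) (c j, False) = B j"
    using assms by simp_all
qed

lemma mdeg_expo: "mdeg (expo A B) = (\<Sum>j<6. A j + B j)"
proof -
  have "mdeg (sum f S) = (\<Sum>i\<in>S. mdeg (f i))" for f :: "nat \<Rightarrow> 'v \<times> bool \<Rightarrow>\<^sub>0 nat" and S
    by (induction S rule: infinite_finite_induct) (simp_all add: mdeg_add)
  then show ?thesis by (simp add: expo_def mdeg_add)
qed

text \<open>In the \<open>Inr\<close> case the support is full, and a label records only vertex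
  degrees and the total b-degree. Vertices below \<open>r\<close> carry only b's and vertex
  \<open>r\<close> holds the last \<open>i\<close> of them, which realises every b-degree below the
  total degree. The top value, b's only, is taken by \<open>Inl {}\<close> with all exponents
  positive.\<close>

fun exp_a :: "index \<Rightarrow> nat \<Rightarrow> nat" where
  "exp_a (\<alpha>, Inl X) j = (if X = {} \<and> (\<forall>j<6. 0 < \<alpha> j) \<or> Suc j mod 6 \<in> X then 0 else \<alpha> (Suc j mod 6))"
| "exp_a (\<alpha>, Inr (i, r)) j = (if j < r then 0 else Suc (\<alpha> j))"

fun exp_b :: "index \<Rightarrow> nat \<Rightarrow> nat" where
  "exp_b (\<alpha>, Inl X) j = (if X = {} \<and> (\<forall>j<6. 0 < \<alpha> j) then \<alpha> j else if j \<in> X then Suc (\<alpha> j) else 0)"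
| "exp_b (\<alpha>, Inr (i, r)) j = (if j < r then Suc (\<alpha> j) else if j = r then i else 0)"

text \<open>A monomial of the same degree as \<open>monomial \<iota>\<close>, matched with \<open>\<iota>\<close> for counting purposes only. For \<open>Inl X\<close>,
  \<open>\<alpha>\<^sub>j\<close> goes to \<open>b\<^sub>j\<close> if \<open>j \<in> X\<close> and to \<open>a\<^bsub>j-1\<^esub>\<close> otherwise, so that \<open>a\<^sub>j b\<^bsub>j+1\<^esub>\<close> never divides the result,
  except when this would give a monomial with full support.\<close>

definition partner :: "index \<Rightarrow> 'v \<times> bool \<Rightarrow>\<^sub>0 nat" where
  "partner \<iota> = expo (exp_a \<iota>) (exp_b \<iota>)"

lemma Suc_mod_6_cancel: "Suc i mod 6 = Suc j mod 6 \<Longrightarrow> i mod 6 = j mod 6" for i j :: nat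
  by (simp add: mod_Suc split: if_splits)

lemma mod_6_pred: "i < 6 \<Longrightarrow> Suc ((i + 5) mod 6) mod 6 = i" for i :: nat
  by (simp add: mod_Suc_eq)

lemma sum_rotate_6: "(\<Sum>j<6. f (Suc j mod 6)) = (\<Sum>j<6. f j :: nat)"
proof -
  have "{..<6::nat} = {0, 1, 2, 3, 4, 5}" by auto
  then show ?thesis by (simp add: numeral_2_eq_2[symmetric])
qed

lemma mdeg_partner:
  assumes "\<iota> \<in> indices D" shows "mdeg (partner \<iota>) \<le> D"
proof -
  obtain \<alpha> e where \<iota>: "\<iota> = (\<alpha>, e)" by (cases \<iota>)
  have le: "(\<Sum>j<6. \<alpha> j) + size (chips e) \<le> D" and e: "e \<in> normals D"
    using assms by (auto simp: \<iota> indices_def)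
  have "mdeg (partner \<iota>) = (\<Sum>j<6. \<alpha> j) + size (chips e)"
  proof (cases e)
    case (Inl X)
    then have X: "X \<subseteq> {..<6}" using e by (auto simp: normals_def)
    show ?thesis
    proof (cases "X = {} \<and> (\<forall>j<6. 0 < \<alpha> j)")
      case True
      then show ?thesis by (simp add: partner_def mdeg_expo \<iota> Inl cong: sum.cong)
    next
      case False
      have "(\<Sum>j<6. exp_a \<iota> j) = (\<Sum>j<6. if Suc j mod 6 \<in> X then 0 else \<alpha> (Suc j mod 6))"
        using False by (intro sum.cong) (auto simp: \<iota> Inl)
      also have "\<dots> = (\<Sum>j<6. if j \<in> X then 0 else \<alpha> j)" by (rule sum_rotate_6)
      finally have "(\<Sum>j<6. exp_a \<iota> j) = (\<Sum>j<6. if j \<in> X then 0 else \<alpha> j)" .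
      then have "mdeg (partner \<iota>) = (\<Sum>j<6. (if j \<in> X then 0 else \<alpha> j) + exp_b \<iota> j)"
        by (simp add: partner_def mdeg_expo sum.distrib)
      also have "\<dots> = (\<Sum>j<6. \<alpha> j + (if j \<in> X then 1 else 0))"
        using False by (intro sum.cong) (auto simp: \<iota> Inl)
      also have "\<dots> = (\<Sum>j<6. \<alpha> j) + card X"
        using X by (simp add: sum.distrib sum.If_cases Int_absorb1)
      finally show ?thesis by (simp add: Inl)
    qed
  next
    case (Inr p)
    obtain i r where p: "p = (i, r)" by (cases p)
    have r: "r < 6" using e by (auto simp: normals_def Inr p)
    have "mdeg (partner \<iota>) = (\<Sum>j<6. Suc (\<alpha> j) + (if j = r then i else 0))"
      unfolding partner_def mdeg_expo by (intro sum.cong) (auto simp: \<iota> Inr p)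
    then show ?thesis using r by (simp add: sum.distrib Inr p crowd_def sum_Suc)
  qed
  with le show ?thesis by simp
qed

text \<open>Two monomials without \<open>a\<^sub>j b\<^bsub>j+1\<^esub>\<close> and with equal labels agree: on the arc between two consecutive
  vertices outside the support, all \<open>b\<close>'s come before all \<open>a\<close>'s.\<close>

lemma sorted_arc_contradiction:
  assumes vd: "vdeg m = vdeg m'"
    and lab: "\<And>Z. separated E m Z \<Longrightarrow> (\<Sum>v\<in>Z. lookup m (v, False)) = (\<Sum>v\<in>Z. lookup m' (v, False))"
    and cross: "\<And>j. lookup m (c j, True) = 0 \<or> lookup m (c (Suc j), False) = 0"
    and t: "vdeg m (c t) = 0"
    and before: "\<And>q. q < n \<Longrightarrow> lookup m (c (t + q), False) = lookup m' (c (t + q), False)"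
    and lt: "lookup m (c (t + n), False) < lookup m' (c (t + n), False)" and n: "0 < n" "n < 6"
  shows False
proof -
  have ex: "n < 6 \<and> vdeg m (c (t + 6)) = 0" using n t by (simp add: periodic)
  \<comment> \<open>The arc ends at the next vertex outside the support after position
    \<open>n\<close>, at the latest at \<open>t\<close> itself after a full turn.\<close>
  define e where "e = (LEAST e. n < e \<and> vdeg m (c (t + e)) = 0)"
  have e: "n < e" "vdeg m (c (t + e)) = 0" and e6: "e \<le> 6"
    unfolding e_def using LeastI[of "\<lambda>e. n < e \<and> vdeg m (c (t + e)) = 0", OF ex]
      Least_le[of "\<lambda>e. n < e \<and> vdeg m (c (t + e)) = 0", OF ex] by auto
  have pos: "vdeg m (c (t + q)) > 0" if "n < q" "q < e" for q
    using that not_less_Least[of q "\<lambda>e. n < e \<and> vdeg m (c (t + e)) = 0"] unfolding e_def by auto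
  \<comment> \<open>The vertices strictly between the two ends; the ends have degree 0, so the set
    is separated and its b-degree is recorded by the label.\<close>
  define Z where "Z = (\<lambda>q. c (t + q)) ` {1..<e}"
  have inj: "inj_on (\<lambda>q. c (t + q)) {1..<e}"
  proof (rule inj_onI)
    fix p q assume pq: "p \<in> {1..<e}" "q \<in> {1..<e}" "c (t + p) = c (t + q)"
    then have "(t + p) mod 6 = (t + q) mod 6" by (simp add: c_eq_iff)
    moreover have "t + p \<in> {t + 1..t + 6}" "t + q \<in> {t + 1..t + 6}" using pq e6 by auto
    ultimately show "p = q" using inj_on_mod6[of "t + 6" t] by (auto dest: inj_onD)
  qed
  have "separated E m Z"
    unfolding separated_def
  proof (intro allI impI)
    fix u v assume uv: "E u v" "u \<in> Z" "v \<notin> Z"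
    obtain q where q: "1 \<le> q" "q < e" "u = c (t + q)" using uv(2) by (auto simp: Z_def)
    have "v = c (Suc (t + q)) \<or> v = c (t + q - 1)"
    proof -
      from uv(1) obtain j where "u = c j \<and> v = c (Suc j) \<or> u = c (Suc j) \<and> v = c j"
        unfolding E_iff by blast
      then show ?thesis
      proof
        assume j: "u = c j \<and> v = c (Suc j)"
        then have "j mod 6 = (t + q) mod 6" using q c_eq_iff by metis
        then have "c (Suc j) = c (Suc (t + q))" unfolding c_eq_iff by (metis mod_Suc_eq)
        then show ?thesis using j by simp
      next
        assume j: "u = c (Suc j) \<and> v = c j"
        then have "Suc j mod 6 = Suc (t + q - 1) mod 6" using q c_eq_iff by simp
        then have "j mod 6 = (t + q - 1) mod 6" by (rule Suc_mod_6_cancel)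
        then show ?thesis using j c_eq_iff by metis
      qed
    qed
    then show "vdeg m u = 0 \<or> vdeg m v = 0"
    proof
      assume v: "v = c (Suc (t + q))"
      have "Suc q = e"
      proof (rule ccontr)
        assume "Suc q \<noteq> e"
        then have "Suc q \<in> {1..<e}" "v = c (t + Suc q)" using q v by auto
        then show False using uv(3) unfolding Z_def by blast
      qed
      then show ?thesis using v e by auto
    next
      assume v: "v = c (t + q - 1)"
      have "q = 1"
      proof (rule ccontr)
        assume "q \<noteq> 1"
        then have "q - 1 \<in> {1..<e}" "v = c (t + (q - 1))" using q v by auto
        then show False using uv(3) unfolding Z_def by blast
      qed
      then show ?thesis using v t by auto
    qed
  qed
  from lab[OF this]
  have eq: "(\<Sum>q\<in>{1..<e}. lookup m (c (t + q), False)) = (\<Sum>q\<in>{1..<e}. lookup m' (c (t + q), False))"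
    unfolding Z_def sum.reindex[OF inj] comp_def .
  \<comment> \<open>Having fewer b's than \<open>m'\<close> at \<open>n\<close>, \<open>m\<close>
    has an \<open>a\<close> there. By \<open>cross\<close> the next vertex has no \<open>b\<close>;
    lying in the support, it has an \<open>a\<close> again, and so on up to the end of the
    arc.\<close>
  have "q < e \<longrightarrow> lookup m (c (t + q), True) > 0 \<and> (n < q \<longrightarrow> lookup m (c (t + q), False) = 0)" if "n \<le> q" for q
    using that
  proof (induction q rule: dec_induct)
    case base
    have "lookup m' (c (t + n), False) \<le> vdeg m (c (t + n))" unfolding vd by (simp add: vdeg_def)
    then show ?case using lt by (simp add: vdeg_def)
  next
    case (step q)
    show ?case
    proof (intro impI)
      assume q: "Suc q < e"
      then have "lookup m (c (t + Suc q), False) = 0" using step cross[of "t + q"] by auto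
      then show "lookup m (c (t + Suc q), True) > 0 \<and> (n < Suc q \<longrightarrow> lookup m (c (t + Suc q), False) = 0)"
        using pos[of "Suc q"] q step by (auto simp: vdeg_def)
    qed
  qed
  then have after: "lookup m (c (t + q), False) = 0" if "n < q" "q < e" for q
    using that by (meson less_imp_le)
  have "(\<Sum>q\<in>{1..<e}. lookup m (c (t + q), False)) < (\<Sum>q\<in>{1..<e}. lookup m' (c (t + q), False))"
  proof (rule sum_strict_mono_ex1)
    show "\<forall>q\<in>{1..<e}. lookup m (c (t + q), False) \<le> lookup m' (c (t + q), False)"
    proof
      fix q assume "q \<in> {1..<e}"
      then show "lookup m (c (t + q), False) \<le> lookup m' (c (t + q), False)"
        using before[of q] after[of q] lt by (cases q n rule: linorder_cases) auto
    qed
    show "\<exists>q\<in>{1..<e}. lookup m (c (t + q), False) < lookup m' (c (t + q), False)"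
      using lt n e by (intro bexI[of _ n]) auto
  qed simp
  with eq show False by simp
qed

lemma label_eqD:
  assumes "label E m = label E m'"
  shows "vdeg m = vdeg m'"
    and "separated E m Z \<Longrightarrow> (\<Sum>v\<in>Z. lookup m (v, False)) = (\<Sum>v\<in>Z. lookup m' (v, False))"
proof -
  show vd: "vdeg m = vdeg m'" using assms by (simp add: label_def)
  have "snd (label E m) Z = snd (label E m') Z" by (simp only: assms)
  then show "separated E m Z \<Longrightarrow> (\<Sum>v\<in>Z. lookup m (v, False)) = (\<Sum>v\<in>Z. lookup m' (v, False))"
    by (simp add: label_def separated_def vd)
qed

text \<open>Walking around from \<open>t\<close>, the first vertex at which the b-exponents differ
  is excluded by the arc argument, applied to whichever monomial has fewer b's there.\<close>

lemma sorted_monomial_unique: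
  assumes lab: "label E m = label E m'"
    and cross: "\<And>j. lookup m (c j, True) = 0 \<or> lookup m (c (Suc j), False) = 0"
    and cross': "\<And>j. lookup m' (c j, True) = 0 \<or> lookup m' (c (Suc j), False) = 0"
    and t: "vdeg m (c t) = 0"
  shows "m = m'"
proof -
  note vd = label_eqD(1)[OF lab]
  have t': "vdeg m' (c t) = 0" using t vd by simp
  have b: "n < 6 \<Longrightarrow> lookup m (c (t + n), False) = lookup m' (c (t + n), False)" for n
  proof (induction n rule: less_induct)
    case (less n)
    show ?case
    proof (cases "n = 0")
      case True
      then show ?thesis using t t' by (simp add: vdeg_def)
    next
      case False
      have before: "lookup m (c (t + q), False) = lookup m' (c (t + q), False)" if "q < n" for q
        using less that by simp
      show ?thesis
      proof (rule ccontr)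
        assume "\<not> ?thesis"
        then consider "lookup m (c (t + n), False) < lookup m' (c (t + n), False)"
          | "lookup m' (c (t + n), False) < lookup m (c (t + n), False)" by linarith
        then show False
        proof cases
          case 1
          then show ?thesis
            using sorted_arc_contradiction[OF vd label_eqD(2)[OF lab] cross t before] False less.prems by blast
        next
          case 2
          then show ?thesis
            using sorted_arc_contradiction[OF vd[symmetric] label_eqD(2)[OF lab[symmetric]] cross' t' before[symmetric]] False less.prems by blast
        qed
      qed
    qed
  qed
  have "lookup m (v, s) = lookup m' (v, s)" for v s
  proof -
    obtain i where i: "i < 6" "v = c i" using c_surj by blast
    define n where "n = (i + (6 - t mod 6)) mod 6"
    have "t mod 6 < 6" by simp
    then have "t + (i + (6 - t mod 6)) = i + (t div 6 + 1) * 6"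
      using div_mult_mod_eq[of t 6] by (simp only: distrib_right)
    then have "(t + (i + (6 - t mod 6))) mod 6 = i" using i(1) by (simp only: mod_mult_self1 mod_less)
    then have "(t + n) mod 6 = i" unfolding n_def by (simp only: mod_add_right_eq)
    then have "c (t + n) = v" using i c_eq_iff[of "t + n" i] by simp
    then have B: "lookup m (v, False) = lookup m' (v, False)" using b[of n] by (simp add: n_def)
    moreover have "vdeg m v = vdeg m' v" by (simp only: vd)
    ultimately show ?thesis by (cases s) (simp_all add: vdeg_def)
  qed
  then show ?thesis by (intro poly_mapping_eqI) auto
qed

lemma vdeg_partner: "j < 6 \<Longrightarrow> vdeg (partner \<iota>) (c j) = exp_a \<iota> j + exp_b \<iota> j"
  by (simp add: vdeg_def partner_def lookup_expo)

lemma partner_cross: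
  assumes "X \<noteq> {} \<or> (\<exists>j<6. \<alpha> j = 0)"
  shows "lookup (partner (\<alpha>, Inl X)) (c j, True) = 0 \<or> lookup (partner (\<alpha>, Inl X)) (c (Suc j), False) = 0"
proof -
  have cross: "exp_a (\<alpha>, Inl X) i = 0 \<or> exp_b (\<alpha>, Inl X) (Suc i mod 6) = 0" for i
    using assms by auto
  have "c (Suc j) = c (Suc (j mod 6) mod 6)" by (simp add: c_eq_iff mod_Suc_eq)
  moreover have "c j = c (j mod 6)" by (simp add: c_mod)
  ultimately show ?thesis
    using cross[of "j mod 6"] by (simp add: partner_def lookup_expo del: exp_a.simps exp_b.simps)
qed

text \<open>A vertex outside \<open>X\<close> with its successor in \<open>X\<close> receives
  neither a nor b; it exists when \<open>X\<close> is neither empty nor everything. For empty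
  \<open>X\<close>, an exponent 0 frees the vertex before it.\<close>

lemma partner_cross_gap:
  assumes nf: "X \<noteq> {} \<or> (\<exists>j<6. \<alpha> j = 0)" and X: "X \<subseteq> {..<6}" "card X \<le> 5"
  shows "\<exists>j<6. vdeg (partner (\<alpha>, Inl X)) (c j) = 0"
proof (cases "X = {}")
  case True
  then obtain i where i: "i < 6" "\<alpha> i = 0" using nf by auto
  define j where "j = (i + 5) mod 6"
  have "Suc j mod 6 = i" "j < 6" unfolding j_def using i mod_6_pred by simp_all
  then show ?thesis using i True by (intro exI[of _ j]) (auto simp: vdeg_partner)
next
  case False
  have "X \<noteq> {..<6}" using X(2) by auto
  have "\<exists>j<6. j \<notin> X \<and> Suc j mod 6 \<in> X"
  proof (rule ccontr)
    assume "\<not> ?thesis"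
    then have step: "Suc j mod 6 \<notin> X" if "j < 6" "j \<notin> X" for j using that by blast
    obtain i where i: "i < 6" "i \<notin> X" using X(1) \<open>X \<noteq> {..<6}\<close> by auto
    have "(i + n) mod 6 \<notin> X" for n
    proof (induction n)
      case (Suc n)
      then have "Suc ((i + n) mod 6) mod 6 \<notin> X" by (intro step) auto
      then show ?case by (simp add: mod_Suc_eq)
    qed (use i in simp)
    then have "j \<notin> X" if "j < 6" for j
    proof -
      have "(i + (6 - i + j)) mod 6 = j" using i that by simp
      then show ?thesis using \<open>\<And>n. (i + n) mod 6 \<notin> X\<close> by metis
    qed
    then show False using False X(1) by auto
  qed
  then show ?thesis using False by (auto simp: vdeg_partner)
qed

lemma sum_exp_b_Inr:
  assumes "r < 6"
  shows "(\<Sum>j<6. exp_b (\<alpha>, Inr (i, r)) j) = (\<Sum>j<r. vdeg (partner (\<alpha>, Inr (i, r))) (c j)) + i"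
proof -
  have "(\<Sum>j<6. exp_b (\<alpha>, Inr (i, r)) j) = (\<Sum>j<Suc r. exp_b (\<alpha>, Inr (i, r)) j)"
    using assms by (intro sum.mono_neutral_right) auto
  also have "\<dots> = (\<Sum>j<r. vdeg (partner (\<alpha>, Inr (i, r))) (c j)) + i"
    using assms by (simp add: vdeg_partner)
  finally show ?thesis .
qed

lemma label_partner_sum:
  assumes "label E (partner \<iota>) = label E (partner \<kappa>)"
  shows "(\<Sum>j<6. exp_b \<iota> j) = (\<Sum>j<6. exp_b \<kappa> j)"
proof -
  have "(\<Sum>v\<in>UNIV. lookup (partner \<iota>) (v, False)) = (\<Sum>v\<in>UNIV. lookup (partner \<kappa>) (v, False))"
    by (rule label_eqD(2)[OF assms]) (simp add: separated_def)
  then show ?thesis unfolding sum_vertices by (simp add: partner_def lookup_expo)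
qed

text \<open>The total b-degree is at least the sum of the vertex degrees below \<open>r\<close> and
  less than that sum with vertex \<open>r\<close> included; for different \<open>r\<close> these
  ranges are disjoint.\<close>

lemma partner_Inr_le:
  assumes lab: "label E (partner (\<alpha>, Inr (i, r))) = label E (partner (\<beta>, Inr (i', r')))" and r: "r < 6" "r' < 6"
  shows "r' \<le> r"
proof (rule ccontr)
  assume "\<not> r' \<le> r"
  then have rr: "r < r'" by simp
  define m where "m j = vdeg (partner (\<alpha>, Inr (i, r))) (c j)" for j
  have m': "vdeg (partner (\<beta>, Inr (i', r'))) (c j) = m j" for j
    using label_eqD(1)[OF lab] by (simp add: m_def)
  have "i < m r" using r by (simp add: m_def vdeg_partner)
  moreover have "(\<Sum>j<r. m j) + m r \<le> (\<Sum>j<r'. m j)"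
    using sum_mono2[of "{..<r'}" "{..<Suc r}" m] rr by simp
  moreover have "(\<Sum>j<r. m j) + i = (\<Sum>j<r'. m j) + i'"
    using label_partner_sum[OF lab] sum_exp_b_Inr[OF r(1), of \<alpha> i] sum_exp_b_Inr[OF r(2), of \<beta> i']
    unfolding m' m_def[symmetric] by simp
  ultimately show False by simp
qed

text \<open>The label shows whether the support is full. If not, it determines the partner monomial,
  from which the index is read off; if so, vertex degrees and total b-degree determine the
  index.\<close>

lemma inj_label_partner: "inj_on (\<lambda>\<iota>. label E (partner \<iota>)) (indices D)"
proof (rule inj_onI)
  fix \<iota> \<kappa> assume \<iota>\<kappa>: "\<iota> \<in> indices D" "\<kappa> \<in> indices D" and lab: "label E (partner \<iota>) = label E (partner \<kappa>)"
  obtain \<alpha> e \<beta> f where \<iota>: "\<iota> = (\<alpha>, e)" and \<kappa>: "\<kappa> = (\<beta>, f)" by (cases \<iota>; cases \<kappa>)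
  have ext: "\<alpha> \<in> extensional {..<6}" "\<beta> \<in> extensional {..<6}"
    and e: "e \<in> normals D" "f \<in> normals D"
    using \<iota>\<kappa> by (auto simp: \<iota> \<kappa> indices_def PiE_iff)
  have \<alpha>\<beta>: "\<alpha> = \<beta>" if "\<And>j. j < 6 \<Longrightarrow> \<alpha> j = \<beta> j" using ext that by (intro extensionalityI) auto
  have vd: "vdeg (partner (\<alpha>, e)) (c j) = vdeg (partner (\<beta>, f)) (c j)" for j
    using label_eqD(1)[OF lab] by (simp add: \<iota> \<kappa>)
  define crossing where "crossing \<alpha> X \<longleftrightarrow> X \<noteq> {} \<or> (\<exists>j<6. \<alpha> j = 0)" for \<alpha> :: "nat \<Rightarrow> nat" and X :: "nat set"
  have full: "vdeg (partner (\<alpha>, e)) (c j) > 0"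
    if "e \<in> normals D" "\<And>X. e = Inl X \<Longrightarrow> \<not> crossing \<alpha> X" "j < 6" for \<alpha> e j
    using that by (cases e) (auto simp: vdeg_partner crossing_def)
  have gap: "\<exists>j<6. vdeg (partner (\<alpha>, Inl X)) (c j) = 0" if "Inl X \<in> normals D" "crossing \<alpha> X" for \<alpha> X
    using that by (intro partner_cross_gap) (auto simp: crossing_def normals_def)
  show "\<iota> = \<kappa>"
  proof (cases "\<exists>X. e = Inl X \<and> crossing \<alpha> X")
    case True
    then obtain X where X: "e = Inl X" "crossing \<alpha> X" by auto
    obtain j where j: "j < 6" "vdeg (partner (\<alpha>, Inl X)) (c j) = 0" using gap X e by auto
    obtain Y where Y: "f = Inl Y" "crossing \<beta> Y"
      using full[OF e(2), of \<beta> j] vd[of j] j X by auto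
    have "partner (\<alpha>, Inl X) = partner (\<beta>, Inl Y)"
      using lab j(2) X Y partner_cross[of X \<alpha>] partner_cross[of Y \<beta>] unfolding \<iota> \<kappa> crossing_def
      by (intro sorted_monomial_unique[of _ _ j]) auto
    then have a: "exp_a (\<alpha>, Inl X) j = exp_a (\<beta>, Inl Y) j" and b: "exp_b (\<alpha>, Inl X) j = exp_b (\<beta>, Inl Y) j"
      if "j < 6" for j
      using lookup_expo[OF that] unfolding partner_def by metis+
    have XY: "X \<subseteq> {..<6}" "Y \<subseteq> {..<6}" using e by (auto simp: X Y normals_def)
    have nX: "\<not> (X = {} \<and> (\<forall>j<6. 0 < \<alpha> j))" and nY: "\<not> (Y = {} \<and> (\<forall>j<6. 0 < \<beta> j))"
      using X Y by (auto simp: crossing_def)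
    have "j \<in> X \<longleftrightarrow> j \<in> Y" if "j < 6" for j
      using b[OF that] nX nY by (auto split: if_splits)
    then have "X = Y" using XY by blast
    moreover have "\<alpha> = \<beta>"
    proof (rule \<alpha>\<beta>)
      fix j :: nat assume j: "j < 6"
      \<comment> \<open>For \<open>j\<close> outside \<open>X\<close> the exponent of \<theta>_j
        sits on the \<open>a\<close> of the preceding vertex.\<close>
      define i where "i = (j + 5) mod 6"
      have i: "Suc i mod 6 = j" "i < 6" unfolding i_def using j mod_6_pred by simp_all
      show "\<alpha> j = \<beta> j"
        using a[OF i(2)] b[OF j] nX nY \<open>X = Y\<close> i(1) by (cases "j \<in> X") (auto split: if_splits)
    qed
    ultimately show ?thesis by (simp add: \<iota> \<kappa> X Y)
  next
    case False
    then have fe: "vdeg (partner (\<alpha>, e)) (c j) > 0" if "j < 6" for j using full[OF e(1), of \<alpha> j] that by blast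
    have nf: "\<not> crossing \<beta> Y" if "f = Inl Y" for Y
      using gap[of Y \<beta>] e(2) that vd fe by (metis less_irrefl)
    have bl: "(\<Sum>j<6. exp_b (\<alpha>, e) j) = (\<Sum>j<6. exp_b (\<beta>, f) j)"
      using label_partner_sum[OF lab] by (simp only: \<iota> \<kappa>)
    \<comment> \<open>This separates the two kinds of full support: for \<open>Inl {}\<close> the
      b-degree equals the total degree.\<close>
    have less: "(\<Sum>j<6. exp_b (\<alpha>, Inr p) j) < (\<Sum>j<6. vdeg (partner (\<alpha>, Inr p)) (c j))"
      if "Inr p \<in> normals D" for \<alpha> p
    proof (rule sum_strict_mono_ex1)
      obtain i r where "p = (i, r)" "r < 6" using \<open>Inr p \<in> normals D\<close> by (auto simp: normals_def)
      then show "\<exists>j\<in>{..<6}. exp_b (\<alpha>, Inr p) j < vdeg (partner (\<alpha>, Inr p)) (c j)"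
        by (intro bexI[of _ r]) (auto simp: vdeg_partner)
    qed (auto simp: vdeg_partner)
    have eq: "exp_b (\<alpha>, Inl X) j = \<alpha> j" "vdeg (partner (\<alpha>, Inl X)) (c j) = \<alpha> j" "X = {}"
      if "\<not> crossing \<alpha> X" "j < 6" for \<alpha> X j
      using that by (auto simp: crossing_def vdeg_partner)
    show ?thesis
    proof (cases e)
      case (Inl X)
      then have X: "\<not> crossing \<alpha> X" using False by auto
      show ?thesis
      proof (cases f)
        fix Y assume f: "f = Inl Y"
        then have "\<alpha> j = \<beta> j" if "j < 6" for j
          using eq(2)[OF X that] eq(2)[OF nf[OF f] that] vd[of j] Inl by simp
        then show ?thesis using \<alpha>\<beta> eq(3)[OF X, of 0] eq(3)[OF nf[OF f], of 0] by (simp add: \<iota> \<kappa> Inl f)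
      next
        fix p assume f: "f = Inr p"
        have "(\<Sum>j<6. exp_b (\<alpha>, e) j) = (\<Sum>j<6. vdeg (partner (\<beta>, f)) (c j))"
          unfolding vd[symmetric] Inl using eq(1,2)[OF X] by (intro sum.cong) (auto simp del: exp_b.simps)
        then show ?thesis using less[of p \<beta>] e(2) bl by (simp add: f del: exp_b.simps)
      qed
    next
      case (Inr p)
      show ?thesis
      proof (cases f)
        fix Y assume f: "f = Inl Y"
        have "(\<Sum>j<6. exp_b (\<beta>, f) j) = (\<Sum>j<6. vdeg (partner (\<alpha>, e)) (c j))"
          unfolding vd f using eq(1,2)[OF nf[OF f]] by (intro sum.cong) (auto simp del: exp_b.simps)
        then show ?thesis using less[of p \<alpha>] e(1) bl by (simp add: Inr del: exp_b.simps)
      next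
        fix p' assume f: "f = Inr p'"
        obtain i r i' r' where p: "p = (i, r)" "p' = (i', r')" by (cases p; cases p')
        have r: "r < 6" "r' < 6" using e by (auto simp: normals_def Inr f p)
        have "r = r'"
          using partner_Inr_le[of \<alpha> i r \<beta> i' r'] partner_Inr_le[of \<beta> i' r' \<alpha> i r] lab r
          by (auto simp: \<iota> \<kappa> Inr f p)
        moreover have "i = i'"
          using bl vd sum_exp_b_Inr[OF r(1), of \<alpha> i] sum_exp_b_Inr[OF r(2), of \<beta> i'] \<open>r = r'\<close>
          by (simp add: Inr f p del: exp_b.simps)
        moreover have "\<alpha> = \<beta>"
        proof (rule \<alpha>\<beta>)
          fix j :: nat assume "j < 6"
          then show "\<alpha> j = \<beta> j"
            using vd[of j] \<open>r = r'\<close> \<open>i = i'\<close> by (auto simp: Inr f p vdeg_partner split: if_splits)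
        qed
        ultimately show ?thesis by (simp add: \<iota> \<kappa> Inr f p)
      qed
    qed
  qed
qed

text \<open>A relation would make one normal form redundant, and the remaining ones would be too few
  to span the partner monomials, which are independent modulo J and as numerous as the
  indices.\<close>

lemma monomials_independent:
  assumes f: "(\<Sum>\<iota>\<in>indices D. cst (f \<iota>) * monomial \<iota>) \<in> J" and \<iota>: "\<iota> \<in> indices D"
  shows "f \<iota> = 0"
proof (rule ccontr)
  assume f0: "f \<iota> \<noteq> 0"
  let ?B = "indices D - {\<iota>}"
  have "card ?B < card (indices D)"
    using \<iota> finite_indices by (intro psubset_card_mono) auto
  moreover have "\<exists>h. mon (partner \<kappa>) - (\<Sum>\<eta>\<in>?B. cst (h \<eta>) * monomial \<eta>) \<in> J" if \<kappa>: "\<kappa> \<in> indices D" for \<kappa>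
  proof -
    have "mon (partner \<kappa>) \<in> W D" by (rule mono_W[OF mdeg_partner[OF \<kappa>]])
    then obtain g where g: "mon (partner \<kappa>) - (\<Sum>\<eta>\<in>indices D. cst (g \<eta>) * monomial \<eta>) \<in> J"
      by (rule W_expand)
    \<comment> \<open>Subtracting this multiple of the relation removes \<open>\<iota>\<close> from
      the expansion.\<close>
    define a where "a = g \<iota> / f \<iota>"
    have "(\<Sum>\<eta>\<in>indices D. cst (g \<eta> - a * f \<eta>) * monomial \<eta>) = (\<Sum>\<eta>\<in>?B. cst (g \<eta> - a * f \<eta>) * monomial \<eta>)"
      using f0 \<iota> finite_indices by (simp add: sum.remove[of _ \<iota>] a_def)
    moreover have "(\<Sum>\<eta>\<in>indices D. cst (g \<eta> - a * f \<eta>) * monomial \<eta>)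
        = (\<Sum>\<eta>\<in>indices D. cst (g \<eta>) * monomial \<eta>) - cst a * (\<Sum>\<eta>\<in>indices D. cst (f \<eta>) * monomial \<eta>)"
      by (simp add: cst_diff cst_mult left_diff_distrib sum_subtractf sum_distrib_left mult.assoc)
    ultimately have eq: "(\<Sum>\<eta>\<in>?B. cst (g \<eta> - a * f \<eta>) * monomial \<eta>)
        = (\<Sum>\<eta>\<in>indices D. cst (g \<eta>) * monomial \<eta>) - cst a * (\<Sum>\<eta>\<in>indices D. cst (f \<eta>) * monomial \<eta>)"
      by metis
    have "mon (partner \<kappa>) - (\<Sum>\<eta>\<in>?B. cst (g \<eta> - a * f \<eta>) * monomial \<eta>)
        = (mon (partner \<kappa>) - (\<Sum>\<eta>\<in>indices D. cst (g \<eta>) * monomial \<eta>)) + cst a * (\<Sum>\<eta>\<in>indices D. cst (f \<eta>) * monomial \<eta>)"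
      by (simp only: eq diff_diff_eq2 diff_add_eq)
    also have "\<dots> \<in> J" by (intro is_ideal_add is_ideal_mult J_ideal g f)
    finally show ?thesis by (rule exI[of _ "\<lambda>\<eta>. g \<eta> - a * f \<eta>"])
  qed
  ultimately obtain d where d: "\<exists>\<kappa>\<in>indices D. d \<kappa> \<noteq> 0" "(\<Sum>\<kappa>\<in>indices D. cst (d \<kappa>) * mon (partner \<kappa>)) \<in> J"
    using dependent_modulo_ideal[OF J_ideal, of ?B "indices D" "\<lambda>\<kappa>. mon (partner \<kappa>)" monomial] finite_indices
    by auto
  then show False
    using independent_labels[OF finite_vertices E_sym finite_indices inj_label_partner d(2)[unfolded J_def]] by blast
qed

section \<open>Unique coordinates and regularity of the \<theta>'s\<close>

definition expansion :: "('v, 'k) bpoly \<Rightarrow> nat \<Rightarrow> (index \<Rightarrow> 'k) \<Rightarrow> bool" where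
  "expansion p D f \<longleftrightarrow> (\<forall>\<iota>. f \<iota> \<noteq> 0 \<longrightarrow> \<iota> \<in> indices D) \<and> p - (\<Sum>\<iota>\<in>indices D. cst (f \<iota>) * monomial \<iota>) \<in> J"

lemma expansionI:
  "(\<And>\<iota>. f \<iota> \<noteq> 0 \<Longrightarrow> \<iota> \<in> indices D) \<Longrightarrow> p - (\<Sum>\<iota>\<in>indices D. cst (f \<iota>) * monomial \<iota>) \<in> J \<Longrightarrow> expansion p D f"
  unfolding expansion_def by blast

lemma expansion_support: "expansion p D f \<Longrightarrow> f \<iota> \<noteq> 0 \<Longrightarrow> \<iota> \<in> indices D"
  and expansion_in_J: "expansion p D f \<Longrightarrow> p - (\<Sum>\<iota>\<in>indices D. cst (f \<iota>) * monomial \<iota>) \<in> J"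
  unfolding expansion_def by blast+

lemma W_expansion: "p \<in> W D \<Longrightarrow> \<exists>f. expansion p D f"
proof -
  assume "p \<in> W D"
  then obtain f where "p - (\<Sum>\<iota>\<in>indices D. cst (f \<iota>) * monomial \<iota>) \<in> J" by (rule W_expand)
  then show ?thesis
    by (intro exI[of _ "\<lambda>\<iota>. if \<iota> \<in> indices D then f \<iota> else 0"]) (simp add: expansion_def cong: sum.cong)
qed

lemma expansion_exists: "\<exists>D f. expansion p D f"
proof -
  obtain D where D: "deg_le D p" using deg_le_exists_list[of "[p]"] by auto
  have "(\<Sum>m\<in>keys p. cst (lookup p m) * mon m) \<in> W D"
    using D by (intro W_sum W_cst mono_W) (auto simp: deg_le_def)
  then show ?thesis using W_expansion poly_mapping_expand[of p] by metis
qed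

lemma expansion_mono:
  assumes "expansion p D f" "D \<le> D'" shows "expansion p D' f"
proof -
  have "(\<Sum>\<iota>\<in>indices D. cst (f \<iota>) * monomial \<iota>) = (\<Sum>\<iota>\<in>indices D'. cst (f \<iota>) * monomial \<iota>)"
  proof (intro sum.mono_neutral_left finite_indices indices_mono assms(2) ballI)
    fix \<iota> assume "\<iota> \<in> indices D' - indices D"
    then have "f \<iota> = 0" using expansion_support[OF assms(1)] by blast
    then show "cst (f \<iota>) * monomial \<iota> = 0" by simp
  qed
  then show ?thesis
    using expansion_support[OF assms(1)] expansion_in_J[OF assms(1)] indices_mono[OF assms(2)]
    by (intro expansionI) auto
qed

lemma expansion_add:
  assumes "expansion p D f" "expansion q D g" shows "expansion (p + q) D (\<lambda>\<iota>. f \<iota> + g \<iota>)"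
proof -
  have "p + q - (\<Sum>\<iota>\<in>indices D. cst (f \<iota> + g \<iota>) * monomial \<iota>)
      = (p - (\<Sum>\<iota>\<in>indices D. cst (f \<iota>) * monomial \<iota>)) + (q - (\<Sum>\<iota>\<in>indices D. cst (g \<iota>) * monomial \<iota>))"
    by (simp add: cst_add distrib_right sum.distrib)
  also have "\<dots> \<in> J" by (intro is_ideal_add J_ideal expansion_in_J assms)
  finally show ?thesis
    using expansion_support[OF assms(1)] expansion_support[OF assms(2)] by (intro expansionI) (metis add_0)
qed

text \<open>Coefficient functions vanish outside \<open>indices D\<close>, so expansions with
  different degree bounds can be compared at the larger one.\<close>

lemma expansion_unique:
  assumes "expansion p D f" "expansion p D' g" shows "f = g"
proof
  fix \<iota>
  define N where "N = max D D'"
  have f: "expansion p N f" and g: "expansion p N g"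
    using assms expansion_mono unfolding N_def by (meson max.cobounded1 max.cobounded2)+
  have "(\<Sum>\<iota>\<in>indices N. cst (f \<iota> - g \<iota>) * monomial \<iota>)
      = (p - (\<Sum>\<iota>\<in>indices N. cst (g \<iota>) * monomial \<iota>)) - (p - (\<Sum>\<iota>\<in>indices N. cst (f \<iota>) * monomial \<iota>))"
    by (simp add: cst_diff left_diff_distrib sum_subtractf)
  also have "\<dots> \<in> J" by (intro is_ideal_diff J_ideal expansion_in_J f g)
  finally have "f \<iota> - g \<iota> = 0" if "\<iota> \<in> indices N"
    using monomials_independent[of "\<lambda>\<iota>. f \<iota> - g \<iota>" N \<iota>] that by simp
  then show "f \<iota> = g \<iota>"
    using expansion_support[OF f, of \<iota>] expansion_support[OF g, of \<iota>] by (metis eq_iff_diff_eq_0)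
qed

text \<open>Multiplication by \<theta>_j in coordinates: it permutes no coefficients but moves them
  along the injective map \<open>bump j\<close>.\<close>

definition shift :: "nat \<Rightarrow> (index \<Rightarrow> 'k) \<Rightarrow> index \<Rightarrow> 'k" where
  "shift j f \<kappa> = (if \<kappa> \<in> range (bump j) then f (inv (bump j) \<kappa>) else 0)"

lemma shift_bump: "shift j f (bump j \<iota>) = f \<iota>"
  by (simp add: shift_def inj_bump)

lemma shift_nonzero: "shift j f \<kappa> \<noteq> 0 \<Longrightarrow> \<exists>\<iota>. \<kappa> = bump j \<iota> \<and> f \<iota> \<noteq> 0"
  by (metis shift_bump shift_def rangeE)

lemma expansion_shift:
  assumes e: "expansion p D f" and j: "j < 6" shows "expansion (\<theta> j * p) (Suc D) (shift j f)"
proof -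
  note f = expansion_support[OF e]
  have "(\<Sum>\<kappa>\<in>indices (Suc D). cst (shift j f \<kappa>) * monomial \<kappa>) = (\<Sum>\<kappa>\<in>bump j ` indices D. cst (shift j f \<kappa>) * monomial \<kappa>)"
  proof (intro sum.mono_neutral_right finite_indices ballI)
    show "bump j ` indices D \<subseteq> indices (Suc D)" using bump_indices j by auto
    fix \<kappa> assume "\<kappa> \<in> indices (Suc D) - bump j ` indices D"
    then have "shift j f \<kappa> = 0" using f shift_nonzero by blast
    then show "cst (shift j f \<kappa>) * monomial \<kappa> = 0" by simp
  qed
  also have "\<dots> = (\<Sum>\<iota>\<in>indices D. cst (f \<iota>) * monomial (bump j \<iota>))"
    by (subst sum.reindex) (auto simp: shift_bump intro: inj_on_subset[OF inj_bump])
  also have "\<dots> = \<theta> j * (\<Sum>\<iota>\<in>indices D. cst (f \<iota>) * monomial \<iota>)"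
    by (simp add: monomial_bump[OF j] sum_distrib_left mult_ac)
  finally have "\<theta> j * p - (\<Sum>\<kappa>\<in>indices (Suc D). cst (shift j f \<kappa>) * monomial \<kappa>)
      = \<theta> j * (p - (\<Sum>\<iota>\<in>indices D. cst (f \<iota>) * monomial \<iota>))"
    by (simp add: right_diff_distrib)
  also have "\<dots> \<in> J" by (intro is_ideal_mult J_ideal expansion_in_J e)
  finally show ?thesis
    using f shift_nonzero bump_indices[OF _ j] by (intro expansionI) blast
qed

fun \<theta>_ideal :: "nat \<Rightarrow> ('v, 'k) bpoly set" where
  "\<theta>_ideal 0 = J"
| "\<theta>_ideal (Suc j) = adjoin (\<theta>_ideal j) (\<theta> j)"

lemma is_ideal_\<theta>_ideal: "is_ideal (\<theta>_ideal j)"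
  by (induction j) (simp_all add: J_ideal is_ideal_adjoin)

lemma \<theta>_ideal_mono: "i \<le> j \<Longrightarrow> \<theta>_ideal i \<subseteq> \<theta>_ideal j"
  by (induction j rule: dec_induct) (use adjoin_superset in auto)

lemma \<theta>_in_\<theta>_ideal: "i < j \<Longrightarrow> \<theta> i \<in> \<theta>_ideal j"
  using \<theta>_ideal_mono[of "Suc i" j] adjoin_self[OF is_ideal_\<theta>_ideal, of "\<theta> i" i] by auto

text \<open>Together with \<open>expansion_in_\<theta>_ideal\<close> this turns membership into a
  condition on the support of the coordinates, as for a monomial ideal.\<close>

lemma \<theta>_ideal_expansion:
  "p \<in> \<theta>_ideal j \<Longrightarrow> j \<le> 6 \<Longrightarrow> \<exists>D f. expansion p D f \<and> (\<forall>\<iota>. f \<iota> \<noteq> 0 \<longrightarrow> (\<exists>i<j. 0 < fst \<iota> i))"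
proof (induction j arbitrary: p)
  case 0
  then have "expansion p 0 (\<lambda>_. 0)" by (simp add: expansion_def)
  then show ?case by (intro exI[of _ 0] exI[of _ "\<lambda>_. 0"]) simp
next
  case (Suc j)
  then obtain a r where p: "p = a + r * \<theta> j" "a \<in> \<theta>_ideal j" by (auto simp: adjoin_def)
  obtain D f where f: "expansion a D f" "\<forall>\<iota>. f \<iota> \<noteq> 0 \<longrightarrow> (\<exists>i<j. 0 < fst \<iota> i)"
    using Suc.IH[OF p(2)] Suc.prems by auto
  obtain D' g where g: "expansion r D' g" using expansion_exists by blast
  define N where "N = max D (Suc D')"
  have "expansion a N f" "expansion (\<theta> j * r) N (shift j g)"
    using f(1) g expansion_shift[of r D' g j] Suc.prems expansion_mono unfolding N_def
    by (meson max.cobounded1 max.cobounded2 Suc_le_eq)+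
  then have "expansion p N (\<lambda>\<iota>. f \<iota> + shift j g \<iota>)"
    using expansion_add unfolding p(1) by (metis mult.commute)
  moreover have "\<exists>i<Suc j. 0 < fst \<iota> i" if "f \<iota> + shift j g \<iota> \<noteq> 0" for \<iota>
  proof (cases "f \<iota> = 0")
    case True
    then have "shift j g \<iota> \<noteq> 0" using that by simp
    then obtain \<kappa> where "\<iota> = bump j \<kappa>" using shift_nonzero by blast
    then have "0 < fst \<iota> j" by (simp add: bump_def)
    then show ?thesis by blast
  next
    case False
    then show ?thesis using f(2) less_SucI by blast
  qed
  ultimately show ?case by blast
qed

lemma expansion_in_\<theta>_ideal:
  assumes e: "expansion p D f" and f: "\<And>\<iota>. f \<iota> \<noteq> 0 \<Longrightarrow> \<exists>i<j. 0 < fst \<iota> i" and j: "j \<le> 6"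
  shows "p \<in> \<theta>_ideal j"
proof -
  have "cst (f \<iota>) * monomial \<iota> \<in> \<theta>_ideal j" for \<iota>
  proof (cases "f \<iota> = 0")
    case True
    then show ?thesis using is_ideal_zero[OF is_ideal_\<theta>_ideal] by simp
  next
    case False
    then obtain i where i: "i < j" "0 < fst \<iota> i" using f by blast
    obtain \<alpha> e where \<iota>: "\<iota> = (\<alpha>, e)" by (cases \<iota>)
    have "\<theta> i dvd \<theta> i ^ \<alpha> i" using i by (simp add: \<iota> dvd_power)
    also have "\<dots> dvd (\<Prod>j<6. \<theta> j ^ \<alpha> j)" using i j by (intro dvd_prodI) auto
    finally have "\<theta> i dvd monomial \<iota>" by (simp add: \<iota> dvd_mult2)
    then obtain r where "monomial \<iota> = \<theta> i * r" ..
    then show ?thesis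
      using \<theta>_in_\<theta>_ideal[OF i(1)] is_ideal_mult_right is_ideal_mult is_ideal_\<theta>_ideal by metis
  qed
  then have "(\<Sum>\<iota>\<in>indices D. cst (f \<iota>) * monomial \<iota>) \<in> \<theta>_ideal j"
    by (intro is_ideal_sum is_ideal_\<theta>_ideal)
  moreover have "p - (\<Sum>\<iota>\<in>indices D. cst (f \<iota>) * monomial \<iota>) \<in> \<theta>_ideal j"
    using expansion_in_J[OF e] \<theta>_ideal_mono[of 0 j] by auto
  ultimately show ?thesis using is_ideal_cong[OF is_ideal_\<theta>_ideal] by blast
qed

text \<open>\<open>bump j\<close> leaves the exponents below \<open>j\<close> unchanged, so
  \<theta>_j g and g satisfy the same support condition.\<close>

lemma nzd_\<theta>: "j < 6 \<Longrightarrow> nzd (\<theta>_ideal j) (\<theta> j)"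
  unfolding nzd_def
proof (intro allI impI)
  fix g assume j: "j < 6" and g: "\<theta> j * g \<in> \<theta>_ideal j"
  obtain D f where f: "expansion (\<theta> j * g) D f" "\<And>\<iota>. f \<iota> \<noteq> 0 \<Longrightarrow> \<exists>i<j. 0 < fst \<iota> i"
    using \<theta>_ideal_expansion[OF g less_imp_le[OF j]] by blast
  obtain D' h where h: "expansion g D' h" using expansion_exists by blast
  have fh: "f = shift j h" by (rule expansion_unique[OF f(1) expansion_shift[OF h j]])
  show "g \<in> \<theta>_ideal j"
  proof (rule expansion_in_\<theta>_ideal[OF h])
    fix \<iota> assume "h \<iota> \<noteq> 0"
    then have "f (bump j \<iota>) \<noteq> 0" by (simp add: fh shift_bump)
    then show "\<exists>i<j. 0 < fst \<iota> i" using f(2)[of "bump j \<iota>"] by (auto simp: bump_def)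
  qed (use j in simp)
qed

lemma reg_list_\<theta>: "reg_list J (map \<theta> [0..<6])"
proof -
  have "n \<le> 6 \<Longrightarrow> reg_list (\<theta>_ideal (6 - n)) (map \<theta> [6 - n..<6])" for n
  proof (induction n)
    case (Suc n)
    define i where "i = 6 - Suc n"
    have i: "i < 6" "6 - n = Suc i" using Suc.prems by (auto simp: i_def)
    then have "[i..<6] = i # [Suc i..<6]" by (intro upt_conv_Cons)
    then show ?case
      unfolding i_def[symmetric] using Suc.IH Suc.prems nzd_\<theta>[OF i(1)] i by simp
  qed simp
  from this[of 6] show ?thesis by simp
qed

section \<open>Depth and dimension of the 6-cycle\<close>

lemma depth_ge: "enat 6 \<le> S_depth J"
proof -
  let ?fs = "map \<theta> [0..<6]"
  have max: "is_ideal (max_ideal_S :: ('v, 'k) bpoly set)" by (simp add: max_ideal_S_def is_ideal_gen)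
  have "avar v \<in> max_ideal_S" "bvar v \<in> max_ideal_S" for v :: 'v
    unfolding max_ideal_S_def by (rule subsetD[OF ideal_gen_superset], simp)+
  then have "set ?fs \<subseteq> max_ideal_S" using is_ideal_diff[OF max] by (auto simp: \<theta>_def)
  moreover have "1 \<notin> ideal_gen (J \<union> set ?fs)"
  proof
    \<comment> \<open>Evaluation at the origin kills J and the \<theta>'s but not 1.\<close>
    let ?ev = "poly_eval (\<lambda>_. 0 :: (nat \<Rightarrow>\<^sub>0 nat) \<Rightarrow>\<^sub>0 'k)"
    assume one: "1 \<in> ideal_gen (J \<union> set ?fs)"
    have zero: "?ev p = 0" if "p \<in> J \<union> set ?fs" for p
      using that
    proof
      assume "p \<in> J"
      then show ?thesis
        unfolding J_def binomial_edge_ideal_def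
        by (rule ideal_gen_poly_eval_zero[rotated]) (auto simp: poly_eval_diff poly_eval_mult)
    qed (auto simp: \<theta>_def poly_eval_diff)
    show False using ideal_gen_poly_eval_zero[OF zero one] by simp
  qed
  ultimately have "regular_seq_quot J max_ideal_S ?fs"
    using reg_list_\<theta> unfolding reg_list_iff[OF J_ideal] by (simp add: regular_seq_quot_def nzd_def)
  then have "enat (length ?fs) \<in> {enat (length fs) | fs. regular_seq_quot J max_ideal_S fs}" by blast
  from Sup_upper[OF this] show ?thesis unfolding S_depth_def depth_quot_def by simp
qed

text \<open>Off \<open>T\<close>, lying in a common minor of \<open>P\<close> is an equivalence by
  the Pluecker relations and primality, and it relates neighbours. For empty \<open>T\<close> there
  is one class, giving 6 + 1; otherwise each class contains an arc running up to a vertex of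
  \<open>T\<close>, so there are at most |T| classes and the total is at most 6.\<close>

lemma dim_le: "S_dim J \<le> enat 7"
proof (rule dim_le_minors)
  fix P :: "('v, 'k) bpoly set" assume P: "prime_ideal P" and JP: "J \<subseteq> P"
  have I: "is_ideal P" using P by (simp add: prime_ideal_def)
  define T where "T = {v. avar v \<in> P \<and> bvar v \<in> P}"
  define cl where "cl v = {w. w \<notin> T \<and> minor v w \<in> P}" for v
  have sym: "minor w v \<in> P" if "minor v w \<in> P" for v w
    using is_ideal_minus[OF I that] by simp
  have trans: "minor v u \<in> P" if "minor v w \<in> P" "minor w u \<in> P" "w \<notin> T" for v w u
  proof -
    have "avar w * minor v u \<in> P" "bvar w * minor v u \<in> P"
      unfolding avar_minor[of w v u] bvar_minor[of w v u] by (intro is_ideal_add is_ideal_mult I that)+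
    then show ?thesis using P that(3) unfolding prime_ideal_def T_def by blast
  qed
  have "minors_ideal P T cl"
  proof
    show "finite (UNIV :: 'v set)" by (rule finite_vertices)
    show "minor v w \<in> P" if "v \<notin> T" "w \<notin> T" "cl v = cl w" for v w
    proof -
      have "w \<in> cl w" using that is_ideal_zero[OF I] by (simp add: cl_def)
      then have "w \<in> cl v" using that(3) by simp
      then show ?thesis by (simp add: cl_def)
    qed
  qed (auto simp: T_def I)
  moreover have "card (- T) + card (cl ` (- T)) \<le> 7"
  proof -
    have finT: "finite A" for A :: "'v set" by (rule finite_subset[OF subset_UNIV finite_vertices])
    have "card (- T) = 6 - card T"
      unfolding Compl_eq_Diff_UNIV using finT card_vertices by (simp add: card_Diff_subset)
    moreover have "card T \<le> 6" using card_mono[OF finite_vertices, of T] card_vertices by simp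
    ultimately have cT: "card (- T) + card T = 6" by simp
    have edge: "minor (c j) (c (Suc j)) \<in> P" for j
      using JP minor_in_binomial_edge_ideal[of E "c j" "c (Suc j)"] E_iff unfolding J_def by blast
    have next_cl: "cl (c j) = cl (c (Suc j))" if "c j \<notin> T" "c (Suc j) \<notin> T" for j
      using trans[OF edge[of j] _ that(2)] trans[OF sym[OF edge[of j]] _ that(1)] unfolding cl_def by blast
    show ?thesis
    proof (cases "T = {}")
      case True
      have const: "cl (c j) = cl (c 0)" for j
      proof (induction j)
        case (Suc j)
        then show ?case using next_cl[of j] True by simp
      qed simp
      have "cl v = cl (c 0)" for v using const c_surj[of v] by blast
      then have "cl ` (- T) \<subseteq> {cl (c 0)}" by blast
      then have "card (cl ` (- T)) \<le> 1" using card_mono[of "{cl (c 0)}" "cl ` (- T)"] by simp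
      then show ?thesis using cT by simp
    next
      case False
      \<comment> \<open>The class of the preceding vertex, since adding 5 is subtracting 1 modulo
        6.\<close>
      define pred where "pred t = cl (c (inv_into {..<6} c t + 5))" for t
      have pred: "pred (c (Suc j)) = cl (c j)" for j
      proof -
        have "inv_into {..<6} c (c (Suc j)) = Suc j mod 6"
          using c_mod[of "Suc j"] c_inj by (intro inv_into_f_eq inj_onI) auto
        moreover have "(Suc j mod 6 + 5) mod 6 = j mod 6"
        proof -
          have "(Suc j mod 6 + 5) mod 6 = (Suc j + 5) mod 6" by (rule mod_add_left_eq)
          then show ?thesis by simp
        qed
        ultimately show ?thesis unfolding pred_def using c_eq_iff[of "Suc j mod 6 + 5" j] by simp
      qed
      have "cl (c i) \<in> pred ` T" if i: "c i \<notin> T" for i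
      proof -
        obtain v where v: "v \<in> T" using False by blast
        obtain t where t: "t < 6" "c t \<in> T" using c_surj[of v] v by auto
        \<comment> \<open>Going \<open>5 * i + t\<close> steps on from \<open>i\<close> ends at
          \<open>t\<close> after \<open>i\<close> full turns, so a vertex of \<open>T\<close> lies
          ahead.\<close>
        have "i + (5 * i + t) = t + i * 6" by simp
        then have "c (i + (5 * i + t)) = c t" by (simp only: c_eq_iff mod_mult_self1)
        then have ex: "\<exists>n. c (i + n) \<in> T" using t(2) by metis
        define n where "n = (LEAST n. c (i + n) \<in> T)"
        have n: "c (i + n) \<in> T" unfolding n_def using ex by (rule LeastI_ex)
        have less: "c (i + q) \<notin> T" if "q < n" for q using that not_less_Least unfolding n_def by blast
        have "n > 0" using n i by (cases n) auto
        then obtain q where q: "n = Suc q" by (cases n) auto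
        have "p \<le> q \<Longrightarrow> cl (c (i + p)) = cl (c i)" for p
        proof (induction p)
          case (Suc p)
          then show ?case using next_cl[of "i + p"] less[of p] less[of "Suc p"] q by simp
        qed simp
        then have "cl (c i) = pred (c (i + n))" using pred[of "i + q"] q by simp
        then show ?thesis using n by blast
      qed
      then have "cl v \<in> pred ` T" if "v \<notin> T" for v using c_surj[of v] that by blast
      then have "cl ` (- T) \<subseteq> pred ` T" by blast
      then have "card (cl ` (- T)) \<le> card T"
        using card_mono[of "pred ` T" "cl ` (- T)"] card_image_le[of T pred] finT by force
      then show ?thesis using cT by simp
    qed
  qed
  ultimately show "\<exists>T (cl :: 'v \<Rightarrow> 'v set). minors_ideal P T cl \<and> card (- T) + card (cl ` (- T)) \<le> 7"
    by blast
qed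

end

text \<open>The edges for i = 1 form the path x_2 - y_1 - x_1 - y_2, and those for i = 3 close it
  through x_3 and y_3.\<close>

lemma (in Gk_graph) six_cycle_3:
  assumes "k = 3"
  shows "six_cycle (Gk_edge k x y) (\<lambda>j. [x 2, y 1, x 1, y 2, x 3, y 3] ! (j mod 6))
    (binomial_edge_ideal (Gk_edge k x y) :: ('v, 'k::field) bpoly set)"
proof
  let ?c = "\<lambda>j::nat. [x 2, y 1, x 1, y 2, x 3, y 3] ! (j mod 6)"
  let ?E = "Gk_edge k x y"
  have ks: "{1..k} = {1, 2, 3}" unfolding assms by auto
  have r: "j = 0 \<or> j = 1 \<or> j = 2 \<or> j = 3 \<or> j = 4 \<or> j = 5" if "j < 6" for j :: nat
    using that by linarith
  show "?c (j + 6) = ?c j" for j by simp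
  have dist: "distinct [x 2, y 1, x 1, y 2, x 3, y 3]"
    by (simp add: x_eq_iff y_eq_iff x_neq_y x_neq_y[symmetric] assms)
  show "i = j" if "i < 6" "j < 6" "?c i = ?c j" for i j
    using that nth_eq_iff_index_eq[OF dist, of i j] by simp
  show "\<exists>j<6. v = ?c j" for v
  proof -
    have "v \<in> set [x 2, y 1, x 1, y 2, x 3, y 3]"
      by (cases v rule: vertex_cases; unfold ks; auto)
    then obtain j where "j < length [x 2, y 1, x 1, y 2, x 3, y 3]" "[x 2, y 1, x 1, y 2, x 3, y 3] ! j = v"
      unfolding in_set_conv_nth by blast
    then show ?thesis by (intro exI[of _ j]) simp
  qed
  have step: "?E (?c j) (?c (Suc j))" for j
  proof -
    have "?c j = ?c (j mod 6)" "?c (Suc j) = ?c (Suc (j mod 6))" by (simp_all add: mod_Suc_eq)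
    moreover have "?E (?c i) (?c (Suc i))" if "i < 6" for i
      using r[OF that] edges[of 1] edges[of 3] assms by auto
    ultimately show ?thesis by (metis mod_less_divisor zero_less_numeral)
  qed
  show "?E u v \<longleftrightarrow> (\<exists>j. u = ?c j \<and> v = ?c (Suc j) \<or> u = ?c (Suc j) \<and> v = ?c j)" for u v
  proof
    assume "?E u v"
    then obtain i where i: "i = 1 \<or> i = 3" and e: "{u, v} = {x 2, y i} \<or> {u, v} = {x i, y 2} \<or> {u, v} = {x i, y i}"
      unfolding Gk_edge_def ks by auto
    have "{x 2, y 1} = {?c 0, ?c (Suc 0)}" "{x 1, y 1} = {?c 1, ?c (Suc 1)}" "{x 1, y 2} = {?c 2, ?c (Suc 2)}"
      "{x 3, y 2} = {?c 3, ?c (Suc 3)}" "{x 3, y 3} = {?c 4, ?c (Suc 4)}" "{x 2, y 3} = {?c 5, ?c (Suc 5)}"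
      by auto
    with i e have "\<exists>j. {u, v} = {?c j, ?c (Suc j)}" by metis
    then show "\<exists>j. u = ?c j \<and> v = ?c (Suc j) \<or> u = ?c (Suc j) \<and> v = ?c j"
      by (auto simp: doubleton_eq_iff)
  next
    assume "\<exists>j. u = ?c j \<and> v = ?c (Suc j) \<or> u = ?c (Suc j) \<and> v = ?c j"
    then show "?E u v" using step Gk_edge_sym by metis
  qed
qed simp

theorem theorem4p6:
  fixes k :: nat and x y :: "nat \<Rightarrow> 'v"
  assumes "k \<ge> 3"
    and "inj_on x {1..k}" and "inj_on y {1..k}"
    and "x ` {1..k} \<inter> y ` {1..k} = {}"
    and "(UNIV :: 'v set) = x ` {1..k} \<union> y ` {1..k}"
  defines "J \<equiv> (binomial_edge_ideal (Gk_edge k x y) :: ('v, 'K::field) bpoly set)"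
  shows "\<not> cohen_macaulay_quot J
    \<and> (k = 3 \<longrightarrow> S_dim J = S_depth J + 1)
    \<and> (k \<ge> 4 \<longrightarrow> S_depth J + enat (k - 3) \<le> S_dim J)"
proof -
  interpret Gk_graph k x y by unfold_locales (use assms(1-5) in auto)
  have depth: "S_depth J \<le> enat (2 * k)" unfolding J_def by (rule depth_le)
  have dim: "enat (3 * k - 3) \<le> S_dim J" "enat (2 * k + 1) \<le> S_dim J"
    unfolding J_def by (rule dim_ge_cut, rule dim_ge_connected)
  \<comment> \<open>The empty cut settles this for every k, since 2k < 2k + 1; the cut {x_2, y_2}
    alone would not do so for k = 3.\<close>
  have "S_depth J \<noteq> S_dim J"
    using depth dim(2) by (metis Suc_eq_plus1 enat_ord_simps(1) not_less_eq_eq order_trans order_refl)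
  moreover have "S_dim J = S_depth J + 1" if k: "k = 3"
  proof -
    interpret six: six_cycle "Gk_edge k x y" "\<lambda>j. [x 2, y 1, x 1, y 2, x 3, y 3] ! (j mod 6)" J
      unfolding J_def by (rule six_cycle_3[OF k])
    have "S_dim J = enat 7" using six.dim_le dim(2) k by (simp add: antisym)
    moreover have "S_depth J = enat 6" using six.depth_ge depth k by (simp add: antisym)
    ultimately show ?thesis by (simp add: one_enat_def)
  qed
  moreover have "S_depth J + enat (k - 3) \<le> S_dim J" if k: "k \<ge> 4"
  proof -
    have "S_depth J + enat (k - 3) \<le> enat (2 * k) + enat (k - 3)" by (rule add_right_mono[OF depth])
    also have "\<dots> = enat (3 * k - 3)" using k by simp
    finally show ?thesis using dim(1) by (rule order_trans)
  qed
  ultimately show ?thesis unfolding cohen_macaulay_quot_def by blast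
qed

end
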